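(* Let $\lambda,\sigma_\mu,\sigma_S>0$, $\gamma,\alpha\in\mathbb{R}$, $0<L_1<L_2$ and $x>0$, and let $Q$ be the cross moving average portfolio defined in the context. Then, for $t>L_2$, $$\begin{aligned}d\ln(Q_t)=&\left(\left(\gamma+\alpha\mathbf 1_{\{G(t,L_1)>G(t,L_2)\}}\right)\mu_t-\frac{\gamma^2\sigma_S^2}{2}-\frac{(\alpha^2+2\alpha\gamma)\sigma_S^2}{2}\mathbf 1_{\{G(t,L_1)>G(t,L_2)\}}\right)dt\\&+\left(\gamma+\alpha\mathbf 1_{\{G(t,L_1)>G(t,L_2)\}}\right)\sigma_S\,dW^S_t.\end{aligned}$$
   Context: Market model: $(W^S,W^\mu)$ is a two-dimensional Wiener process with independent components. The risky asset price $S$ (with $S_0>0$ a constant) and its trend $\mu$ satisfy $$\frac{dS_t}{S_t}=\mu_t\,dt+\sigma_S\,dW^S_t,\qquad d\mu_t=-\lambda\mu_t\,dt+\sigma_\mu\,dW^\mu_t,\qquad \mu_0=0,$$ with constants $\lambda,\sigma_\mu,\sigma_S>0$. Geometric moving average of the price at time $t$ on a window $L$ ($0<L<t$): $G(t,L)=\exp\left(\frac1L\int_{t-L}^t\log(S_u)\,du\right)$. Cross moving average portfolio: for $t>L_2$, $$\frac{dQ_t}{Q_t}=\theta_t\frac{dS_t}{S_t},\qquad \theta_t=\gamma+\alpha\mathbf 1_{\{G(t,L_1)>G(t,L_2)\}},$$ with initial wealth $Q_0=x>0$. Trading starts at time $L_2$, that is, $Q_t=x$ for $0\le t\le L_2$.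 *)

theory Defs
  imports "HOL-Probability.Probability"
begin

section \<open>Wiener processes on a filtered probability space\<close>

text \<open>Time is \<^typ>\<open>real\<close>, but only the indices \<open>t \<ge> 0\<close> are used. A filtration indexed by
  \<open>t \<ge> 0\<close> extends to negative times by the trivial sigma-algebra. No usual conditions are imposed:
  both the raw and the augmented filtration of the Wiener process are instances.\<close>

locale filtered_prob_space = prob_space M + filtration "space M" F
  for M :: "'a measure" and F :: "real \<Rightarrow> 'a measure" +
  assumes subalg: "\<And>t. subalgebra M (F t)"

definition wiener_process ::
    "'a measure \<Rightarrow> (real \<Rightarrow> 'a measure) \<Rightarrow> (real \<Rightarrow> 'a \<Rightarrow> real) \<Rightarrow> bool" where
  "wiener_process M F W \<longleftrightarrow>
     (\<forall>t\<ge>0. W t \<in> borel_measurable (F t)) \<and>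
     (AE \<omega> in M. W 0 \<omega> = 0) \<and>
     (AE \<omega> in M. continuous_on {0..} (\<lambda>t. W t \<omega>)) \<and>
     (\<forall>s t. 0 \<le> s \<and> s < t \<longrightarrow>
        distributed M lborel (\<lambda>\<omega>. W t \<omega> - W s \<omega>) (normal_density 0 (sqrt (t - s))) \<and>
        prob_space.indep_set M (sets (F s))
          (sets (vimage_algebra (space M) (\<lambda>\<omega>. W t \<omega> - W s \<omega>) borel)))"

definition wiener_process_2d ::
    "'a measure \<Rightarrow> (real \<Rightarrow> 'a measure) \<Rightarrow> (real \<Rightarrow> 'a \<Rightarrow> real) \<Rightarrow> (real \<Rightarrow> 'a \<Rightarrow> real) \<Rightarrow> bool" where
  "wiener_process_2d M F V W \<longleftrightarrow>
     wiener_process M F V \<and> wiener_process M F W \<and>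
     prob_space.indep_var M
       (\<Pi>\<^sub>M t\<in>{0..}. borel) (\<lambda>\<omega>. \<lambda>t\<in>{0..}. V t \<omega>)
       (\<Pi>\<^sub>M t\<in>{0..}. borel) (\<lambda>\<omega>. \<lambda>t\<in>{0..}. W t \<omega>) \<and>
     (\<forall>s t. 0 \<le> s \<and> s < t \<longrightarrow>
        prob_space.indep_set M (sets (F s))
          (sets (vimage_algebra (space M) (\<lambda>\<omega>. (V t \<omega> - V s \<omega>, W t \<omega> - W s \<omega>)) borel)))"

section \<open>The Ito integral\<close>

definition progressive ::
    "(real \<Rightarrow> 'a measure) \<Rightarrow> real set \<Rightarrow> (real \<Rightarrow> 'a \<Rightarrow> real) \<Rightarrow> bool" where
  "progressive F T X \<longleftrightarrow>
     (\<forall>t\<in>T. (\<lambda>(u, \<omega>). X u \<omega>) \<in> borel_measurable (restrict_space borel (T \<inter> {..t}) \<Otimes>\<^sub>M F t))"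

text \<open>Measurability is part of the definition, since \<^const>\<open>measure\<close> is 0 on non-measurable sets.\<close>

definition tendsto_in_prob :: "'a measure \<Rightarrow> (nat \<Rightarrow> 'a \<Rightarrow> real) \<Rightarrow> ('a \<Rightarrow> real) \<Rightarrow> bool" where
  "tendsto_in_prob M X Y \<longleftrightarrow>
     (\<forall>n. X n \<in> borel_measurable M) \<and> Y \<in> borel_measurable M \<and>
     (\<forall>\<epsilon>>0. (\<lambda>n. measure M {\<omega> \<in> space M. \<bar>X n \<omega> - Y \<omega>\<bar> > \<epsilon>}) \<longlonglongrightarrow> 0)"

text \<open>A list of triples \<open>(s, t, \<xi>)\<close> stands for the simple process that is the sum of the
  \<open>\<xi> 1\<^bsub>(s,t]\<^esub>\<close>, where the intervals may overlap.\<close>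

type_synonym 'a simple = "(real \<times> real \<times> ('a \<Rightarrow> real)) list"

definition simple_on :: "(real \<Rightarrow> 'a measure) \<Rightarrow> real \<Rightarrow> real \<Rightarrow> 'a simple \<Rightarrow> bool" where
  "simple_on F a b hs \<longleftrightarrow>
     (\<forall>(s, t, \<xi>) \<in> set hs. a \<le> s \<and> s \<le> t \<and> t \<le> b \<and>
        \<xi> \<in> borel_measurable (F s) \<and> (\<exists>C. \<forall>\<omega>\<in>space (F s). \<bar>\<xi> \<omega>\<bar> \<le> C))"

definition simple_process :: "'a simple \<Rightarrow> real \<Rightarrow> 'a \<Rightarrow> real" where
  "simple_process hs u \<omega> = (\<Sum>(s, t, \<xi>)\<leftarrow>hs. \<xi> \<omega> * indicator {s<..t} u)"

definition simple_integral :: "(real \<Rightarrow> 'a \<Rightarrow> real) \<Rightarrow> 'a simple \<Rightarrow> 'a \<Rightarrow> real" where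
  "simple_integral W hs \<omega> = (\<Sum>(s, t, \<xi>)\<leftarrow>hs. \<xi> \<omega> * (W t \<omega> - W s \<omega>))"

text \<open>\<open>has_ito_integral M F W H a b I\<close>: the random variable \<open>I\<close> is (a version of) the Ito integral of
  \<open>H\<close> against \<open>W\<close> over \<open>[a, b]\<close>, for progressive \<open>H\<close> with almost surely square integrable paths.\<close>

definition has_ito_integral ::
    "'a measure \<Rightarrow> (real \<Rightarrow> 'a measure) \<Rightarrow> (real \<Rightarrow> 'a \<Rightarrow> real) \<Rightarrow> (real \<Rightarrow> 'a \<Rightarrow> real) \<Rightarrow>
      real \<Rightarrow> real \<Rightarrow> ('a \<Rightarrow> real) \<Rightarrow> bool" where
  "has_ito_integral M F W H a b I \<longleftrightarrow>
     progressive F {a..b} H \<and>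
     (AE \<omega> in M. set_integrable lborel {a..b} (\<lambda>u. (H u \<omega>)\<^sup>2)) \<and>
     (\<exists>hs. (\<forall>n. simple_on F a b (hs n)) \<and>
        tendsto_in_prob M
          (\<lambda>n \<omega>. set_lebesgue_integral lborel {a..b} (\<lambda>u. (simple_process (hs n) u \<omega> - H u \<omega>)\<^sup>2))
          (\<lambda>_. 0) \<and>
        tendsto_in_prob M (\<lambda>n. simple_integral W (hs n)) I)"

section \<open>Stochastic differentials\<close>

text \<open>\<open>has_differential M F W t0 X b s\<close>: \<open>X\<close> is an Ito process on \<open>[t0, \<infinity>)\<close> with
  \<open>dX = b dt + s dW\<close>.\<close>

definition has_differential ::
    "'a measure \<Rightarrow> (real \<Rightarrow> 'a measure) \<Rightarrow> (real \<Rightarrow> 'a \<Rightarrow> real) \<Rightarrow> real \<Rightarrow>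
      (real \<Rightarrow> 'a \<Rightarrow> real) \<Rightarrow> (real \<Rightarrow> 'a \<Rightarrow> real) \<Rightarrow> (real \<Rightarrow> 'a \<Rightarrow> real) \<Rightarrow> bool" where
  "has_differential M F W t0 X b s \<longleftrightarrow>
     progressive F {t0..} X \<and> progressive F {t0..} b \<and> progressive F {t0..} s \<and>
     (AE \<omega> in M. continuous_on {t0..} (\<lambda>t. X t \<omega>)) \<and>
     (AE \<omega> in M. \<forall>t\<ge>t0. set_integrable lborel {t0..t} (\<lambda>u. b u \<omega>)) \<and>
     (AE \<omega> in M. \<forall>t\<ge>t0. set_integrable lborel {t0..t} (\<lambda>u. (s u \<omega>)\<^sup>2)) \<and>
     (\<forall>t\<ge>t0. has_ito_integral M F W s t0 t
        (\<lambda>\<omega>. X t \<omega> - X t0 \<omega> - set_lebesgue_integral lborel {t0..t} (\<lambda>u. b u \<omega>)))"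

text \<open>\<open>has_differential_wrt M F W t0 Y H X\<close>: \<open>dY = H dX\<close> on \<open>[t0, \<infinity>)\<close> for an Ito process \<open>X\<close>,
  where \<open>H dX\<close> means \<open>H b dt + H s dW\<close> if \<open>dX = b dt + s dW\<close>. The coefficients \<open>b\<close> and \<open>s\<close> are
  determined by \<open>X\<close> up to null sets, so their choice is irrelevant.\<close>

definition has_differential_wrt ::
    "'a measure \<Rightarrow> (real \<Rightarrow> 'a measure) \<Rightarrow> (real \<Rightarrow> 'a \<Rightarrow> real) \<Rightarrow> real \<Rightarrow>
      (real \<Rightarrow> 'a \<Rightarrow> real) \<Rightarrow> (real \<Rightarrow> 'a \<Rightarrow> real) \<Rightarrow> (real \<Rightarrow> 'a \<Rightarrow> real) \<Rightarrow> bool" where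
  "has_differential_wrt M F W t0 Y H X \<longleftrightarrow>
     progressive F {t0..} H \<and>
     (\<exists>b s. has_differential M F W t0 X b s) \<and>
     (\<forall>b s. has_differential M F W t0 X b s \<longrightarrow>
        has_differential M F W t0 Y (\<lambda>t \<omega>. H t \<omega> * b t \<omega>) (\<lambda>t \<omega>. H t \<omega> * s t \<omega>))"

section \<open>Geometric moving averages\<close>

definition geometric_average :: "(real \<Rightarrow> 'a \<Rightarrow> real) \<Rightarrow> real \<Rightarrow> real \<Rightarrow> 'a \<Rightarrow> real" where
  "geometric_average S t L \<omega> =
     exp (1 / L * set_lebesgue_integral lborel {t - L..t} (\<lambda>u. ln (S u \<omega>)))"

definition cross_signal :: "(real \<Rightarrow> 'a \<Rightarrow> real) \<Rightarrow> real \<Rightarrow> real \<Rightarrow> real \<Rightarrow> 'a \<Rightarrow> real" where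
  "cross_signal S L1 L2 t \<omega> =
     (if geometric_average S t L1 \<omega> > geometric_average S t L2 \<omega> then 1 else 0)"

end

theory Submission
  imports Defs
begin

text \<open>Since \<open>S\<close> never vanishes, \<open>dQ = Q (\<theta> \<mu> dt + \<theta> \<sigma>\<^sub>S dW)\<close>, and the claim is Ito's formula for the
  logarithm. Ito's formula for a function with bounded derivatives is proved by Taylor expansion along
  uniform grids: the integrand is replaced by a step process on the grid, and every error is controlled
  in probability by the isometry for a process that is switched off once its quadratic variation
  exceeds a level \<open>d\<close>. Along a subsequence all errors vanish almost surely, and what remains is a
  statement about a single path.

  Positivity of a solution of \<open>dX = X (\<beta> dt + \<phi> dW)\<close> follows by applying the formula to
  \<open>ln (X\<^sup>2 + \<epsilon>\<^sup>2) / 2\<close>: drift and diffusion of this process are bounded by those of the logarithm, uniformly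
  in \<open>\<epsilon>\<close>, so by a maximal inequality it cannot tend to \<open>- \<infinity>\<close> anywhere on a bounded interval. Then \<open>\<epsilon>\<close>
  tends to \<open>0\<close>.\<close>

section \<open>Convergence in probability\<close>

text \<open>The integrands are only almost surely square integrable and
  \<open>has_ito_integral\<close> is a limit in probability, so the L2 isometry cannot be applied to
  the integrand itself. Every estimate therefore has the form \<open>d\<close> plus the size in
  probability of (quadratic variation) / \<open>d\<close>, with \<open>d\<close> free. A second
  obstacle is that \<open>has_ito_integral\<close> speaks of one interval at a time: integrals up to
  different times are versions that may come from unrelated approximating sequences. They are tied
  together by cutting down the approximants of the largest interval (\<open>clip\<close>,
  \<open>restriction_tendsto\<close>). The mesh of a grid is chosen after the bound \<open>C\<close>
  of the sampled process, because the compensated squares of the increments of \<open>W\<close> cost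
  \<open>C ^ 4\<close> divided by the number of cells. The hypotheses fix the signs of
  \<open>S\<close> and \<open>Q\<close> only at the start, while the integrand of \<open>Q\<close>
  contains a division by \<open>S\<close>. Positivity is thus proved twice: for \<open>S\<close>
  from time 0, where it cancels the division, and for \<open>Q\<close> from
  \<open>L\<^sub>2\<close>. The derivatives of the logarithm are unbounded near 0; regularising it
  takes the place of localisation at exit times.\<close>

definition prob_norm :: "'a measure \<Rightarrow> ('a \<Rightarrow> real) \<Rightarrow> real" where
  "prob_norm M Z = (\<integral>\<omega>. min 1 \<bar>Z \<omega>\<bar> \<partial>M)"

context prob_space
begin

lemma prob_norm_integrable:
  assumes [measurable]: "Z \<in> borel_measurable M"
  shows "integrable M (\<lambda>\<omega>. min 1 \<bar>Z \<omega>\<bar> :: real)"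
  by (rule integrable_const_bound[where B=1]) auto

lemma prob_norm_nonneg: "0 \<le> prob_norm M Z"
  unfolding prob_norm_def by (rule integral_nonneg_AE) auto

lemma prob_norm_mono_AE:
  assumes [measurable]: "X \<in> borel_measurable M" "Y \<in> borel_measurable M"
    and "AE \<omega> in M. \<bar>X \<omega>\<bar> \<le> \<bar>Y \<omega>\<bar>"
  shows "prob_norm M X \<le> prob_norm M Y"
  unfolding prob_norm_def
  by (rule integral_mono_AE) (use assms(3) in \<open>auto intro!: prob_norm_integrable\<close>)

lemma prob_norm_add:
  assumes [measurable]: "X \<in> borel_measurable M" "Y \<in> borel_measurable M"
  shows "prob_norm M (\<lambda>\<omega>. X \<omega> + Y \<omega>) \<le> prob_norm M X + prob_norm M Y"
proof -
  have "prob_norm M (\<lambda>\<omega>. X \<omega> + Y \<omega>) \<le> (\<integral>\<omega>. min 1 \<bar>X \<omega>\<bar> + min 1 \<bar>Y \<omega>\<bar> \<partial>M)"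
    unfolding prob_norm_def
    by (rule integral_mono) (auto intro!: prob_norm_integrable Bochner_Integration.integrable_add)
  then show ?thesis
    by (simp add: prob_norm_def prob_norm_integrable)
qed

text \<open>The truncation at 1 breaks homogeneity: for a factor below 1 in absolute value the
  inequality fails when \<open>X\<close> is large, hence the lower bound on
  \<open>c\<close>.\<close>

lemma prob_norm_cmult:
  assumes [measurable]: "X \<in> borel_measurable M" and c: "1 \<le> \<bar>c\<bar>"
  shows "prob_norm M (\<lambda>\<omega>. c * X \<omega>) \<le> \<bar>c\<bar> * prob_norm M X"
proof -
  have "min 1 \<bar>c * y\<bar> \<le> \<bar>c\<bar> * min 1 \<bar>y\<bar>" for y
  proof (cases "\<bar>y\<bar> \<le> 1")
    case False
    then show ?thesis using c by (simp add: min_def)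
  qed (simp add: abs_mult min_def)
  then have "prob_norm M (\<lambda>\<omega>. c * X \<omega>) \<le> (\<integral>\<omega>. \<bar>c\<bar> * min 1 \<bar>X \<omega>\<bar> \<partial>M)"
    unfolding prob_norm_def by (intro integral_mono prob_norm_integrable integrable_mult_right) auto
  then show ?thesis
    by (simp add: prob_norm_def)
qed

lemma prob_norm_tendsto_AE:
  assumes [measurable]: "\<And>n. X n \<in> borel_measurable M" "Y \<in> borel_measurable M"
    and "AE \<omega> in M. (\<lambda>n. X n \<omega>) \<longlonglongrightarrow> Y \<omega>"
  shows "(\<lambda>n. prob_norm M (X n)) \<longlonglongrightarrow> prob_norm M Y"
  unfolding prob_norm_def
proof (rule integral_dominated_convergence[where w="\<lambda>_. 1"])
  show "AE \<omega> in M. (\<lambda>n. min 1 \<bar>X n \<omega>\<bar>) \<longlonglongrightarrow> min 1 \<bar>Y \<omega>\<bar>"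
    using assms(3) by eventually_elim (intro tendsto_intros)
qed auto

lemma prob_norm_tendsto_0_AE:
  assumes [measurable]: "\<And>n. X n \<in> borel_measurable M"
    and "AE \<omega> in M. (\<lambda>n. X n \<omega>) \<longlonglongrightarrow> 0"
  shows "(\<lambda>n. prob_norm M (X n)) \<longlonglongrightarrow> 0"
  using prob_norm_tendsto_AE[of X "\<lambda>_. 0"] assms(2) by (simp add: prob_norm_def)

text \<open>The truncated variables tend to 0 in L1, hence almost surely along a subsequence, and
  below 1 the truncation is inactive. Errors that have to vanish along a common subsequence are
  added up before this is applied.\<close>

lemma prob_norm_subseq:
  assumes [measurable]: "\<And>n. X n \<in> borel_measurable M"
    and "(\<lambda>n. prob_norm M (X n)) \<longlonglongrightarrow> 0"
  obtains r :: "nat \<Rightarrow> nat" where "strict_mono r" "AE \<omega> in M. (\<lambda>n. X (r n) \<omega>) \<longlonglongrightarrow> 0"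
proof -
  obtain r :: "nat \<Rightarrow> nat" where r: "strict_mono r"
    "AE \<omega> in M. (\<lambda>n. min 1 \<bar>X (r n) \<omega>\<bar>) \<longlonglongrightarrow> 0"
    using tendsto_L1_AE_subseq[of M "\<lambda>n \<omega>. min 1 \<bar>X n \<omega>\<bar>"] assms(2) prob_norm_integrable
    unfolding prob_norm_def by auto
  have "AE \<omega> in M. (\<lambda>n. X (r n) \<omega>) \<longlonglongrightarrow> 0"
    using r(2)
  proof eventually_elim
    case (elim \<omega>)
    have "eventually (\<lambda>n. min 1 \<bar>X (r n) \<omega>\<bar> < 1) sequentially"
      using order_tendstoD(2)[OF elim] by simp
    then have "eventually (\<lambda>n. min 1 \<bar>X (r n) \<omega>\<bar> = \<bar>X (r n) \<omega>\<bar>) sequentially"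
      by eventually_elim (auto simp: min_def split: if_splits)
    then show ?case
      using elim tendsto_rabs_zero_iff tendsto_cong by fastforce
  qed
  with r(1) that show ?thesis by blast
qed

text \<open>\<open>prob_norm\<close> of a difference is the standard metric of convergence in
  probability. It is subadditive and compatible with dominated convergence, so all later estimates
  are carried out with it.\<close>

lemma tendsto_in_prob_iff_prob_norm:
  assumes [measurable]: "\<And>n. X n \<in> borel_measurable M" "Y \<in> borel_measurable M"
  shows "tendsto_in_prob M X Y \<longleftrightarrow> (\<lambda>n. prob_norm M (\<lambda>\<omega>. X n \<omega> - Y \<omega>)) \<longlonglongrightarrow> 0"
proof
  assume "tendsto_in_prob M X Y"
  then have P: "\<And>e. e > 0 \<Longrightarrow> (\<lambda>n. prob {\<omega> \<in> space M. \<bar>X n \<omega> - Y \<omega>\<bar> > e}) \<longlonglongrightarrow> 0"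
    by (auto simp: tendsto_in_prob_def)
  show "(\<lambda>n. prob_norm M (\<lambda>\<omega>. X n \<omega> - Y \<omega>)) \<longlonglongrightarrow> 0"
  proof (rule LIMSEQ_I)
    fix e :: real assume e: "0 < e"
    \<comment> \<open>Where the difference is at most \<open>e / 2\<close> it contributes at most
      that much; elsewhere the truncation caps it at 1, which integrates to the probability.\<close>
    have le: "prob_norm M (\<lambda>\<omega>. X n \<omega> - Y \<omega>) \<le> e / 2 + prob {\<omega> \<in> space M. \<bar>X n \<omega> - Y \<omega>\<bar> > e / 2}" for n
    proof -
      have "prob_norm M (\<lambda>\<omega>. X n \<omega> - Y \<omega>)
          \<le> (\<integral>\<omega>. e / 2 + indicator {\<omega> \<in> space M. \<bar>X n \<omega> - Y \<omega>\<bar> > e / 2} \<omega> \<partial>M)"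
        unfolding prob_norm_def using e
        by (intro integral_mono prob_norm_integrable Bochner_Integration.integrable_add
              integrable_real_indicator)
           (auto simp: less_top[symmetric] min_def split: split_indicator)
      also have "\<dots> = e / 2 + prob {\<omega> \<in> space M. \<bar>X n \<omega> - Y \<omega>\<bar> > e / 2}"
        by (subst Bochner_Integration.integral_add) (auto simp: prob_space less_top[symmetric])
      finally show ?thesis .
    qed
    obtain N where "\<And>n. n \<ge> N \<Longrightarrow> prob {\<omega> \<in> space M. \<bar>X n \<omega> - Y \<omega>\<bar> > e / 2} < e / 2"
      using LIMSEQ_D[OF P[of "e/2"], of "e/2"] e by (auto simp: measure_nonneg)
    then show "\<exists>N. \<forall>n\<ge>N. norm (prob_norm M (\<lambda>\<omega>. X n \<omega> - Y \<omega>) - 0) < e"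
      using le prob_norm_nonneg by (intro exI[of _ N]) (smt (verit) field_sum_of_halves real_norm_def)
  qed
next
  assume L: "(\<lambda>n. prob_norm M (\<lambda>\<omega>. X n \<omega> - Y \<omega>)) \<longlonglongrightarrow> 0"
  show "tendsto_in_prob M X Y"
    unfolding tendsto_in_prob_def
  proof (intro conjI allI impI)
    fix e :: real assume e: "0 < e"
    \<comment> \<open>On the event in question the truncated difference is at least
      \<open>min 1 e\<close>; dividing by this value gives Markov's inequality for the
      truncation.\<close>
    define c where "c = min 1 e"
    have c: "0 < c" using e by (simp add: c_def)
    have le: "prob {\<omega> \<in> space M. \<bar>X n \<omega> - Y \<omega>\<bar> > e} \<le> prob_norm M (\<lambda>\<omega>. X n \<omega> - Y \<omega>) / c" for n
    proof -
      have "prob {\<omega> \<in> space M. \<bar>X n \<omega> - Y \<omega>\<bar> > e} = (\<integral>\<omega>. indicator {\<omega> \<in> space M. \<bar>X n \<omega> - Y \<omega>\<bar> > e} \<omega> \<partial>M)"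
        by simp
      also have "\<dots> \<le> (\<integral>\<omega>. min 1 \<bar>X n \<omega> - Y \<omega>\<bar> / c \<partial>M)"
        using e c by (intro integral_mono integrable_real_indicator integrable_divide_zero prob_norm_integrable)
          (auto simp: less_top[symmetric] c_def split: split_indicator)
      finally show ?thesis by (simp add: prob_norm_def)
    qed
    show "(\<lambda>n. prob {\<omega> \<in> space M. \<bar>X n \<omega> - Y \<omega>\<bar> > e}) \<longlonglongrightarrow> 0"
    proof (rule tendsto_sandwich[of "\<lambda>_. 0"])
      show "(\<lambda>n. prob_norm M (\<lambda>\<omega>. X n \<omega> - Y \<omega>) / c) \<longlonglongrightarrow> 0"
        using tendsto_divide[OF L tendsto_const[of c]] c by simp
    qed (auto simp: le)
  qed auto
qed

lemma tendsto_in_prob_AE: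
  assumes [measurable]: "\<And>n. X n \<in> borel_measurable M" "Y \<in> borel_measurable M"
    and "AE \<omega> in M. (\<lambda>n. X n \<omega>) \<longlonglongrightarrow> Y \<omega>"
  shows "tendsto_in_prob M X Y"
proof -
  have "AE \<omega> in M. (\<lambda>n. X n \<omega> - Y \<omega>) \<longlonglongrightarrow> 0"
    using assms(3) by eventually_elim (rule LIM_zero)
  then show ?thesis
    by (subst tendsto_in_prob_iff_prob_norm) (auto intro!: prob_norm_tendsto_0_AE)
qed

end

section \<open>Sums of independent increments with adapted coefficients\<close>

text \<open>A discrete skeleton of the driving noise. It is instantiated twice: with the increments
  of \<open>W\<close>, where \<delta> is the length of a cell, and with the compensated squares of
  these increments, which carry the quadratic variation.\<close>

locale increments = prob_space M for M :: "'a measure" +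
  fixes G :: "nat \<Rightarrow> 'a measure" and D :: "nat \<Rightarrow> 'a \<Rightarrow> real" and \<delta> :: "nat \<Rightarrow> real" and N :: nat
  assumes sub: "\<And>j. j \<le> N \<Longrightarrow> subalgebra M (G j)"
    and mono_G: "\<And>i j. i \<le> j \<Longrightarrow> j \<le> N \<Longrightarrow> sets (G i) \<subseteq> sets (G j)"
    and D_meas: "\<And>j. j < N \<Longrightarrow> D j \<in> borel_measurable (G (Suc j))"
    and D_sq: "\<And>j. j < N \<Longrightarrow> integrable M (\<lambda>\<omega>. (D j \<omega>)\<^sup>2)"
    and D_mean: "\<And>j. j < N \<Longrightarrow> expectation (D j) = 0"
    and D_var: "\<And>j. j < N \<Longrightarrow> expectation (\<lambda>\<omega>. (D j \<omega>)\<^sup>2) = \<delta> j"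
    and D_indep: "\<And>j. j < N \<Longrightarrow>
      indep_set (sets (G j)) (sets (vimage_algebra (space M) (D j) borel))"
begin

lemma meas_G: "i \<le> j \<Longrightarrow> j \<le> N \<Longrightarrow> X \<in> borel_measurable (G i) \<Longrightarrow> X \<in> borel_measurable (G j)"
  by (rule measurable_from_subalg[of "G j" "G i"])
     (use sub[of i] sub[of j] mono_G[of i j] in \<open>auto simp: subalgebra_def\<close>)

lemma meas_M: "j \<le> N \<Longrightarrow> X \<in> borel_measurable (G j) \<Longrightarrow> X \<in> borel_measurable M"
  by (rule measurable_from_subalg[OF sub])

lemma D_meas_M: "j < N \<Longrightarrow> D j \<in> borel_measurable M"
  using meas_M[of "Suc j"] D_meas by auto

lemma \<delta>_nonneg: "j < N \<Longrightarrow> 0 \<le> \<delta> j"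
  using D_var[of j] by (metis (no_types, lifting) integral_nonneg_AE AE_I2 zero_le_power2)

lemma indep_var_D:
  assumes j: "j < N" and Y: "Y \<in> borel_measurable (G j)"
  shows "indep_var borel Y borel (D j)"
  unfolding indep_var_eq
proof (intro conjI)
  show 1: "random_variable borel Y" using meas_M[OF _ Y] j by simp
  show 2: "random_variable borel (D j)" using D_meas_M j by simp
  have spG: "space (G j) = space M"
    using sub[of j] j by (auto simp: subalgebra_def)
  have "sigma_sets (space M) {Y -` A \<inter> space M |A. A \<in> sets borel} \<subseteq> sets (G j)"
    unfolding spG[symmetric]
    by (rule sets.sigma_sets_subset) (use measurable_sets[OF Y] in auto)
  moreover have "sigma_sets (space M) {D j -` A \<inter> space M |A. A \<in> sets borel} =
      sets (vimage_algebra (space M) (D j) borel)"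
    by (simp add: sets_vimage_algebra)
  ultimately show "indep_set (sigma_sets (space M) {Y -` A \<inter> space M |A. A \<in> sets borel})
     (sigma_sets (space M) {D j -` A \<inter> space M |A. A \<in> sets borel})"
    using D_indep[OF j] unfolding indep_sets2_eq by blast
qed

lemma D_integrable: "j < N \<Longrightarrow> integrable M (D j)"
  using D_sq D_meas_M square_integrable_imp_integrable by blast

text \<open>The cross term in the expansion of the square vanishes by independence.\<close>

lemma second_moment:
  assumes \<xi>: "\<And>j. j < N \<Longrightarrow> \<xi> j \<in> borel_measurable (G j)"
    and B: "\<And>j \<omega>. j < N \<Longrightarrow> \<omega> \<in> space M \<Longrightarrow> \<bar>\<xi> j \<omega>\<bar> \<le> B"
    and n: "n \<le> N"
  shows "integrable M (\<lambda>\<omega>. (\<Sum>j<n. \<xi> j \<omega> * D j \<omega>)\<^sup>2) \<and>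
    expectation (\<lambda>\<omega>. (\<Sum>j<n. \<xi> j \<omega> * D j \<omega>)\<^sup>2) = (\<Sum>j<n. expectation (\<lambda>\<omega>. (\<xi> j \<omega>)\<^sup>2) * \<delta> j)"
  using n
proof (induction n)
  case (Suc n)
  define S where "S \<omega> = (\<Sum>j<n. \<xi> j \<omega> * D j \<omega>)" for \<omega>
  have n: "n < N" using Suc by simp
  have S_G: "S \<in> borel_measurable (G n)"
    unfolding S_def using Suc.prems
    by (intro borel_measurable_sum borel_measurable_times) (auto intro: meas_G[OF _ _ \<xi>] meas_G[OF _ _ D_meas])
  have S_M[measurable]: "S \<in> borel_measurable M"
    by (rule meas_M[OF _ S_G]) (use n in simp)
  have IH: "integrable M (\<lambda>\<omega>. (S \<omega>)\<^sup>2)"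
      "expectation (\<lambda>\<omega>. (S \<omega>)\<^sup>2) = (\<Sum>j<n. expectation (\<lambda>\<omega>. (\<xi> j \<omega>)\<^sup>2) * \<delta> j)"
    using Suc by (auto simp: S_def)
  have \<xi>n: "\<xi> n \<in> borel_measurable (G n)" using \<xi> n by simp
  have [measurable]: "\<xi> n \<in> borel_measurable M" "D n \<in> borel_measurable M"
    using meas_M[OF _ \<xi>n] D_meas_M n by auto
  have S_int: "integrable M S"
    using square_integrable_imp_integrable[OF S_M IH(1)] .
  have S\<xi>_int: "integrable M (\<lambda>\<omega>. 2 * S \<omega> * \<xi> n \<omega>)"
  proof (rule Bochner_Integration.integrable_bound)
    show "integrable M (\<lambda>\<omega>. 2 * B * S \<omega>)" using S_int by simp
    show "AE \<omega> in M. norm (2 * S \<omega> * \<xi> n \<omega>) \<le> norm (2 * B * S \<omega>)"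
      using B[OF n] by (intro AE_I2) (auto simp: abs_mult, smt (verit, best) mult.commute mult_left_mono abs_ge_zero)
  qed auto
  have \<xi>2_int: "integrable M (\<lambda>\<omega>. (\<xi> n \<omega>)\<^sup>2)"
    using power_mono[OF B[OF n], of _ 2]
    by (intro integrable_const_bound[where B="B\<^sup>2"] AE_I2) auto
  have i1: "indep_var borel (\<lambda>\<omega>. 2 * S \<omega> * \<xi> n \<omega>) borel (D n)"
    by (intro indep_var_D n borel_measurable_times borel_measurable_const S_G \<xi>n)
  have i2: "indep_var borel (\<lambda>\<omega>. (\<xi> n \<omega>)\<^sup>2) borel (\<lambda>\<omega>. (D n \<omega>)\<^sup>2)"
    using indep_var_compose[OF indep_var_D[OF n \<xi>n], of "\<lambda>x. x\<^sup>2" borel "\<lambda>x. x\<^sup>2" borel]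
    by (simp add: comp_def)
  have cross: "integrable M (\<lambda>\<omega>. (2 * S \<omega> * \<xi> n \<omega>) * D n \<omega>)"
      "expectation (\<lambda>\<omega>. (2 * S \<omega> * \<xi> n \<omega>) * D n \<omega>) = 0"
    using indep_var_integrable[OF i1 S\<xi>_int D_integrable[OF n]]
      indep_var_lebesgue_integral[OF i1 S\<xi>_int D_integrable[OF n]] D_mean[OF n] by auto
  have sq: "integrable M (\<lambda>\<omega>. (\<xi> n \<omega>)\<^sup>2 * (D n \<omega>)\<^sup>2)"
      "expectation (\<lambda>\<omega>. (\<xi> n \<omega>)\<^sup>2 * (D n \<omega>)\<^sup>2) = expectation (\<lambda>\<omega>. (\<xi> n \<omega>)\<^sup>2) * \<delta> n"
    using indep_var_integrable[OF i2 \<xi>2_int D_sq[OF n]]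
      indep_var_lebesgue_integral[OF i2 \<xi>2_int D_sq[OF n]] D_var[OF n] by auto
  have eq: "(\<Sum>j<Suc n. \<xi> j \<omega> * D j \<omega>)\<^sup>2 =
      ((S \<omega>)\<^sup>2 + (2 * S \<omega> * \<xi> n \<omega>) * D n \<omega>) + (\<xi> n \<omega>)\<^sup>2 * (D n \<omega>)\<^sup>2" for \<omega>
    by (simp add: S_def power2_sum power_mult_distrib)
  show ?case
    unfolding eq using IH cross sq by simp
qed simp

text \<open>The coefficients are switched off as soon as the sum of the \<open>(\<xi> i j)\<^sup>2 * \<delta> j\<close> would exceed \<open>d\<close>.
  The remaining sums have second moment at most \<open>d\<close>, and nothing was changed unless the full sum
  exceeds \<open>d\<close>.\<close>

lemma budget_inequality:
  assumes A: "finite A"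
    and \<xi>: "\<And>i j. i \<in> A \<Longrightarrow> j < N \<Longrightarrow> \<xi> i j \<in> borel_measurable (G j)"
    and B: "\<And>i j \<omega>. i \<in> A \<Longrightarrow> j < N \<Longrightarrow> \<omega> \<in> space M \<Longrightarrow> \<bar>\<xi> i j \<omega>\<bar> \<le> B"
    and d: "0 < d"
  shows "prob_norm M (\<lambda>\<omega>. \<Sum>i\<in>A. (\<Sum>j<N. \<xi> i j \<omega> * D j \<omega>)\<^sup>2) \<le>
     d + prob_norm M (\<lambda>\<omega>. (\<Sum>i\<in>A. \<Sum>j<N. (\<xi> i j \<omega>)\<^sup>2 * \<delta> j) / d)"
proof -
  define Y where "Y k \<omega> = (\<Sum>i\<in>A. \<Sum>j<k. (\<xi> i j \<omega>)\<^sup>2 * \<delta> j)" for k \<omega>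
  \<comment> \<open>The test for \<open>j\<close> already includes the \<open>j\<close>-th terms,
    whose coefficients are known at time \<open>j\<close>. So the switch is measurable for
    \<open>G j\<close>, and the term that would overrun the level is itself dropped.\<close>
  define ok where "ok j \<omega> = (if Y (Suc j) \<omega> \<le> d then 1 else 0 :: real)" for j \<omega>
  define \<xi>' where "\<xi>' i j \<omega> = \<xi> i j \<omega> * ok j \<omega>" for i j \<omega>
  have Y_G: "Y (Suc j) \<in> borel_measurable (G j)" if "j < N" for j
    unfolding Y_def using that
    by (intro borel_measurable_sum borel_measurable_times borel_measurable_power) (auto intro!: meas_G[OF _ _ \<xi>])
  have Y_mono: "Y k \<omega> \<le> Y l \<omega>" if "k \<le> l" "l \<le> N" for k l \<omega>
    unfolding Y_def using that by (intro sum_mono sum_mono2) (auto intro!: mult_nonneg_nonneg \<delta>_nonneg)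
  have \<xi>'_G: "\<xi>' i j \<in> borel_measurable (G j)" if "i \<in> A" "j < N" for i j
  proof -
    note [measurable] = Y_G[OF that(2)] \<xi>[OF that]
    show ?thesis unfolding \<xi>'_def ok_def by measurable
  qed
  have \<xi>'_B: "\<bar>\<xi>' i j \<omega>\<bar> \<le> B" if "i \<in> A" "j < N" "\<omega> \<in> space M" for i j \<omega>
    using B[OF that] by (auto simp: \<xi>'_def ok_def)
  note [measurable] = meas_M[OF _ \<xi>] meas_M[OF _ \<xi>'_G] D_meas_M
  have [measurable]: "(\<lambda>\<omega>. \<Sum>i\<in>A. (\<Sum>j<N. \<xi> i j \<omega> * D j \<omega>)\<^sup>2) \<in> borel_measurable M"
    "(\<lambda>\<omega>. \<Sum>i\<in>A. (\<Sum>j<N. \<xi>' i j \<omega> * D j \<omega>)\<^sup>2) \<in> borel_measurable M"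
    by (intro borel_measurable_sum borel_measurable_times borel_measurable_power; simp)+
  have Y_M[measurable]: "Y N \<in> borel_measurable M"
    unfolding Y_def by (intro borel_measurable_sum borel_measurable_times borel_measurable_power) simp_all
  have sp: "(\<Sum>i\<in>A. \<Sum>j<k. (\<xi>' i j \<omega>)\<^sup>2 * \<delta> j) \<le> d" if "k \<le> N" for k \<omega>
  proof (cases "\<exists>j<k. Y (Suc j) \<omega> > d")
    case False
    then have "ok j \<omega> = 1" if "j < k" for j
      using False that unfolding ok_def by (meson not_less)
    then have "(\<Sum>i\<in>A. \<Sum>j<k. (\<xi>' i j \<omega>)\<^sup>2 * \<delta> j) = Y k \<omega>"
      unfolding Y_def[of k] by (intro sum.cong) (auto simp: \<xi>'_def)
    moreover have "Y k \<omega> \<le> d"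
    proof (cases k)
      case (Suc m)
      then have "m < k" by simp
      then have "\<not> d < Y (Suc m) \<omega>" using False by blast
      then show ?thesis by (simp add: Suc not_less)
    qed (use d in \<open>simp add: Y_def\<close>)
    ultimately show ?thesis by simp
  next
    case True
    \<comment> \<open>\<open>Y\<close> is monotone, so all coefficients vanish from the first
      overrun \<open>l\<close> on, and what remains is \<open>Y l\<close>, which is still at most
      \<open>d\<close>.\<close>
    define l where "l = (LEAST j. Y (Suc j) \<omega> > d)"
    obtain j where j: "j < k" "Y (Suc j) \<omega> > d" using True by blast
    have l2: "Y (Suc i) \<omega> \<le> d" if "i < l" for i
      using not_less_Least[of i "\<lambda>j. Y (Suc j) \<omega> > d"] that by (simp add: l_def not_less)
    have l1: "Y (Suc l) \<omega> > d"
      unfolding l_def by (rule LeastI[of "\<lambda>j. Y (Suc j) \<omega> > d", OF j(2)])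
    have "l < k" using Least_le[of "\<lambda>j. Y (Suc j) \<omega> > d", OF j(2)] j(1) by (simp add: l_def)
    have z: "\<xi>' i j \<omega> = 0" if "j \<in> {l..<k}" for i j
      using l1 Y_mono[of "Suc l" "Suc j" \<omega>] that \<open>k \<le> N\<close> by (auto simp: \<xi>'_def ok_def)
    have "(\<Sum>j<k. (\<xi>' i j \<omega>)\<^sup>2 * \<delta> j) = (\<Sum>j<l. (\<xi> i j \<omega>)\<^sup>2 * \<delta> j)" for i
    proof -
      have "(\<Sum>j<k. (\<xi>' i j \<omega>)\<^sup>2 * \<delta> j) = (\<Sum>j<l. (\<xi>' i j \<omega>)\<^sup>2 * \<delta> j)"
        by (rule sum.mono_neutral_right) (use \<open>l < k\<close> z in auto)
      also have "\<dots> = (\<Sum>j<l. (\<xi> i j \<omega>)\<^sup>2 * \<delta> j)"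
        by (intro sum.cong) (use l2 in \<open>auto simp: \<xi>'_def ok_def\<close>)
      finally show ?thesis .
    qed
    then have "(\<Sum>i\<in>A. \<Sum>j<k. (\<xi>' i j \<omega>)\<^sup>2 * \<delta> j) = Y l \<omega>" by (simp add: Y_def)
    moreover have "Y l \<omega> \<le> d" using l2[of "l - 1"] d by (cases l) (auto simp: Y_def[of 0])
    ultimately show ?thesis by simp
  qed
  have mom: "integrable M (\<lambda>\<omega>. (\<Sum>j<N. \<xi>' i j \<omega> * D j \<omega>)\<^sup>2)"
    "expectation (\<lambda>\<omega>. (\<Sum>j<N. \<xi>' i j \<omega> * D j \<omega>)\<^sup>2) = (\<Sum>j<N. expectation (\<lambda>\<omega>. (\<xi>' i j \<omega>)\<^sup>2) * \<delta> j)"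
    if "i \<in> A" for i
    using second_moment[of "\<xi>' i" B N] \<xi>'_G[OF that] \<xi>'_B[OF that] by auto
  have sqi: "integrable M (\<lambda>\<omega>. (\<xi>' i j \<omega>)\<^sup>2)" if "i \<in> A" "j < N" for i j
    using power_mono[OF \<xi>'_B[OF that], of _ 2] that
    by (intro integrable_const_bound[where B="B\<^sup>2"] AE_I2) auto
  have "expectation (\<lambda>\<omega>. \<Sum>i\<in>A. (\<Sum>j<N. \<xi>' i j \<omega> * D j \<omega>)\<^sup>2)
      = (\<Sum>i\<in>A. \<Sum>j<N. expectation (\<lambda>\<omega>. (\<xi>' i j \<omega>)\<^sup>2) * \<delta> j)"
    using mom by simp
  also have "\<dots> = expectation (\<lambda>\<omega>. \<Sum>i\<in>A. \<Sum>j<N. (\<xi>' i j \<omega>)\<^sup>2 * \<delta> j)"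
  proof -
    have *: "integrable M (\<lambda>\<omega>. (\<xi>' i j \<omega>)\<^sup>2 * \<delta> j)" if "i \<in> A" "j \<in> {..<N}" for i j
      using sqi that by simp
    have "expectation (\<lambda>\<omega>. \<Sum>i\<in>A. \<Sum>j<N. (\<xi>' i j \<omega>)\<^sup>2 * \<delta> j)
        = (\<Sum>i\<in>A. expectation (\<lambda>\<omega>. \<Sum>j<N. (\<xi>' i j \<omega>)\<^sup>2 * \<delta> j))"
      by (intro Bochner_Integration.integral_sum Bochner_Integration.integrable_sum *)
    also have "\<dots> = (\<Sum>i\<in>A. \<Sum>j<N. expectation (\<lambda>\<omega>. (\<xi>' i j \<omega>)\<^sup>2 * \<delta> j))"
      by (intro sum.cong refl Bochner_Integration.integral_sum *)
    finally show ?thesis by simp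
  qed
  also have "\<dots> \<le> expectation (\<lambda>\<omega>. d)"
    using sqi sp[of N] by (intro integral_mono Bochner_Integration.integrable_sum integrable_mult_left) auto
  finally have E': "expectation (\<lambda>\<omega>. \<Sum>i\<in>A. (\<Sum>j<N. \<xi>' i j \<omega> * D j \<omega>)\<^sup>2) \<le> d"
    by (simp add: prob_space)
  \<comment> \<open>If \<open>Y N\<close> stays below \<open>d\<close>, nothing was switched off and
    the two families of sums agree; otherwise \<open>Y N / d\<close> exceeds 1 and the second
    summand alone pays for the truncated left side.\<close>
  have "prob_norm M (\<lambda>\<omega>. \<Sum>i\<in>A. (\<Sum>j<N. \<xi> i j \<omega> * D j \<omega>)\<^sup>2) \<le>
      (\<integral>\<omega>. (\<Sum>i\<in>A. (\<Sum>j<N. \<xi>' i j \<omega> * D j \<omega>)\<^sup>2) + min 1 \<bar>Y N \<omega> / d\<bar> \<partial>M)"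
    unfolding prob_norm_def
  proof (rule integral_mono)
    fix \<omega> assume "\<omega> \<in> space M"
    show "min 1 \<bar>\<Sum>i\<in>A. (\<Sum>j<N. \<xi> i j \<omega> * D j \<omega>)\<^sup>2\<bar> \<le>
        (\<Sum>i\<in>A. (\<Sum>j<N. \<xi>' i j \<omega> * D j \<omega>)\<^sup>2) + min 1 \<bar>Y N \<omega> / d\<bar>"
    proof (cases "Y N \<omega> \<le> d")
      case True
      have "\<xi>' i j \<omega> = \<xi> i j \<omega>" if "j < N" for i j
        using Y_mono[of "Suc j" N \<omega>] that True by (auto simp: \<xi>'_def ok_def)
      then have "(\<Sum>i\<in>A. (\<Sum>j<N. \<xi>' i j \<omega> * D j \<omega>)\<^sup>2) = (\<Sum>i\<in>A. (\<Sum>j<N. \<xi> i j \<omega> * D j \<omega>)\<^sup>2)"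
        by simp
      moreover have "0 \<le> (\<Sum>i\<in>A. (\<Sum>j<N. \<xi> i j \<omega> * D j \<omega>)\<^sup>2)" by (simp add: sum_nonneg)
      moreover have "0 \<le> min 1 \<bar>Y N \<omega> / d\<bar>" by simp
      ultimately show ?thesis by linarith
    next
      case False
      then have "1 \<le> \<bar>Y N \<omega> / d\<bar>" using d by (simp add: field_simps)
      moreover have "0 \<le> (\<Sum>i\<in>A. (\<Sum>j<N. \<xi>' i j \<omega> * D j \<omega>)\<^sup>2)" by (simp add: sum_nonneg)
      ultimately show ?thesis by (auto simp: min_def)
    qed
  qed (intro prob_norm_integrable Bochner_Integration.integrable_add Bochner_Integration.integrable_sum mom; measurable)+
  also have "\<dots> = expectation (\<lambda>\<omega>. \<Sum>i\<in>A. (\<Sum>j<N. \<xi>' i j \<omega> * D j \<omega>)\<^sup>2) + prob_norm M (\<lambda>\<omega>. Y N \<omega> / d)"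
    unfolding prob_norm_def
    by (intro Bochner_Integration.integral_add prob_norm_integrable Bochner_Integration.integrable_sum mom) measurable
  finally show ?thesis using E' by (simp add: Y_def)
qed

end

section \<open>Step functions\<close>

definition step :: "(nat \<Rightarrow> real) \<Rightarrow> nat \<Rightarrow> (nat \<Rightarrow> real) \<Rightarrow> real \<Rightarrow> real" where
  "step p N c u = (\<Sum>j<N. c j * indicator {p j<..p (Suc j)} u)"

lemma step_eq:
  assumes "mono p" "j < N" "u \<in> {p j<..p (Suc j)}"
  shows "step p N c u = c j"
proof -
  have "u \<notin> {p i<..p (Suc i)}" if "i \<noteq> j" for i
    using assms(3) monoD[OF assms(1), of "Suc i" j] monoD[OF assms(1), of "Suc j" i] that
    by (cases i j rule: linorder_cases) auto
  then have "c i * indicator {p i<..p (Suc i)} u = (if i = j then c j else 0)" for i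
    using assms(3) by (auto simp: indicator_def)
  then show ?thesis using assms(2) by (simp add: step_def)
qed

lemma step_cell:
  fixes p :: "nat \<Rightarrow> real"
  assumes "mono p" "u \<in> {p 0<..p N}"
  obtains j where "j < N" "u \<in> {p j<..p (Suc j)}"
proof -
  define j where "j = (LEAST j. u \<le> p (Suc j))"
  have "N \<noteq> 0" using assms(2) by (auto intro: ccontr)
  then have *: "u \<le> p (Suc (N - 1))" using assms(2) by simp
  then have "u \<le> p (Suc j)" "j \<le> N - 1"
    unfolding j_def
    using LeastI[of "\<lambda>j. u \<le> p (Suc j)", OF *] Least_le[of "\<lambda>j. u \<le> p (Suc j)" "N - 1", OF *] by auto
  moreover have "p j < u"
    using not_less_Least[of "j - 1" "\<lambda>j. u \<le> p (Suc j)"] assms(2)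
    by (cases j) (auto simp: j_def[symmetric] not_le)
  ultimately show ?thesis using \<open>N \<noteq> 0\<close> by (intro that[of j]) auto
qed

lemma step_outside:
  assumes "mono p" "u \<notin> {p 0<..p N}"
  shows "step p N c u = 0"
  unfolding step_def
proof (rule sum.neutral, intro ballI)
  fix j assume "j \<in> {..<N}"
  then have "u \<notin> {p j<..p (Suc j)}"
    using monoD[OF assms(1), of 0 j] monoD[OF assms(1), of "Suc j" N] assms(2) by auto
  then show "c j * indicator {p j<..p (Suc j)} u = 0" by simp
qed

text \<open>The same index serves all coefficient families \<open>c\<close> at once. Pointwise
  identities and bounds between several step functions on one partition thus reduce to statements
  about coefficients.\<close>

lemma step_cases:
  assumes "mono p"
  obtains j where "j < N" "\<And>c. step p N c u = c j" | "\<And>c. step p N c u = 0"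
proof (cases "u \<in> {p 0<..p N}")
  case True
  then obtain j where j: "j < N" "u \<in> {p j<..p (Suc j)}" using step_cell[OF assms] by blast
  from that(1)[OF j(1) step_eq[OF assms j]] show ?thesis .
qed (use that(2) step_outside[OF assms] in blast)

text \<open>The condition on \<phi> at 0 takes care of the points outside the cells, where every
  step function vanishes.\<close>

lemma step_map:
  assumes "mono p" "\<phi> 0 = (0::real)"
  shows "\<phi> (step p N c u) = step p N (\<lambda>j. \<phi> (c j)) u"
proof (cases "u \<in> {p 0<..p N}")
  case True
  then obtain j where "j < N" "u \<in> {p j<..p (Suc j)}" using step_cell[OF assms(1)] by blast
  then show ?thesis using step_eq[OF assms(1)] by simp
qed (use assms in \<open>simp add: step_outside\<close>)

lemma step_measurable[measurable]: "step p N c \<in> borel_measurable borel"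
  unfolding step_def by measurable

lemma step_linear: "step p N (\<lambda>j. x * c j + c' j) u = x * step p N c u + step p N c' u"
  unfolding step_def sum_distrib_left sum.distrib[symmetric] by (intro sum.cong) (auto simp: algebra_simps)

lemma step_integral:
  assumes "mono p" and g: "set_integrable lborel {p 0..p N} g"
  shows "set_integrable lborel {p 0..p N} (\<lambda>u. step p N c u * g u)"
    and "(LINT u:{p 0..p N}|lborel. step p N c u * g u)
      = (\<Sum>j<N. c j * (LINT u:{p j<..p (Suc j)}|lborel. g u))"
proof -
  have sub: "{p j<..p (Suc j)} \<subseteq> {p 0..p N}" if "j < N" for j
    using monoD[OF assms(1), of 0 j] monoD[OF assms(1), of "Suc j" N] that by auto
  have int: "set_integrable lborel {p j<..p (Suc j)} g" if "j < N" for j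
    by (rule set_integrable_subset[OF g]) (use sub[OF that] in auto)
  have eq: "indicator {p 0..p N} u *\<^sub>R (step p N c u * g u)
      = (\<Sum>j<N. c j * (indicator {p j<..p (Suc j)} u *\<^sub>R g u))" for u
  proof -
    have "indicator {p 0..p N} u * indicator {p j<..p (Suc j)} u = (indicator {p j<..p (Suc j)} u :: real)"
      if "j < N" for j
      using sub[OF that] by (auto simp: indicator_def)
    then show ?thesis
      unfolding step_def real_scaleR_def sum_distrib_right sum_distrib_left
      by (intro sum.cong) (auto simp: algebra_simps)
  qed
  show "set_integrable lborel {p 0..p N} (\<lambda>u. step p N c u * g u)"
    unfolding set_integrable_def eq
    by (intro Bochner_Integration.integrable_sum integrable_mult_right)
       (use int in \<open>auto simp: set_integrable_def\<close>)
  show "(LINT u:{p 0..p N}|lborel. step p N c u * g u)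
      = (\<Sum>j<N. c j * (LINT u:{p j<..p (Suc j)}|lborel. g u))"
    unfolding set_lebesgue_integral_def eq using int
    by (subst Bochner_Integration.integral_sum) (auto simp: set_integrable_def)
qed

lemma step_integral_const:
  assumes "mono p"
  shows "set_integrable lborel {p 0..p N} (step p N c)"
    and "(LINT u:{p 0..p N}|lborel. step p N c u) = (\<Sum>j<N. c j * (p (Suc j) - p j))"
proof -
  have *: "set_integrable lborel {p 0..p N} (\<lambda>_. 1::real)"
    using borel_integrable_atLeastAtMost'[of "p 0" "p N" "\<lambda>_. 1::real"] by simp
  show "set_integrable lborel {p 0..p N} (step p N c)"
    using step_integral(1)[OF assms *] by simp
  have "p j \<le> p (Suc j)" for j using monoD[OF assms] by simp
  then show "(LINT u:{p 0..p N}|lborel. step p N c u) = (\<Sum>j<N. c j * (p (Suc j) - p j))"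
    using step_integral(2)[OF assms *, of c] by (simp add: set_lebesgue_integral_def)
qed

section \<open>Simple processes\<close>

lemma simple_process_Nil[simp]: "simple_process [] u \<omega> = 0"
  and simple_process_Cons[simp]:
    "simple_process ((s, t, \<xi>) # hs) u \<omega> = \<xi> \<omega> * indicator {s<..t} u + simple_process hs u \<omega>"
  and simple_process_append[simp]:
    "simple_process (hs @ hs') u \<omega> = simple_process hs u \<omega> + simple_process hs' u \<omega>"
  by (simp_all add: simple_process_def)

lemma simple_integral_Nil[simp]: "simple_integral W [] \<omega> = 0"
  and simple_integral_Cons[simp]:
    "simple_integral W ((s, t, \<xi>) # hs) \<omega> = \<xi> \<omega> * (W t \<omega> - W s \<omega>) + simple_integral W hs \<omega>"
  and simple_integral_append[simp]:
    "simple_integral W (hs @ hs') \<omega> = simple_integral W hs \<omega> + simple_integral W hs' \<omega>"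
  by (simp_all add: simple_integral_def)

lemma simple_on_Nil[simp]: "simple_on F a b []"
  and simple_on_Cons[simp]: "simple_on F a b ((s, t, \<xi>) # hs) \<longleftrightarrow>
    a \<le> s \<and> s \<le> t \<and> t \<le> b \<and> \<xi> \<in> borel_measurable (F s) \<and>
    (\<exists>C. \<forall>\<omega>\<in>space (F s). \<bar>\<xi> \<omega>\<bar> \<le> C) \<and> simple_on F a b hs"
  and simple_on_append[simp]: "simple_on F a b (hs @ hs') \<longleftrightarrow> simple_on F a b hs \<and> simple_on F a b hs'"
  by (simp_all add: simple_on_def ball_Un)

lemma simple_process_measurable_time[measurable]:
  "(\<lambda>u. simple_process hs u \<omega>) \<in> borel_measurable borel"
  by (induction hs) auto

locale wiener_space = filtered_prob_space M F
  for M :: "'a measure" and F :: "real \<Rightarrow> 'a measure" +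
  fixes W :: "real \<Rightarrow> 'a \<Rightarrow> real"
  assumes wiener: "wiener_process M F W"

context filtered_prob_space
begin

lemma measurable_F_mono: "s \<le> t \<Longrightarrow> X \<in> borel_measurable (F s) \<Longrightarrow> X \<in> borel_measurable (F t)"
  by (rule measurable_from_subalg[of "F t" "F s"])
     (use sets_F_mono[of s t] space_F in \<open>auto simp: subalgebra_def\<close>)

lemma measurable_F_M: "X \<in> borel_measurable (F t) \<Longrightarrow> X \<in> borel_measurable M"
  by (rule measurable_from_subalg[OF subalg])

lemma simple_process_bounded:
  assumes "simple_on F a b hs"
  shows "\<exists>C. \<forall>u. \<forall>\<omega>\<in>space M. \<bar>simple_process hs u \<omega>\<bar> \<le> C"
  using assms
proof (induction hs)
  case (Cons h hs)
  obtain s t \<xi> where h: "h = (s, t, \<xi>)" by (cases h)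
  from Cons obtain C where C: "\<And>u \<omega>. \<omega> \<in> space M \<Longrightarrow> \<bar>simple_process hs u \<omega>\<bar> \<le> C"
    by (auto simp: h)
  from Cons obtain C' where C': "\<And>\<omega>. \<omega> \<in> space M \<Longrightarrow> \<bar>\<xi> \<omega>\<bar> \<le> C'"
    by (auto simp: h space_F)
  have "\<bar>\<xi> \<omega> * indicator {s<..t} u + simple_process hs u \<omega>\<bar> \<le> C' + C" if "\<omega> \<in> space M" for u \<omega>
    using C[OF that, of u] C'[OF that] by (cases "u \<in> {s<..t}") auto
  then show ?case by (intro exI[of _ "C' + C"]) (simp add: h)
qed auto

lemma simple_process_measurable_pair:
  assumes "simple_on F a b hs"
  shows "(\<lambda>(u, \<omega>). simple_process hs u \<omega>) \<in> borel_measurable (borel \<Otimes>\<^sub>M M)"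
  using assms
proof (induction hs)
  case (Cons h hs)
  obtain s t \<xi> where h: "h = (s, t, \<xi>)" by (cases h)
  have [measurable]: "\<xi> \<in> borel_measurable M"
    using Cons.prems measurable_F_M by (auto simp: h)
  have [measurable]: "(\<lambda>(u, \<omega>). simple_process hs u \<omega>) \<in> borel_measurable (borel \<Otimes>\<^sub>M M)"
    using Cons by (simp add: h)
  show ?case unfolding h simple_process_Cons by measurable
qed (simp add: case_prod_unfold)

text \<open>The value on a cell is read off at its right end point. Only coefficients with
  \<open>s < p (Suc j)\<close> contribute, and as \<open>s\<close> is a partition point this forces
  \<open>s \<le> p j\<close>, so they are known at the left end point.\<close>

lemma simple_process_measurable_partition:
  assumes "simple_on F a b hs" "mono p" "j < N"
    and "\<And>s t \<xi>. (s, t, \<xi>) \<in> set hs \<Longrightarrow> s \<in> p ` {..N}"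
  shows "simple_process hs (p (Suc j)) \<in> borel_measurable (F (p j))"
  using assms
proof (induction hs)
  case (Cons h hs)
  obtain s t \<xi> where h: "h = (s, t, \<xi>)" by (cases h)
  have IH[measurable]: "simple_process hs (p (Suc j)) \<in> borel_measurable (F (p j))"
    using Cons by (auto simp: h)
  have "(\<lambda>\<omega>. \<xi> \<omega> * indicator {s<..t} (p (Suc j))) \<in> borel_measurable (F (p j))"
  proof (cases "s < p (Suc j)")
    case True
    obtain i where i: "s = p i" using Cons.prems(4)[of s t \<xi>] by (auto simp: h)
    then have "i \<le> j" using True monoD[OF assms(2), of "Suc j" i] by (meson not_less_eq_eq not_less)
    then have "s \<le> p j" using i monoD[OF assms(2)] by simp
    then have [measurable]: "\<xi> \<in> borel_measurable (F (p j))"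
      using Cons.prems(1) by (auto simp: h intro: measurable_F_mono)
    show ?thesis by measurable
  qed simp
  then show ?case unfolding h simple_process_Cons using IH by (intro borel_measurable_add)
next
  case Nil
  have "simple_process [] (p (Suc j)) = (\<lambda>_::'a. 0)" by auto
  then show ?case by simp
qed

end

lemma simple_process_eq_step:
  assumes "simple_on F (p 0) (p N) hs" "mono p"
    and "\<And>s t \<xi>. (s, t, \<xi>) \<in> set hs \<Longrightarrow> s \<in> p ` {..N} \<and> t \<in> p ` {..N}"
  shows "simple_process hs u \<omega> = step p N (\<lambda>j. simple_process hs (p (Suc j)) \<omega>) u"
  using assms
proof (induction hs)
  case (Cons h hs)
  obtain s t \<xi> where h: "h = (s, t, \<xi>)" by (cases h)
  obtain i k where ik: "s = p i" "t = p k" "i \<le> N" "k \<le> N"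
    using Cons.prems(3)[of s t \<xi>] by (auto simp: h)
  have "(indicator {s<..t} u :: real) = step p N (\<lambda>j. indicator {s<..t} (p (Suc j))) u"
  proof (cases "u \<in> {p 0<..p N}")
    case True
    then obtain j where j: "j < N" "u \<in> {p j<..p (Suc j)}" using step_cell[OF assms(2)] by blast
    have "p i < u \<longleftrightarrow> p i < p (Suc j)"
      using j monoD[OF assms(2), of i j] monoD[OF assms(2), of "Suc j" i] by (cases "i \<le> j") auto
    moreover have "u \<le> p k \<longleftrightarrow> p (Suc j) \<le> p k"
      using j monoD[OF assms(2), of k j] monoD[OF assms(2), of "Suc j" k] by (cases "k \<le> j") auto
    ultimately show ?thesis using step_eq[OF assms(2) j] by (auto simp: ik indicator_def)
  next
    case False
    then have "u \<notin> {s<..t}" using Cons.prems(1) by (auto simp: h)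
    then show ?thesis using False by (simp add: step_outside[OF assms(2)])
  qed
  moreover have "simple_process hs u \<omega> = step p N (\<lambda>j. simple_process hs (p (Suc j)) \<omega>) u"
    by (rule Cons.IH) (use Cons.prems in \<open>auto simp: h\<close>)
  ultimately show ?case
    by (simp add: h step_linear)
qed (simp add: step_def)

text \<open>On a partition through all end points the overlaps of the intervals are harmless: each
  coefficient appears on the cells of its interval, and the increments of \<open>W\<close> over
  these cells telescope.\<close>

lemma simple_integral_eq_sum:
  assumes "simple_on F (p 0) (p N) hs" "mono p" "\<And>j. j < N \<Longrightarrow> p j < p (Suc j)"
    and "\<And>s t \<xi>. (s, t, \<xi>) \<in> set hs \<Longrightarrow> s \<in> p ` {..N} \<and> t \<in> p ` {..N}"
  shows "simple_integral W hs \<omega> =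
    (\<Sum>j<N. simple_process hs (p (Suc j)) \<omega> * (W (p (Suc j)) \<omega> - W (p j) \<omega>))"
  using assms(1,4)
proof (induction hs)
  case (Cons h hs)
  obtain s t \<xi> where h: "h = (s, t, \<xi>)" by (cases h)
  obtain i k where ik: "s = p i" "t = p k" "i \<le> N" "k \<le> N"
    using Cons.prems(2)[of s t \<xi>] by (auto simp: h)
  have less: "p l < p m" if "l < m" "m \<le> N" for l m
    using that
  proof (induction m)
    case (Suc m)
    then show ?case using assms(3)[of m] by (cases "l = m") auto
  qed simp
  have "i \<le> k" using Cons.prems(1) less[of k i] ik by (cases "i \<le> k") (auto simp: h)
  have ind: "indicator {s<..t} (p (Suc j)) = (if i \<le> j \<and> j < k then 1 else 0 :: real)" if "j < N" for j
    using less[of i "Suc j"] less[of k "Suc j"] monoD[OF assms(2), of "Suc j" i]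
      monoD[OF assms(2), of "Suc j" k] that ik
    by (cases "i \<le> j"; cases "j < k") (auto simp: indicator_def not_less_eq_eq)
  have "(\<Sum>j<N. indicator {s<..t} (p (Suc j)) * (W (p (Suc j)) \<omega> - W (p j) \<omega>))
      = (\<Sum>j\<in>{i..<k}. W (p (Suc j)) \<omega> - W (p j) \<omega>)"
    using ind ik by (intro sum.mono_neutral_cong_right) auto
  also have "\<dots> = W t \<omega> - W s \<omega>"
    using sum_Suc_diff'[OF \<open>i \<le> k\<close>, of "\<lambda>j. W (p j) \<omega>"] by (simp add: ik)
  finally have "(\<Sum>j<N. \<xi> \<omega> * (indicator {s<..t} (p (Suc j)) * (W (p (Suc j)) \<omega> - W (p j) \<omega>)))
      = \<xi> \<omega> * (W t \<omega> - W s \<omega>)"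
    by (simp add: sum_distrib_left[symmetric])
  moreover have "simple_integral W hs \<omega> =
    (\<Sum>j<N. simple_process hs (p (Suc j)) \<omega> * (W (p (Suc j)) \<omega> - W (p j) \<omega>))"
    by (rule Cons.IH) (use Cons.prems in \<open>auto simp: h\<close>)
  ultimately show ?case
    by (simp add: h distrib_right sum.distrib mult.assoc)
qed simp

lemma common_partition:
  fixes a b :: real
  assumes "finite P" "P \<subseteq> {a..b}" "a < b"
  obtains p N where "mono p" "\<And>j. j < N \<Longrightarrow> p j < p (Suc j)" "p 0 = a" "p N = b" "P \<subseteq> p ` {..N}"
proof -
  define Q where "Q = insert a (insert b P)"
  define l where "l = sorted_list_of_set Q"
  define N where "N = length l - 1"
  \<comment> \<open>Constant beyond \<open>N\<close>, so that \<open>p\<close> is monotone on all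
    indices, as the lemmas on step functions require.\<close>
  define p where "p j = l ! (min j N)" for j
  have Q: "finite Q" "Q \<noteq> {}" using assms by (auto simp: Q_def)
  have l: "sorted l" "distinct l" "set l = Q" "l \<noteq> []"
    using Q by (auto simp: l_def)
  have len: "length l = Suc N" using l(4) by (simp add: N_def)
  have img: "p ` {..N} = Q"
    using len l(3) by (auto simp: p_def set_conv_nth image_def less_Suc_eq_le)
  have mono: "mono p"
    unfolding p_def using len by (intro monoI sorted_nth_mono[OF l(1)]) auto
  have ends: "p 0 = a" "p N = b"
  proof -
    have "a \<in> p ` {..N}" "b \<in> p ` {..N}" unfolding img by (simp_all add: Q_def)
    then obtain i j where ij: "a = p i" "b = p j" "i \<le> N" "j \<le> N" by blast
    have "p 0 \<in> Q" "p N \<in> Q" using img by auto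
    then have "a \<le> p 0" "p N \<le> b" using assms by (auto simp: Q_def)
    then show "p 0 = a" "p N = b"
      using ij monoD[OF mono, of 0 i] monoD[OF mono, of j N] by auto
  qed
  have "p j < p (Suc j)" if "j < N" for j
    using that len sorted_nth_mono[OF l(1), of j "Suc j"] nth_eq_iff_index_eq[OF l(2), of j "Suc j"]
    by (simp add: p_def order_less_le)
  with mono ends img show ?thesis by (intro that[of p N]) (auto simp: Q_def)
qed

section \<open>Gaussian increments and the second moment estimate for simple integrals\<close>

context wiener_space
begin

lemma W_measurable_F: "0 \<le> t \<Longrightarrow> W t \<in> borel_measurable (F t)"
  using wiener by (simp add: wiener_process_def)

lemma W_measurable: "0 \<le> t \<Longrightarrow> W t \<in> borel_measurable M"
  using W_measurable_F measurable_F_M by blast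

lemma simple_integral_measurable:
  assumes "simple_on F a b hs" "0 \<le> a"
  shows "simple_integral W hs \<in> borel_measurable M"
  using assms(1)
proof (induction hs)
  case (Cons h hs)
  obtain s t \<xi> where h: "h = (s, t, \<xi>)" by (cases h)
  have [measurable]: "\<xi> \<in> borel_measurable M" "W s \<in> borel_measurable M" "W t \<in> borel_measurable M"
    "simple_integral W hs \<in> borel_measurable M"
    using Cons assms(2) measurable_F_M by (auto simp: h intro!: W_measurable)
  show ?case unfolding h simple_integral_Cons by measurable
next
  case Nil
  show ?case by (simp add: simple_integral_def)
qed

context
  fixes s t :: real
  assumes st: "0 \<le> s" "s < t"
begin

lemma increment_distributed:
  "distributed M lborel (\<lambda>\<omega>. W t \<omega> - W s \<omega>) (normal_density 0 (sqrt (t - s)))"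
  using wiener st by (auto simp: wiener_process_def)

lemma increment_moment:
  "integrable M (\<lambda>\<omega>. (W t \<omega> - W s \<omega>) ^ k)"
  "expectation (\<lambda>\<omega>. (W t \<omega> - W s \<omega>) ^ k) = (LINT x|lborel. normal_density 0 (sqrt (t - s)) x * x ^ k)"
  using distributed_integrable[OF increment_distributed, of "\<lambda>x. x ^ k"]
    distributed_integral[OF increment_distributed, of "\<lambda>x. x ^ k"]
    integrable_normal_moment[of "sqrt (t - s)" 0 k] st by simp_all

lemma increment_mean: "expectation (\<lambda>\<omega>. W t \<omega> - W s \<omega>) = 0"
  using increment_moment(2)[of 1] integral_normal_moment_odd[of "sqrt (t - s)" 0 0] st by simp

lemma increment_variance: "expectation (\<lambda>\<omega>. (W t \<omega> - W s \<omega>)\<^sup>2) = t - s"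
  using increment_moment(2)[of 2] integral_normal_moment_even[of "sqrt (t - s)" 0 1] st by simp

lemma increment_fourth_moment: "expectation (\<lambda>\<omega>. (W t \<omega> - W s \<omega>) ^ 4) = 3 * (t - s)\<^sup>2"
  using increment_moment(2)[of 4] integral_normal_moment_even[of "sqrt (t - s)" 0 2] st
  by (simp add: fact_numeral power_divide)

end

lemma indep_increment:
  assumes "0 \<le> s" "s < t" "g \<in> borel_measurable borel"
  shows "indep_set (sets (F s)) (sets (vimage_algebra (space M) (\<lambda>\<omega>. g (W t \<omega> - W s \<omega>)) borel))"
proof -
  have "indep_set (sets (F s)) (sets (vimage_algebra (space M) (\<lambda>\<omega>. W t \<omega> - W s \<omega>) borel))"
    using wiener assms by (auto simp: wiener_process_def)
  moreover have "sets (vimage_algebra (space M) (\<lambda>\<omega>. g (W t \<omega> - W s \<omega>)) borel) \<subseteq>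
      sets (vimage_algebra (space M) (\<lambda>\<omega>. W t \<omega> - W s \<omega>) borel)"
  proof -
    have [measurable]: "(\<lambda>\<omega>. W t \<omega> - W s \<omega>) \<in> borel_measurable (vimage_algebra (space M) (\<lambda>\<omega>. W t \<omega> - W s \<omega>) borel)"
      by (rule measurable_vimage_algebra1) simp
    note [measurable] = assms(3)
    have "(\<lambda>\<omega>. g (W t \<omega> - W s \<omega>)) \<in> borel_measurable (vimage_algebra (space M) (\<lambda>\<omega>. W t \<omega> - W s \<omega>) borel)"
      by measurable
    from measurable_sets[OF this] show ?thesis
      unfolding sets_vimage_algebra[of _ "\<lambda>\<omega>. g (W t \<omega> - W s \<omega>)"]
      by (intro sets.sigma_sets_subset[of _ "vimage_algebra (space M) (\<lambda>\<omega>. W t \<omega> - W s \<omega>) borel", simplified]) auto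
  qed
  ultimately show ?thesis unfolding indep_sets2_eq by blast
qed

lemma increments_W:
  assumes "mono p" "\<And>j. j < N \<Longrightarrow> p j < p (Suc j)" "0 \<le> p 0"
  shows "increments M (\<lambda>j. F (p j)) (\<lambda>j \<omega>. W (p (Suc j)) \<omega> - W (p j) \<omega>) (\<lambda>j. p (Suc j) - p j) N"
proof
  have p0: "0 \<le> p j" for j using monoD[OF assms(1), of 0 j] assms(3) by simp
  have le: "p j \<le> p (Suc j)" for j using monoD[OF assms(1)] by simp
  fix j assume j: "j < N"
  note st = p0[of j] assms(2)[OF j]
  show "(\<lambda>\<omega>. W (p (Suc j)) \<omega> - W (p j) \<omega>) \<in> borel_measurable (F (p (Suc j)))"
    using W_measurable_F p0 measurable_F_mono[OF le] by (intro borel_measurable_diff) auto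
  show "integrable M (\<lambda>\<omega>. (W (p (Suc j)) \<omega> - W (p j) \<omega>)\<^sup>2)"
    by (rule increment_moment[OF st])
  show "expectation (\<lambda>\<omega>. W (p (Suc j)) \<omega> - W (p j) \<omega>) = 0"
    by (rule increment_mean[OF st])
  show "expectation (\<lambda>\<omega>. (W (p (Suc j)) \<omega> - W (p j) \<omega>)\<^sup>2) = p (Suc j) - p j"
    by (rule increment_variance[OF st])
  show "indep_set (sets (F (p j))) (sets (vimage_algebra (space M) (\<lambda>\<omega>. W (p (Suc j)) \<omega> - W (p j) \<omega>) borel))"
    using indep_increment[OF st, of "\<lambda>x. x"] by simp
qed (use subalg sets_F_mono monoD[OF assms(1)] in auto)

text \<open>For a Gaussian increment of variance \<delta> the fourth moment is three times the
  square of \<delta>. Expanding the square of the compensated square leaves 3 - 2 + 1 = 2 times the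
  square of \<delta>.\<close>

lemma increments_W_squared:
  assumes "mono p" "\<And>j. j < N \<Longrightarrow> p j < p (Suc j)" "0 \<le> p 0"
  shows "increments M (\<lambda>j. F (p j)) (\<lambda>j \<omega>. (W (p (Suc j)) \<omega> - W (p j) \<omega>)\<^sup>2 - (p (Suc j) - p j))
    (\<lambda>j. 2 * (p (Suc j) - p j)\<^sup>2) N"
proof
  have p0: "0 \<le> p j" for j using monoD[OF assms(1), of 0 j] assms(3) by simp
  have le: "p j \<le> p (Suc j)" for j using monoD[OF assms(1)] by simp
  fix j assume j: "j < N"
  define D where "D \<omega> = W (p (Suc j)) \<omega> - W (p j) \<omega>" for \<omega>
  define \<delta> where "\<delta> = p (Suc j) - p j"
  note st = p0[of j] assms(2)[OF j]
  have eq: "((D \<omega>)\<^sup>2 - \<delta>)\<^sup>2 = (D \<omega>) ^ 4 - 2 * \<delta> * (D \<omega>)\<^sup>2 + \<delta>\<^sup>2" for \<omega>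
    by (simp add: power2_diff)
  have [simp]: "integrable M (\<lambda>\<omega>. (D \<omega>) ^ k)" for k
    unfolding D_def by (rule increment_moment[OF st])
  have v: "expectation (\<lambda>\<omega>. (D \<omega>)\<^sup>2) = \<delta>" "expectation (\<lambda>\<omega>. (D \<omega>) ^ 4) = 3 * \<delta>\<^sup>2"
    unfolding D_def \<delta>_def by (rule increment_variance[OF st] increment_fourth_moment[OF st])+
  show "(\<lambda>\<omega>. (W (p (Suc j)) \<omega> - W (p j) \<omega>)\<^sup>2 - (p (Suc j) - p j)) \<in> borel_measurable (F (p (Suc j)))"
    using W_measurable_F p0 measurable_F_mono[OF le]
    by (intro borel_measurable_diff borel_measurable_power borel_measurable_const) auto
  show "integrable M (\<lambda>\<omega>. ((W (p (Suc j)) \<omega> - W (p j) \<omega>)\<^sup>2 - (p (Suc j) - p j))\<^sup>2)"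
    unfolding D_def[symmetric] \<delta>_def[symmetric] eq by simp
  show "expectation (\<lambda>\<omega>. (W (p (Suc j)) \<omega> - W (p j) \<omega>)\<^sup>2 - (p (Suc j) - p j)) = 0"
    unfolding D_def[symmetric] \<delta>_def[symmetric] using v by (simp add: prob_space)
  show "expectation (\<lambda>\<omega>. ((W (p (Suc j)) \<omega> - W (p j) \<omega>)\<^sup>2 - (p (Suc j) - p j))\<^sup>2) = 2 * (p (Suc j) - p j)\<^sup>2"
    unfolding D_def[symmetric] \<delta>_def[symmetric] eq using v by (simp add: prob_space power2_eq_square[of \<delta>])
  show "indep_set (sets (F (p j))) (sets (vimage_algebra (space M)
      (\<lambda>\<omega>. (W (p (Suc j)) \<omega> - W (p j) \<omega>)\<^sup>2 - (p (Suc j) - p j)) borel))"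
    by (rule indep_increment[OF st, of "\<lambda>x. x\<^sup>2 - (p (Suc j) - p j)"]) simp
qed (use subalg sets_F_mono monoD[OF assms(1)] in auto)

lemma simple_integral_degenerate: "simple_on F a a hs \<Longrightarrow> simple_integral W hs \<omega> = 0"
  by (induction hs) (auto simp: antisym_conv)

text \<open>All members are written on one partition through all their end points, where
  \<open>budget_inequality\<close> applies. One budget is shared by the whole family; this is what
  later bounds a sum of squared errors without a factor for the number of cells.\<close>

lemma simple_family_inequality:
  assumes A: "finite A" and k: "\<And>i. i \<in> A \<Longrightarrow> simple_on F a b (k i)"
    and ab: "0 \<le> a" "a \<le> b" and d: "0 < d"
  shows "prob_norm M (\<lambda>\<omega>. \<Sum>i\<in>A. (simple_integral W (k i) \<omega>)\<^sup>2) \<le>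
    d + prob_norm M (\<lambda>\<omega>. (\<Sum>i\<in>A. LINT u:{a..b}|lborel. (simple_process (k i) u \<omega>)\<^sup>2) / d)"
\<comment> \<open>\<open>common_partition\<close> needs an interval of positive length; on a
  degenerate one all simple integrals are 0.\<close>
proof (cases "a = b")
  case True
  have "simple_integral W (k i) \<omega> = 0" if "i \<in> A" for i \<omega>
    using simple_integral_degenerate k[OF that] unfolding True by blast
  then have "prob_norm M (\<lambda>\<omega>. \<Sum>i\<in>A. (simple_integral W (k i) \<omega>)\<^sup>2) = 0"
    by (simp add: prob_norm_def)
  then show ?thesis using d prob_norm_nonneg by (simp add: add_nonneg_nonneg)
next
  case False
  with ab have ab: "0 \<le> a" "a < b" by auto
  define P where "P = (\<Union>i\<in>A. \<Union>(s, t, \<xi>)\<in>set (k i). {s, t})"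
  have "finite P" unfolding P_def using A by auto
  moreover have "P \<subseteq> {a..b}"
    using k by (force simp: P_def simple_on_def)
  ultimately obtain p N where p: "mono p" "\<And>j. j < N \<Longrightarrow> p j < p (Suc j)" "p 0 = a" "p N = b" "P \<subseteq> p ` {..N}"
    by (rule common_partition[OF _ _ ab(2)]) blast
  have sub: "s \<in> p ` {..N} \<and> t \<in> p ` {..N}" if "(s, t, \<xi>) \<in> set (k i)" "i \<in> A" for s t \<xi> i
  proof -
    have "s \<in> P" "t \<in> P" using that by (force simp: P_def)+
    then show ?thesis using p(5) by auto
  qed
  interpret I: increments M "\<lambda>j. F (p j)" "\<lambda>j \<omega>. W (p (Suc j)) \<omega> - W (p j) \<omega>" "\<lambda>j. p (Suc j) - p j" N
    using increments_W[OF p(1,2)] p(3) ab by auto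
  define \<xi> where "\<xi> i j = simple_process (k i) (p (Suc j))" for i j
  have "\<exists>C. \<forall>i\<in>A. \<forall>u. \<forall>\<omega>\<in>space M. \<bar>simple_process (k i) u \<omega>\<bar> \<le> C"
  proof -
    have "\<forall>i\<in>A. \<exists>C. \<forall>u. \<forall>\<omega>\<in>space M. \<bar>simple_process (k i) u \<omega>\<bar> \<le> C"
      using simple_process_bounded[OF k] by blast
    then obtain C where C: "\<forall>i\<in>A. \<forall>u. \<forall>\<omega>\<in>space M. \<bar>simple_process (k i) u \<omega>\<bar> \<le> C i"
      using bchoice[of A "\<lambda>i C. \<forall>u. \<forall>\<omega>\<in>space M. \<bar>simple_process (k i) u \<omega>\<bar> \<le> C"] by blast
    show ?thesis
    proof (intro exI ballI allI)
      fix i u \<omega> assume i: "i \<in> A" "\<omega> \<in> space M"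
      then have "\<bar>simple_process (k i) u \<omega>\<bar> \<le> C i" using C by blast
      also have "\<dots> \<le> (\<Sum>i\<in>A. \<bar>C i\<bar>)"
        using member_le_sum[OF i(1), of "\<lambda>i. \<bar>C i\<bar>"] A by auto
      finally show "\<bar>simple_process (k i) u \<omega>\<bar> \<le> (\<Sum>i\<in>A. \<bar>C i\<bar>)" .
    qed
  qed
  then obtain C where C: "\<And>i u \<omega>. i \<in> A \<Longrightarrow> \<omega> \<in> space M \<Longrightarrow> \<bar>simple_process (k i) u \<omega>\<bar> \<le> C"
    by blast
  have k': "simple_on F (p 0) (p N) (k i)" if "i \<in> A" for i using k[OF that] p by simp
  have ineq: "prob_norm M (\<lambda>\<omega>. \<Sum>i\<in>A. (\<Sum>j<N. \<xi> i j \<omega> * (W (p (Suc j)) \<omega> - W (p j) \<omega>))\<^sup>2) \<le>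
     d + prob_norm M (\<lambda>\<omega>. (\<Sum>i\<in>A. \<Sum>j<N. (\<xi> i j \<omega>)\<^sup>2 * (p (Suc j) - p j)) / d)"
  proof (rule I.budget_inequality[OF A _ _ d])
    show "\<xi> i j \<in> borel_measurable (F (p j))" if "i \<in> A" "j < N" for i j
      unfolding \<xi>_def using sub[OF _ that(1)]
      by (intro simple_process_measurable_partition[OF k'[OF that(1)] p(1) that(2)]) auto
    show "\<bar>\<xi> i j \<omega>\<bar> \<le> C" if "i \<in> A" "j < N" "\<omega> \<in> space M" for i j \<omega>
      unfolding \<xi>_def using C that by simp
  qed
  have 1: "simple_integral W (k i) \<omega> = (\<Sum>j<N. \<xi> i j \<omega> * (W (p (Suc j)) \<omega> - W (p j) \<omega>))" if "i \<in> A" for i \<omega>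
    unfolding \<xi>_def using sub[OF _ that] by (intro simple_integral_eq_sum[OF k'[OF that] p(1,2)]) auto
  have 2: "(LINT u:{a..b}|lborel. (simple_process (k i) u \<omega>)\<^sup>2) = (\<Sum>j<N. (\<xi> i j \<omega>)\<^sup>2 * (p (Suc j) - p j))"
    if "i \<in> A" for i \<omega>
  proof -
    have "simple_process (k i) u \<omega> = step p N (\<lambda>j. \<xi> i j \<omega>) u" for u
      unfolding \<xi>_def using sub[OF _ that] by (intro simple_process_eq_step[OF k'[OF that] p(1)]) auto
    then have "(simple_process (k i) u \<omega>)\<^sup>2 = step p N (\<lambda>j. (\<xi> i j \<omega>)\<^sup>2) u" for u
      using step_map[OF p(1), of "\<lambda>x. x\<^sup>2"] by simp
    then show ?thesis using step_integral_const(2)[OF p(1), of N] p by simp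
  qed
  show ?thesis using ineq 1 2 by simp
qed

end

section \<open>Square integrable functions\<close>

definition square_integrable_on :: "(real \<Rightarrow> real) \<Rightarrow> real set \<Rightarrow> bool" where
  "square_integrable_on f A \<longleftrightarrow>
    set_borel_measurable lborel A f \<and> set_integrable lborel A (\<lambda>u. (f u)\<^sup>2)"

lemma set_borel_measurable_times:
  fixes f g :: "'a \<Rightarrow> real"
  assumes "set_borel_measurable M A f" "set_borel_measurable M A g"
  shows "set_borel_measurable M A (\<lambda>x. f x * g x)"
proof -
  have "(\<lambda>x. indicator A x *\<^sub>R (f x * g x)) = (\<lambda>x. (indicator A x *\<^sub>R f x) * (indicator A x *\<^sub>R g x))"
    by (auto simp: indicator_def)
  then show ?thesis using assms by (simp add: set_borel_measurable_def)
qed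

lemma set_borel_measurable_linear:
  fixes f g :: "'a \<Rightarrow> real"
  assumes "set_borel_measurable M A f" "set_borel_measurable M A g"
  shows "set_borel_measurable M A (\<lambda>x. c * f x + g x)"
proof -
  have "(\<lambda>x. indicator A x *\<^sub>R (c * f x + g x)) = (\<lambda>x. c * (indicator A x *\<^sub>R f x) + indicator A x *\<^sub>R g x)"
    by (auto simp: indicator_def)
  then show ?thesis using assms by (simp add: set_borel_measurable_def)
qed

lemma set_integrable_bound_real:
  fixes f g :: "real \<Rightarrow> real"
  assumes "set_integrable lborel A f" "set_borel_measurable lborel A g"
    and "\<And>u. u \<in> A \<Longrightarrow> \<bar>g u\<bar> \<le> \<bar>f u\<bar>"
  shows "set_integrable lborel A g"
  using assms(1) unfolding set_integrable_def
  by (rule Bochner_Integration.integrable_bound)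
     (use assms(2,3) in \<open>auto simp: set_borel_measurable_def indicator_def\<close>)

lemma set_integral_dominated:
  fixes f :: "nat \<Rightarrow> real \<Rightarrow> real"
  assumes w: "set_integrable lborel A w"
    and f: "\<And>n. set_borel_measurable lborel A (f n)" and g: "set_borel_measurable lborel A g"
    and lim: "AE u in lborel. u \<in> A \<longrightarrow> (\<lambda>n. f n u) \<longlonglongrightarrow> g u"
    and le: "\<And>n u. u \<in> A \<Longrightarrow> \<bar>f n u\<bar> \<le> w u"
  shows "(\<lambda>n. LINT u:A|lborel. f n u) \<longlonglongrightarrow> (LINT u:A|lborel. g u)"
  unfolding set_lebesgue_integral_def
proof (rule integral_dominated_convergence[where w="\<lambda>u. indicator A u *\<^sub>R w u"])
  show "AE u in lborel. (\<lambda>n. indicator A u *\<^sub>R f n u) \<longlonglongrightarrow> indicator A u *\<^sub>R g u"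
    using lim by eventually_elim (auto simp: indicator_def)
qed (use w f g le in \<open>auto simp: set_integrable_def set_borel_measurable_def indicator_def\<close>)

lemma sum_squares_le: "(x + y)\<^sup>2 \<le> 2 * x\<^sup>2 + 2 * (y::real)\<^sup>2"
  using sum_squares_bound[of x y] by (simp add: power2_sum)

lemma diff_squares_le: "(x - y)\<^sup>2 \<le> 2 * x\<^sup>2 + 2 * (y::real)\<^sup>2"
  using sum_squares_le[of x "- y"] by simp

lemma square_integrable_on_diff:
  assumes "square_integrable_on f A" "square_integrable_on g A"
  shows "square_integrable_on (\<lambda>u. f u - g u) A"
    and "(LINT u:A|lborel. (f u - g u)\<^sup>2) \<le>
      2 * (LINT u:A|lborel. (f u)\<^sup>2) + 2 * (LINT u:A|lborel. (g u)\<^sup>2)"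
proof -
  have m: "set_borel_measurable lborel A (\<lambda>u. f u - g u)"
    using set_borel_measurable_linear[of lborel A g f "-1"] assms
    by (simp add: square_integrable_on_def)
  have i: "set_integrable lborel A (\<lambda>u. 2 * (f u)\<^sup>2 + 2 * (g u)\<^sup>2)"
    using assms by (intro set_integral_add) (auto simp: square_integrable_on_def)
  have "set_integrable lborel A (\<lambda>u. (f u - g u)\<^sup>2)"
  proof (rule set_integrable_bound_real[OF i])
    show "set_borel_measurable lborel A (\<lambda>u. (f u - g u)\<^sup>2)"
      using set_borel_measurable_times[OF m m] by (simp add: power2_eq_square)
    show "\<bar>(f u - g u)\<^sup>2\<bar> \<le> \<bar>2 * (f u)\<^sup>2 + 2 * (g u)\<^sup>2\<bar>" for u
      using diff_squares_le[of "f u" "g u"] by simp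
  qed
  with m show "square_integrable_on (\<lambda>u. f u - g u) A"
    by (simp add: square_integrable_on_def)
  have "(LINT u:A|lborel. (f u - g u)\<^sup>2) \<le> (LINT u:A|lborel. 2 * (f u)\<^sup>2 + 2 * (g u)\<^sup>2)"
    by (rule set_integral_mono[OF _ i]) (use \<open>set_integrable lborel A (\<lambda>u. (f u - g u)\<^sup>2)\<close> diff_squares_le in auto)
  also have "\<dots> = 2 * (LINT u:A|lborel. (f u)\<^sup>2) + 2 * (LINT u:A|lborel. (g u)\<^sup>2)"
    using assms by (subst set_integral_add) (auto simp: square_integrable_on_def)
  finally show "(LINT u:A|lborel. (f u - g u)\<^sup>2) \<le>
      2 * (LINT u:A|lborel. (f u)\<^sup>2) + 2 * (LINT u:A|lborel. (g u)\<^sup>2)" .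
qed

lemma mean_square_triangle:
  assumes "square_integrable_on f A" "square_integrable_on g A" "square_integrable_on h A"
  shows "(LINT u:A|lborel. (f u - h u)\<^sup>2) \<le>
    2 * (LINT u:A|lborel. (f u - g u)\<^sup>2) + 2 * (LINT u:A|lborel. (g u - h u)\<^sup>2)"
  using square_integrable_on_diff(2)[OF square_integrable_on_diff(1)[OF assms(1,2)]
      square_integrable_on_diff(1)[OF assms(3,2)]]
  by (simp add: power2_commute[of "h _"])

lemma square_integrable_on_mult_bounded:
  assumes "square_integrable_on f A" "set_borel_measurable lborel A g" "\<And>u. u \<in> A \<Longrightarrow> (g u)\<^sup>2 \<le> C"
  shows "square_integrable_on (\<lambda>u. g u * f u) A"
    and "(LINT u:A|lborel. (g u * f u)\<^sup>2) \<le> C * (LINT u:A|lborel. (f u)\<^sup>2)"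
proof -
  have m: "set_borel_measurable lborel A (\<lambda>u. g u * f u)"
    using set_borel_measurable_times[OF assms(2)] assms(1) by (simp add: square_integrable_on_def)
  have i: "set_integrable lborel A (\<lambda>u. C * (f u)\<^sup>2)"
    using assms by (auto simp: square_integrable_on_def)
  have le: "(g u * f u)\<^sup>2 \<le> C * (f u)\<^sup>2" if "u \<in> A" for u
    using mult_right_mono[OF assms(3)[OF that], of "(f u)\<^sup>2"] by (simp add: power_mult_distrib)
  have "set_integrable lborel A (\<lambda>u. (g u * f u)\<^sup>2)"
  proof (rule set_integrable_bound_real[OF i])
    show "set_borel_measurable lborel A (\<lambda>u. (g u * f u)\<^sup>2)"
      using set_borel_measurable_times[OF m m] by (simp add: power2_eq_square)
    show "\<bar>(g u * f u)\<^sup>2\<bar> \<le> \<bar>C * (f u)\<^sup>2\<bar>" if "u \<in> A" for u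
      using le[OF that] by simp
  qed
  with m show "square_integrable_on (\<lambda>u. g u * f u) A"
    by (simp add: square_integrable_on_def)
  have "(LINT u:A|lborel. (g u * f u)\<^sup>2) \<le> (LINT u:A|lborel. C * (f u)\<^sup>2)"
    by (rule set_integral_mono[OF _ i]) (use \<open>set_integrable lborel A (\<lambda>u. (g u * f u)\<^sup>2)\<close> le in auto)
  then show "(LINT u:A|lborel. (g u * f u)\<^sup>2) \<le> C * (LINT u:A|lborel. (f u)\<^sup>2)"
    by simp
qed

lemma square_integrable_on_bounded:
  assumes "f \<in> borel_measurable borel" "\<And>u. \<bar>f u\<bar> \<le> C"
  shows "square_integrable_on f {a..b}"
  unfolding square_integrable_on_def
proof
  show m: "set_borel_measurable lborel {a..b} f"
    using assms(1) by (simp add: set_borel_measurable_def)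
  have i: "set_integrable lborel {a..b} (\<lambda>_. C\<^sup>2)"
    using borel_integrable_atLeastAtMost'[of a b "\<lambda>_. C\<^sup>2"] by simp
  show "set_integrable lborel {a..b} (\<lambda>u. (f u)\<^sup>2)"
  proof (rule set_integrable_bound_real[OF i])
    show "set_borel_measurable lborel {a..b} (\<lambda>u. (f u)\<^sup>2)"
      using set_borel_measurable_times[OF m m] by (simp add: power2_eq_square)
    show "\<bar>(f u)\<^sup>2\<bar> \<le> \<bar>C\<^sup>2\<bar>" for u
      using power_mono[OF assms(2)[of u], of 2] by simp
  qed
qed

lemma square_integrable_on_subset:
  "square_integrable_on f A \<Longrightarrow> B \<subseteq> A \<Longrightarrow> B \<in> sets borel \<Longrightarrow> square_integrable_on f B"
  unfolding square_integrable_on_def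
  by (auto intro: set_integrable_subset set_borel_measurable_subset)

lemma set_integral_nonneg_mono_set:
  fixes f :: "real \<Rightarrow> real"
  assumes "set_integrable lborel A f" "B \<subseteq> A" "B \<in> sets borel" "\<And>u. 0 \<le> f u"
  shows "(LINT u:B|lborel. f u) \<le> (LINT u:A|lborel. f u)"
  unfolding set_lebesgue_integral_def
  by (rule integral_mono)
     (use assms set_integrable_subset[OF assms(1), of B] in \<open>auto simp: set_integrable_def indicator_def\<close>)

lemma set_integral_square_nonneg: "0 \<le> (LINT u:A|lborel. (f u :: real)\<^sup>2)"
  unfolding set_lebesgue_integral_def by (rule integral_nonneg_AE) auto

section \<open>Progressive processes\<close>

context filtered_prob_space
begin

lemma progressive_subset:
  assumes "progressive F T X" "T' \<subseteq> T"
  shows "progressive F T' X"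
  unfolding progressive_def
proof
  fix t assume "t \<in> T'"
  then have X: "(\<lambda>(u, \<omega>). X u \<omega>) \<in> borel_measurable (restrict_space borel (T \<inter> {..t}) \<Otimes>\<^sub>M F t)"
    using assms by (auto simp: progressive_def)
  have [measurable]: "(\<lambda>u. u) \<in> restrict_space borel (T' \<inter> {..t}) \<rightarrow>\<^sub>M restrict_space borel (T \<inter> {..t})"
    by (intro measurable_restrict_space2 measurable_restrict_space1)
       (use assms(2) in \<open>auto simp: space_restrict_space\<close>)
  have "(\<lambda>(u, \<omega>). (u, \<omega>)) \<in> restrict_space borel (T' \<inter> {..t}) \<Otimes>\<^sub>M F t \<rightarrow>\<^sub>M
      restrict_space borel (T \<inter> {..t}) \<Otimes>\<^sub>M F t"
    by measurable
  from measurable_compose[OF this X]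
  show "(\<lambda>(u, \<omega>). X u \<omega>) \<in> borel_measurable (restrict_space borel (T' \<inter> {..t}) \<Otimes>\<^sub>M F t)"
    by (simp add: case_prod_unfold)
qed

lemma progressive_joint:
  assumes "progressive F T X" "{a..t} \<subseteq> T" "a \<le> t"
  shows "(\<lambda>(u, \<omega>). indicator {a..t} u * X u \<omega>) \<in> borel_measurable (borel \<Otimes>\<^sub>M F t)"
proof -
  have X: "(\<lambda>(u, \<omega>). X u \<omega>) \<in> borel_measurable (restrict_space borel (T \<inter> {..t}) \<Otimes>\<^sub>M F t)"
    using assms by (auto simp: progressive_def)
  \<comment> \<open>\<open>\<pi>\<close> retracts the line onto \<open>{a..t}\<close>, so that
    \<open>X\<close> composed with it is jointly measurable on the whole line; the indicator removes
    the artificial values.\<close>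
  define \<pi> where "\<pi> u = (if u \<in> {a..t} then u else t)" for u
  have [measurable]: "\<pi> \<in> borel \<rightarrow>\<^sub>M restrict_space borel (T \<inter> {..t})"
    using assms(2,3) unfolding \<pi>_def by (intro measurable_restrict_space2) auto
  have "(\<lambda>(u, \<omega>). (\<pi> u, \<omega>)) \<in> borel \<Otimes>\<^sub>M F t \<rightarrow>\<^sub>M restrict_space borel (T \<inter> {..t}) \<Otimes>\<^sub>M F t"
    by measurable
  from measurable_compose[OF this X]
  have [measurable]: "(\<lambda>(u, \<omega>). X (\<pi> u) \<omega>) \<in> borel_measurable (borel \<Otimes>\<^sub>M F t)"
    by (simp add: case_prod_unfold)
  have "(\<lambda>(u, \<omega>). indicator {a..t} u * X u \<omega>) = (\<lambda>(u, \<omega>). indicator {a..t} u * X (\<pi> u) \<omega>)"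
    by (auto simp: \<pi>_def indicator_def)
  also have "\<dots> \<in> borel_measurable (borel \<Otimes>\<^sub>M F t)" by measurable
  finally show ?thesis .
qed

lemma progressive_joint_M:
  assumes "progressive F T X" "{a..t} \<subseteq> T" "a \<le> t"
  shows "(\<lambda>(u, \<omega>). indicator {a..t} u * X u \<omega>) \<in> borel_measurable (borel \<Otimes>\<^sub>M M)"
proof -
  have "(\<lambda>\<omega>. \<omega>) \<in> M \<rightarrow>\<^sub>M F t"
    by (rule measurable_from_subalg[OF subalg[of t] measurable_ident_sets[OF refl]])
  then have "(\<lambda>(u, \<omega>). (u, \<omega>)) \<in> borel \<Otimes>\<^sub>M M \<rightarrow>\<^sub>M borel \<Otimes>\<^sub>M F t"
    by measurable
  from measurable_compose[OF this progressive_joint[OF assms]] show ?thesis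
    by (simp add: case_prod_unfold)
qed

lemma progressive_adapted:
  assumes "progressive F T X" "t \<in> T"
  shows "X t \<in> borel_measurable (F t)"
proof -
  have X: "(\<lambda>(u, \<omega>). X u \<omega>) \<in> borel_measurable (restrict_space borel (T \<inter> {..t}) \<Otimes>\<^sub>M F t)"
    using assms by (auto simp: progressive_def)
  have "(\<lambda>\<omega>. (t, \<omega>)) \<in> F t \<rightarrow>\<^sub>M restrict_space borel (T \<inter> {..t}) \<Otimes>\<^sub>M F t"
    using assms(2) by (intro measurable_Pair1') (auto simp: space_restrict_space)
  from measurable_compose[OF this X] show ?thesis by simp
qed

lemma path_integral_measurable:
  assumes "(\<lambda>(u, \<omega>). indicator A u * X u \<omega>) \<in> borel_measurable (borel \<Otimes>\<^sub>M N)"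
  shows "(\<lambda>\<omega>. LINT u:A|lborel. X u \<omega> :: real) \<in> borel_measurable N"
proof -
  have "(\<lambda>(\<omega>, u). indicator A u * X u \<omega>) \<in> borel_measurable (N \<Otimes>\<^sub>M lborel)"
    using measurable_compose[OF measurable_pair_swap' assms] by (simp add: case_prod_unfold)
  then show ?thesis
    unfolding set_lebesgue_integral_def
    by (intro lborel.borel_measurable_lebesgue_integral) simp
qed

lemma progressive_path_integral:
  assumes "progressive F T X" "{a..t} \<subseteq> T" "a \<le> t"
  shows "(\<lambda>\<omega>. LINT u:{a..t}|lborel. X u \<omega>) \<in> borel_measurable (F t)"
  by (rule path_integral_measurable[OF progressive_joint[OF assms]])

lemma progressive_path_measurable:
  assumes "progressive F T X" "{a..t} \<subseteq> T" "a \<le> t" "\<omega> \<in> space M"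
  shows "set_borel_measurable lborel {a..t} (\<lambda>u. X u \<omega>)"
proof -
  have "(\<lambda>u. (u, \<omega>)) \<in> borel \<rightarrow>\<^sub>M borel \<Otimes>\<^sub>M M"
    using assms(4) by (intro measurable_Pair2') auto
  from measurable_compose[OF this progressive_joint_M[OF assms(1-3)]]
  show ?thesis by (simp add: set_borel_measurable_def)
qed

lemma simple_process_square_integrable:
  assumes "simple_on F a b hs" "\<omega> \<in> space M"
  shows "square_integrable_on (\<lambda>u. simple_process hs u \<omega>) {c..d}"
  using simple_process_bounded[OF assms(1)] assms(2)
  by (auto intro!: square_integrable_on_bounded)

lemma distance_measurable:
  assumes "progressive F T H" "{a..b} \<subseteq> T" "a \<le> b"
    and k: "(\<lambda>(u, \<omega>). k u \<omega>) \<in> borel_measurable (borel \<Otimes>\<^sub>M M)"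
  shows "(\<lambda>\<omega>. LINT u:{a..b}|lborel. (k u \<omega> - H u \<omega> :: real)\<^sup>2) \<in> borel_measurable M"
proof (rule path_integral_measurable)
  note [measurable] = k progressive_joint_M[OF assms(1-3)]
  have "(\<lambda>(u, \<omega>). indicator {a..b} u * (k u \<omega> - H u \<omega>)\<^sup>2) =
      (\<lambda>(u, \<omega>). indicator {a..b} u * (k u \<omega> - indicator {a..b} u * H u \<omega>)\<^sup>2)"
    by (auto simp: indicator_def)
  also have "\<dots> \<in> borel_measurable (borel \<Otimes>\<^sub>M M)" by measurable
  finally show "(\<lambda>(u, \<omega>). indicator {a..b} u * (k u \<omega> - H u \<omega>)\<^sup>2) \<in> borel_measurable (borel \<Otimes>\<^sub>M M)" .
qed

end

section \<open>The Ito integral by almost sure limits\<close>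

lemma (in prob_space) tendsto_in_prob_diff_0:
  assumes "tendsto_in_prob M X Y"
  shows "(\<lambda>n. prob_norm M (\<lambda>\<omega>. X n \<omega> - Y \<omega>)) \<longlonglongrightarrow> 0"
  using assms tendsto_in_prob_iff_prob_norm[of X Y] by (simp add: tendsto_in_prob_def)

lemma (in prob_space) prob_norm_add_tendsto_0:
  assumes "\<And>n. X n \<in> borel_measurable M" "\<And>n. Y n \<in> borel_measurable M"
    and "(\<lambda>n. prob_norm M (X n)) \<longlonglongrightarrow> 0" "(\<lambda>n. prob_norm M (Y n)) \<longlonglongrightarrow> 0"
  shows "(\<lambda>n. prob_norm M (\<lambda>\<omega>. X n \<omega> + Y n \<omega>)) \<longlonglongrightarrow> 0"
proof (rule tendsto_sandwich[of "\<lambda>_. 0"])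
  show "(\<lambda>n. prob_norm M (X n) + prob_norm M (Y n)) \<longlonglongrightarrow> 0"
    using tendsto_add[OF assms(3,4)] by simp
qed (use assms(1,2) in \<open>auto intro!: always_eventually prob_norm_add prob_norm_nonneg\<close>)

lemma (in prob_space) prob_norm_combination_tendsto_0:
  assumes [measurable]: "\<And>n. X n \<in> borel_measurable M" "\<And>n. Y n \<in> borel_measurable M"
      "\<And>n. Z n \<in> borel_measurable M"
    and X: "(\<lambda>n. prob_norm M (X n)) \<longlonglongrightarrow> 0" and Y: "(\<lambda>n. prob_norm M (Y n)) \<longlonglongrightarrow> 0"
    and Z: "\<And>n. AE \<omega> in M. 0 \<le> Z n \<omega> \<and> Z n \<omega> \<le> 2 * X n \<omega> + 2 * Y n \<omega>"
  shows "(\<lambda>n. prob_norm M (Z n)) \<longlonglongrightarrow> 0"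
proof (rule tendsto_sandwich[OF _ _ tendsto_const]; (intro always_eventually allI)?)
  show "(\<lambda>n. 2 * prob_norm M (X n) + 2 * prob_norm M (Y n)) \<longlonglongrightarrow> 0"
    using tendsto_add[OF tendsto_mult_right_zero[OF X, of 2] tendsto_mult_right_zero[OF Y, of 2]] by simp
  fix n
  have "AE \<omega> in M. \<bar>Z n \<omega>\<bar> \<le> \<bar>2 * X n \<omega> + 2 * Y n \<omega>\<bar>"
    using Z[of n] by eventually_elim linarith
  then have "prob_norm M (Z n) \<le> prob_norm M (\<lambda>\<omega>. 2 * X n \<omega> + 2 * Y n \<omega>)"
    by (intro prob_norm_mono_AE) measurable
  also have "\<dots> \<le> prob_norm M (\<lambda>\<omega>. 2 * X n \<omega>) + prob_norm M (\<lambda>\<omega>. 2 * Y n \<omega>)"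
    by (rule prob_norm_add) measurable
  also have "\<dots> \<le> 2 * prob_norm M (X n) + 2 * prob_norm M (Y n)"
    using prob_norm_cmult[of "X n" 2] prob_norm_cmult[of "Y n" 2] by simp
  finally show "prob_norm M (Z n) \<le> 2 * prob_norm M (X n) + 2 * prob_norm M (Y n)" .
qed (rule prob_norm_nonneg)

lemma (in prob_space) prob_norm_sum_tendsto_0:
  assumes "finite I" "\<And>i n. i \<in> I \<Longrightarrow> X i n \<in> borel_measurable M"
    and "\<And>i. i \<in> I \<Longrightarrow> (\<lambda>n. prob_norm M (X i n)) \<longlonglongrightarrow> 0"
  shows "(\<lambda>n. prob_norm M (\<lambda>\<omega>. \<Sum>i\<in>I. X i n \<omega>)) \<longlonglongrightarrow> 0"
  using assms
proof (induction I rule: finite_induct)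
  case (insert i I)
  then show ?case
    using prob_norm_add_tendsto_0[of "X i" "\<lambda>n \<omega>. \<Sum>i\<in>I. X i n \<omega>"] by simp
qed (simp add: prob_norm_def)

lemma (in prob_space) prob_norm_abs: "prob_norm M (\<lambda>\<omega>. \<bar>X \<omega>\<bar>) = prob_norm M X"
  by (simp add: prob_norm_def)

text \<open>How the estimates are exploited: first fix the level \<open>d\<close> small, then let
  \<open>n\<close> grow, which makes the second summand small for this fixed
  \<open>d\<close>.\<close>

lemma (in prob_space) budget_tendsto_0:
  assumes "\<And>n d. 0 < d \<Longrightarrow> prob_norm M (Q n) \<le> d + prob_norm M (\<lambda>\<omega>. c * Y n \<omega> / d)"
    and [measurable]: "\<And>n. Y n \<in> borel_measurable M"
    and Y: "AE \<omega> in M. (\<lambda>n. Y n \<omega>) \<longlonglongrightarrow> 0"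
  shows "(\<lambda>n. prob_norm M (Q n)) \<longlonglongrightarrow> 0"
proof (rule LIMSEQ_I)
  fix r :: real assume r: "0 < r"
  have "(\<lambda>n. prob_norm M (\<lambda>\<omega>. c * Y n \<omega> / (r / 2))) \<longlonglongrightarrow> 0"
  proof (rule prob_norm_tendsto_0_AE)
    show "AE \<omega> in M. (\<lambda>n. c * Y n \<omega> / (r / 2)) \<longlonglongrightarrow> 0"
      using Y by eventually_elim (use r in \<open>auto intro!: tendsto_eq_intros\<close>)
  qed measurable
  from LIMSEQ_D[OF this, of "r / 2"] obtain n0 where n0: "\<And>n. n \<ge> n0 \<Longrightarrow>
      prob_norm M (\<lambda>\<omega>. c * Y n \<omega> / (r / 2)) < r / 2"
    using r by (auto simp: prob_norm_nonneg)
  have "prob_norm M (Q n) < r" if "n \<ge> n0" for n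
    using assms(1)[of "r / 2" n] r n0[OF that] by simp
  then show "\<exists>n0. \<forall>n\<ge>n0. norm (prob_norm M (Q n) - 0) < r"
    using prob_norm_nonneg by (intro exI[of _ n0]) auto
qed

text \<open>Threshold argument: either the absolute value of \<open>X\<close> is at most
  \<open>e\<close>, or it is bounded by its square divided by \<open>e\<close>. It recovers
  convergence of \<open>X\<close> from that of its square.\<close>

lemma (in prob_space) prob_norm_square:
  assumes [measurable]: "X \<in> borel_measurable M" and e: "0 < e" "e \<le> 1"
  shows "prob_norm M X \<le> e + prob_norm M (\<lambda>\<omega>. (X \<omega>)\<^sup>2) / e"
proof -
  have "min 1 \<bar>x\<bar> \<le> e + min 1 \<bar>x\<^sup>2\<bar> / e" for x
  proof (cases "\<bar>x\<bar> \<le> e")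
    case True
    then show ?thesis using e by (auto intro!: add_increasing2 simp: min_le_iff_disj)
  next
    case False
    then have *: "\<bar>x\<bar> * e \<le> \<bar>x\<bar> * \<bar>x\<bar>" by (intro mult_left_mono) auto
    have "min 1 \<bar>x\<bar> * e \<le> min 1 \<bar>x\<^sup>2\<bar>"
    proof (rule min.boundedI)
      show "min 1 \<bar>x\<bar> * e \<le> 1" using e by (intro mult_le_one) auto
      have "min 1 \<bar>x\<bar> * e \<le> \<bar>x\<bar> * e" using e by (intro mult_right_mono) auto
      also note *
      finally show "min 1 \<bar>x\<bar> * e \<le> \<bar>x\<^sup>2\<bar>" by (simp add: power2_eq_square abs_mult)
    qed
    then have "min 1 \<bar>x\<bar> \<le> min 1 \<bar>x\<^sup>2\<bar> / e" using e by (simp add: field_simps)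
    then show ?thesis using e by simp
  qed
  then have "prob_norm M X \<le> (\<integral>\<omega>. e + min 1 \<bar>(X \<omega>)\<^sup>2\<bar> / e \<partial>M)"
    unfolding prob_norm_def
    by (intro integral_mono prob_norm_integrable Bochner_Integration.integrable_add integrable_divide_zero) auto
  also have "\<dots> = e + prob_norm M (\<lambda>\<omega>. (X \<omega>)\<^sup>2) / e"
    unfolding prob_norm_def using prob_norm_integrable[of "\<lambda>\<omega>. (X \<omega>)\<^sup>2"]
    by (subst Bochner_Integration.integral_add) (auto simp: prob_space)
  finally show ?thesis .
qed

lemma (in prob_space) prob_norm_square_tendsto_0:
  assumes [measurable]: "\<And>n. X n \<in> borel_measurable M"
    and L: "(\<lambda>n. prob_norm M (\<lambda>\<omega>. (X n \<omega>)\<^sup>2)) \<longlonglongrightarrow> 0"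
  shows "(\<lambda>n. prob_norm M (X n)) \<longlonglongrightarrow> 0"
proof (rule LIMSEQ_I)
  fix r :: real assume r: "0 < r"
  define e where "e = min 1 (r / 2)"
  have e: "0 < e" "e \<le> 1" "e \<le> r / 2" using r by (auto simp: e_def)
  obtain n0 where n0: "\<And>n. n \<ge> n0 \<Longrightarrow> prob_norm M (\<lambda>\<omega>. (X n \<omega>)\<^sup>2) < e * (r / 2)"
    using LIMSEQ_D[OF L, of "e * (r / 2)"] e r by (auto simp: prob_norm_nonneg)
  have "prob_norm M (X n) < r" if "n \<ge> n0" for n
  proof -
    have "prob_norm M (\<lambda>\<omega>. (X n \<omega>)\<^sup>2) / e < r / 2"
      using n0[OF that] e by (simp add: field_simps)
    then show ?thesis using prob_norm_square[OF assms(1) e(1,2), of n] e by linarith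
  qed
  then show "\<exists>n0. \<forall>n\<ge>n0. norm (prob_norm M (X n) - 0) < r"
    using prob_norm_nonneg by (intro exI[of _ n0]) auto
qed

context wiener_space
begin

lemma has_ito_integralI_AE:
  assumes "progressive F {a..b} H" "0 \<le> a" "a \<le> b"
    and "AE \<omega> in M. set_integrable lborel {a..b} (\<lambda>u. (H u \<omega>)\<^sup>2)"
    and hs: "\<And>n. simple_on F a b (hs n)"
    and "AE \<omega> in M. (\<lambda>n. LINT u:{a..b}|lborel. (simple_process (hs n) u \<omega> - H u \<omega>)\<^sup>2) \<longlonglongrightarrow> 0"
    and "I \<in> borel_measurable M"
    and "AE \<omega> in M. (\<lambda>n. simple_integral W (hs n) \<omega>) \<longlonglongrightarrow> I \<omega>"
  shows "has_ito_integral M F W H a b I"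
  unfolding has_ito_integral_def using assms
  by (auto intro!: exI[of _ hs] tendsto_in_prob_AE simple_integral_measurable
      distance_measurable simple_process_measurable_pair)

text \<open>The mean square error and the error of the integrals are both nonnegative, so extracting
  a subsequence from their sum makes one subsequence serve both limits.\<close>

lemma has_ito_integralE_AE:
  assumes "has_ito_integral M F W H a b I" "0 \<le> a" "a \<le> b"
  obtains hs where "\<And>n. simple_on F a b (hs n)"
    "AE \<omega> in M. (\<lambda>n. LINT u:{a..b}|lborel. (simple_process (hs n) u \<omega> - H u \<omega>)\<^sup>2) \<longlonglongrightarrow> 0"
    "AE \<omega> in M. (\<lambda>n. simple_integral W (hs n) \<omega>) \<longlonglongrightarrow> I \<omega>"
proof -
  obtain hs where hs: "\<And>n. simple_on F a b (hs n)"
    and 1: "tendsto_in_prob M (\<lambda>n \<omega>. LINT u:{a..b}|lborel. (simple_process (hs n) u \<omega> - H u \<omega>)\<^sup>2) (\<lambda>_. 0)"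
    and 2: "tendsto_in_prob M (\<lambda>n. simple_integral W (hs n)) I"
    using assms(1) by (auto simp: has_ito_integral_def)
  define X where "X n \<omega> = (LINT u:{a..b}|lborel. (simple_process (hs n) u \<omega> - H u \<omega>)\<^sup>2)" for n \<omega>
  define Y where "Y n \<omega> = \<bar>simple_integral W (hs n) \<omega> - I \<omega>\<bar>" for n \<omega>
  have X[measurable]: "X n \<in> borel_measurable M" for n
    using 1 unfolding X_def tendsto_in_prob_def by simp
  have Y[measurable]: "Y n \<in> borel_measurable M" for n
  proof -
    have [measurable]: "simple_integral W (hs n) \<in> borel_measurable M" "I \<in> borel_measurable M"
      using 2 by (auto simp: tendsto_in_prob_def)
    show ?thesis unfolding Y_def[abs_def] by measurable
  qed
  have "(\<lambda>n. prob_norm M (\<lambda>\<omega>. X n \<omega> + Y n \<omega>)) \<longlonglongrightarrow> 0"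
    using tendsto_in_prob_diff_0[OF 1] tendsto_in_prob_diff_0[OF 2]
    by (intro prob_norm_add_tendsto_0 X Y) (simp_all add: X_def Y_def prob_norm_abs)
  then obtain r :: "nat \<Rightarrow> nat" where r: "strict_mono r" "AE \<omega> in M. (\<lambda>n. X (r n) \<omega> + Y (r n) \<omega>) \<longlonglongrightarrow> 0"
    using prob_norm_subseq[of "\<lambda>n \<omega>. X n \<omega> + Y n \<omega>"] by auto
  have nn: "0 \<le> X n \<omega>" "0 \<le> Y n \<omega>" for n \<omega>
    by (auto simp: X_def Y_def set_integral_square_nonneg)
  show ?thesis
  proof (rule that[of "\<lambda>n. hs (r n)"])
    show "AE \<omega> in M. (\<lambda>n. LINT u:{a..b}|lborel. (simple_process (hs (r n)) u \<omega> - H u \<omega>)\<^sup>2) \<longlonglongrightarrow> 0"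
      using r(2)
    proof eventually_elim
      case (elim \<omega>)
      have "(\<lambda>n. X (r n) \<omega>) \<longlonglongrightarrow> 0"
        by (rule tendsto_sandwich[OF _ _ tendsto_const elim]) (use nn in auto)
      then show ?case by (simp add: X_def)
    qed
    show "AE \<omega> in M. (\<lambda>n. simple_integral W (hs (r n)) \<omega>) \<longlonglongrightarrow> I \<omega>"
      using r(2)
    proof eventually_elim
      case (elim \<omega>)
      have "(\<lambda>n. Y (r n) \<omega>) \<longlonglongrightarrow> 0"
        by (rule tendsto_sandwich[OF _ _ tendsto_const elim]) (use nn in auto)
      then show ?case unfolding Y_def tendsto_rabs_zero_iff by (rule LIM_zero_cancel)
    qed
  qed (rule hs)
qed

lemma has_ito_integral_square_integrable:
  assumes "has_ito_integral M F W H a b I" "a \<le> b"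
  shows "AE \<omega> in M. square_integrable_on (\<lambda>u. H u \<omega>) {a..b}"
proof -
  have "AE \<omega> in M. set_integrable lborel {a..b} (\<lambda>u. (H u \<omega>)\<^sup>2)" and p: "progressive F {a..b} H"
    using assms by (auto simp: has_ito_integral_def)
  from this(1) AE_space show ?thesis
    by eventually_elim (use progressive_path_measurable[OF p] assms in \<open>auto simp: square_integrable_on_def\<close>)
qed

text \<open>Continuity of the elementary integral at 0 in probability. Applied to differences, it
  shows that the limit does not depend on the approximating sequence.\<close>

lemma simple_integral_tendsto_0:
  assumes k: "\<And>n. simple_on F a b (k n)" and ab: "0 \<le> a" "a \<le> b"
    and L: "AE \<omega> in M. (\<lambda>n. LINT u:{a..b}|lborel. (simple_process (k n) u \<omega>)\<^sup>2) \<longlonglongrightarrow> 0"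
  shows "(\<lambda>n. prob_norm M (simple_integral W (k n))) \<longlonglongrightarrow> 0"
proof (rule prob_norm_square_tendsto_0)
  \<comment> \<open>The squared integrand is treated as its squared distance from the zero process,
    so that \<open>distance_measurable\<close> yields measurability of its integral.\<close>
  have 0: "progressive F UNIV (\<lambda>_ _. 0)" by (simp add: progressive_def case_prod_unfold)
  show [measurable]: "simple_integral W (k n) \<in> borel_measurable M" for n
    using simple_integral_measurable[OF k ab(1)] .
  have [measurable]: "(\<lambda>\<omega>. LINT u:{a..b}|lborel. (simple_process (k n) u \<omega>)\<^sup>2) \<in> borel_measurable M" for n
    using distance_measurable[OF 0 _ ab(2) simple_process_measurable_pair[OF k]] by simp
  show "(\<lambda>n. prob_norm M (\<lambda>\<omega>. (simple_integral W (k n) \<omega>)\<^sup>2)) \<longlonglongrightarrow> 0"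
    using simple_family_inequality[of "{0::nat}" a b "\<lambda>_. k _"] k ab
    by (intro budget_tendsto_0[OF _ _ L, where c=1]) simp_all
qed

end

lemma step_square_integrable: "square_integrable_on (step p N c) {a..b}"
proof (rule square_integrable_on_bounded)
  show "\<bar>step p N c u\<bar> \<le> (\<Sum>j<N. \<bar>c j\<bar>)" for u
    unfolding step_def by (rule order_trans[OF sum_abs sum_mono]) (auto simp: indicator_def)
qed simp

section \<open>Restriction of simple processes\<close>

text \<open>The case distinction keeps the coefficient measurable at the new left end point, which is \<open>r\<close> and
  hence smaller than \<open>s\<close> if \<open>r < s\<close>.\<close>

definition clip :: "real \<Rightarrow> real \<Rightarrow> ('a \<Rightarrow> real) \<Rightarrow> 'a simple \<Rightarrow> 'a simple" where
  "clip l r w hs = map (\<lambda>(s, t, \<xi>).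
     (min r (max l s), min r (max l t), \<lambda>\<omega>. if s \<le> r then w \<omega> * \<xi> \<omega> else 0)) hs"

lemma clip_Nil[simp]: "clip l r w [] = []"
  and clip_Cons[simp]: "clip l r w ((s, t, \<xi>) # hs) =
    (min r (max l s), min r (max l t), \<lambda>\<omega>. if s \<le> r then w \<omega> * \<xi> \<omega> else 0) # clip l r w hs"
  by (simp_all add: clip_def)

lemma simple_process_clip:
  assumes "simple_on F a b hs" "l \<le> r"
  shows "simple_process (clip l r w hs) u \<omega> = w \<omega> * (indicator {l<..r} u * simple_process hs u \<omega>)"
  using assms(1)
proof (induction hs)
  case (Cons h hs)
  obtain s t \<xi> where h: "h = (s, t, \<xi>)" by (cases h)
  have "(if s \<le> r then w \<omega> * \<xi> \<omega> else 0) * indicator {min r (max l s)<..min r (max l t)} u =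
      w \<omega> * (indicator {l<..r} u * (\<xi> \<omega> * indicator {s<..t} u))"
    using Cons.prems assms(2) by (auto simp: h indicator_def min_def max_def)
  then show ?case using Cons by (simp add: h distrib_left)
qed simp

text \<open>Additivity in the interval. It allows the increment of an integral over a cell to be
  multiplied by a weight known at the left end point without leaving the simple processes.\<close>

lemma simple_integral_clip:
  assumes "simple_on F a b hs" "a \<le> l" "l \<le> r"
  shows "simple_integral W (clip l r w hs) \<omega> =
    w \<omega> * (simple_integral W (clip a r (\<lambda>_. 1) hs) \<omega> - simple_integral W (clip a l (\<lambda>_. 1) hs) \<omega>)"
  using assms(1)
proof (induction hs)
  case (Cons h hs)
  obtain s t \<xi> where h: "h = (s, t, \<xi>)" by (cases h)
  have "(if s \<le> r then w \<omega> * \<xi> \<omega> else 0) * (W (min r (max l t)) \<omega> - W (min r (max l s)) \<omega>) =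
      w \<omega> * ((if s \<le> r then 1 * \<xi> \<omega> else 0) * (W (min r (max a t)) \<omega> - W (min r (max a s)) \<omega>)
        - (if s \<le> l then 1 * \<xi> \<omega> else 0) * (W (min l (max a t)) \<omega> - W (min l (max a s)) \<omega>))"
    using Cons.prems assms(2,3) by (auto simp: h min_def max_def algebra_simps)
  then show ?case using Cons by (simp add: h algebra_simps)
qed simp

context filtered_prob_space
begin

lemma simple_on_mono: "simple_on F l r hs \<Longrightarrow> a \<le> l \<Longrightarrow> r \<le> b \<Longrightarrow> simple_on F a b hs"
  by (induction hs) auto

lemma simple_on_clip:
  assumes "simple_on F a b hs" "l \<le> r" "w \<in> borel_measurable (F l)" "\<And>\<omega>. \<omega> \<in> space M \<Longrightarrow> \<bar>w \<omega>\<bar> \<le> B"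
  shows "simple_on F l r (clip l r w hs)"
  using assms(1)
proof (induction hs)
  case (Cons h hs)
  obtain s t \<xi> where h: "h = (s, t, \<xi>)" by (cases h)
  from Cons.prems obtain C where C: "\<And>\<omega>. \<omega> \<in> space M \<Longrightarrow> \<bar>\<xi> \<omega>\<bar> \<le> C" and \<xi>: "\<xi> \<in> borel_measurable (F s)"
    by (auto simp: h space_F)
  have m: "(\<lambda>\<omega>. if s \<le> r then w \<omega> * \<xi> \<omega> else 0) \<in> borel_measurable (F (min r (max l s)))"
  proof (cases "s \<le> r")
    case True
    then have "w \<in> borel_measurable (F (min r (max l s)))" "\<xi> \<in> borel_measurable (F (min r (max l s)))"
      using assms(2) by (auto intro!: measurable_F_mono[OF _ assms(3)] measurable_F_mono[OF _ \<xi>])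
    then show ?thesis using True by simp
  qed simp
  have "\<bar>if s \<le> r then w \<omega> * \<xi> \<omega> else 0\<bar> \<le> \<bar>B\<bar> * \<bar>C\<bar>" if "\<omega> \<in> space M" for \<omega>
    using mult_mono[of "\<bar>w \<omega>\<bar>" "\<bar>B\<bar>" "\<bar>\<xi> \<omega>\<bar>" "\<bar>C\<bar>"] assms(4)[OF that] C[OF that]
    by (auto simp: abs_mult)
  then have "\<exists>C. \<forall>\<omega>\<in>space (F (min r (max l s))). \<bar>if s \<le> r then w \<omega> * \<xi> \<omega> else 0\<bar> \<le> C"
    unfolding space_F by blast
  moreover have "min r (max l s) \<le> min r (max l t)"
    using Cons.prems by (auto simp: h intro!: min.mono max.mono)
  ultimately show ?case using Cons m assms(2) by (simp add: h)
qed simp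

lemma simple_on_singleton:
  assumes "l \<le> r" "w \<in> borel_measurable (F l)" "\<And>\<omega>. \<omega> \<in> space M \<Longrightarrow> \<bar>w \<omega>\<bar> \<le> B"
  shows "simple_on F l r [(l, r, w)]"
  using assms by (auto simp: space_F)

end

lemma simple_integral_clip_whole:
  assumes "simple_on F a b hs"
  shows "simple_integral W (clip a b (\<lambda>_. 1) hs) \<omega> = simple_integral W hs \<omega>"
  using assms by (induction hs) (auto simp: max_def min_def)

context wiener_space
begin

text \<open>\<open>J\<close> comes with its own approximants on \<open>{a..r}\<close>, unrelated to
  \<open>hs\<close>. Both sequences, cut to this interval, approximate \<open>H\<close> in mean
  square, so the integral of their difference vanishes in probability.\<close>

lemma restriction_tendsto:
  assumes H: "progressive F {a..T} H" "0 \<le> a" "a \<le> r" "r \<le> T"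
    and hs: "\<And>n. simple_on F a T (hs n)"
    and L: "AE \<omega> in M. (\<lambda>n. LINT u:{a..T}|lborel. (simple_process (hs n) u \<omega> - H u \<omega>)\<^sup>2) \<longlonglongrightarrow> 0"
    and sq: "AE \<omega> in M. square_integrable_on (\<lambda>u. H u \<omega>) {a..T}"
    and J: "has_ito_integral M F W H a r J"
  shows "(\<lambda>n. prob_norm M (\<lambda>\<omega>. simple_integral W (clip a r (\<lambda>_. 1) (hs n)) \<omega> - J \<omega>)) \<longlonglongrightarrow> 0"
proof -
  obtain hs' where hs': "\<And>n. simple_on F a r (hs' n)"
    and L': "AE \<omega> in M. (\<lambda>n. LINT u:{a..r}|lborel. (simple_process (hs' n) u \<omega> - H u \<omega>)\<^sup>2) \<longlonglongrightarrow> 0"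
    and I': "AE \<omega> in M. (\<lambda>n. simple_integral W (hs' n) \<omega>) \<longlonglongrightarrow> J \<omega>"
    using has_ito_integralE_AE[OF J H(2,3)] by blast
  have [measurable]: "J \<in> borel_measurable M"
    using J by (auto simp: has_ito_integral_def tendsto_in_prob_def)
  \<comment> \<open>A difference of simple processes: the weight -1 of \<open>clip\<close> supplies
    the subtraction.\<close>
  define k where "k n = clip a r (\<lambda>_. 1) (hs n) @ clip a r (\<lambda>_. -1) (hs' n)" for n
  have c: "simple_on F a r (clip a r (\<lambda>_. c) (hs n))" "simple_on F a r (clip a r (\<lambda>_. c) (hs' n))" for c n
    using simple_on_clip[OF hs H(3), of "\<lambda>_. c" "\<bar>c\<bar>"] simple_on_clip[OF hs' H(3), of "\<lambda>_. c" "\<bar>c\<bar>"] by auto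
  have k: "simple_on F a r (k n)" for n
    unfolding k_def using c by simp
  have kI: "simple_integral W (k n) \<omega> = simple_integral W (clip a r (\<lambda>_. 1) (hs n)) \<omega> - simple_integral W (hs' n) \<omega>" for n \<omega>
  proof -
    have "simple_integral W (clip a a (\<lambda>_. 1) (hs' n)) \<omega> = 0"
      by (rule simple_integral_degenerate[OF simple_on_clip[OF hs', where B=1]]) auto
    then have "simple_integral W (clip a r (\<lambda>_. -1) (hs' n)) \<omega> = - simple_integral W (hs' n) \<omega>"
      using simple_integral_clip[OF hs', of a r W "\<lambda>_. -1" n \<omega>] H(3) simple_integral_clip_whole[OF hs'] by simp
    then show ?thesis by (simp add: k_def)
  qed
  have "AE \<omega> in M. (\<lambda>n. LINT u:{a..r}|lborel. (simple_process (k n) u \<omega>)\<^sup>2) \<longlonglongrightarrow> 0"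
    using L L' sq AE_space
  proof eventually_elim
    case (elim \<omega>)
    have f: "square_integrable_on (\<lambda>u. simple_process (hs n) u \<omega> - H u \<omega>) {a..T}" for n
      by (intro square_integrable_on_diff(1) simple_process_square_integrable[OF hs] elim)
    have g: "square_integrable_on (\<lambda>u. simple_process (hs' n) u \<omega> - H u \<omega>) {a..r}" for n
      by (intro square_integrable_on_diff(1) simple_process_square_integrable[OF hs'] elim
          square_integrable_on_subset[OF elim(3)]) (use H in auto)
    have f': "square_integrable_on (\<lambda>u. simple_process (hs n) u \<omega> - H u \<omega>) {a..r}" for n
      by (rule square_integrable_on_subset[OF f]) (use H in auto)
    define X where "X n = (LINT u:{a..T}|lborel. (simple_process (hs n) u \<omega> - H u \<omega>)\<^sup>2)" for n
    define Y where "Y n = (LINT u:{a..r}|lborel. (simple_process (hs' n) u \<omega> - H u \<omega>)\<^sup>2)" for n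
    have le: "(LINT u:{a..r}|lborel. (simple_process (k n) u \<omega>)\<^sup>2) \<le> 2 * X n + 2 * Y n" for n
    proof -
      have "(LINT u:{a..r}|lborel. (simple_process (k n) u \<omega>)\<^sup>2) =
          (LINT u:{a..r}|lborel. (indicator {a<..r} u * ((simple_process (hs n) u \<omega> - H u \<omega>)
            - (simple_process (hs' n) u \<omega> - H u \<omega>)))\<^sup>2)"
        unfolding k_def simple_process_append simple_process_clip[OF hs H(3)] simple_process_clip[OF hs' H(3)]
        by (simp add: algebra_simps)
      also have "\<dots> \<le> 1 * (LINT u:{a..r}|lborel. ((simple_process (hs n) u \<omega> - H u \<omega>)
            - (simple_process (hs' n) u \<omega> - H u \<omega>))\<^sup>2)"
        by (rule square_integrable_on_mult_bounded(2)[OF square_integrable_on_diff(1)[OF f' g]])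
          (auto simp: set_borel_measurable_def indicator_def)
      also have "\<dots> \<le> 2 * (LINT u:{a..r}|lborel. (simple_process (hs n) u \<omega> - H u \<omega>)\<^sup>2) + 2 * Y n"
        using square_integrable_on_diff(2)[OF f' g] by (simp add: Y_def)
      also have "(LINT u:{a..r}|lborel. (simple_process (hs n) u \<omega> - H u \<omega>)\<^sup>2) \<le> X n"
        unfolding X_def using f[of n] H
        by (intro set_integral_nonneg_mono_set) (auto simp: square_integrable_on_def)
      finally show ?thesis by simp
    qed
    have lim: "(\<lambda>n. 2 * X n + 2 * Y n) \<longlonglongrightarrow> 0"
      using elim(1,2) unfolding X_def Y_def by (auto intro!: tendsto_eq_intros)
    show ?case
      by (rule tendsto_sandwich[OF _ _ tendsto_const lim])
         (auto intro!: always_eventually set_integral_square_nonneg le)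
  qed
  then have "(\<lambda>n. prob_norm M (simple_integral W (k n))) \<longlonglongrightarrow> 0"
    by (rule simple_integral_tendsto_0[OF k H(2,3)])
  moreover have "(\<lambda>n. prob_norm M (\<lambda>\<omega>. simple_integral W (hs' n) \<omega> - J \<omega>)) \<longlonglongrightarrow> 0"
    using I' simple_integral_measurable[OF hs' H(2)]
    by (intro tendsto_in_prob_diff_0 tendsto_in_prob_AE) auto
  ultimately have "(\<lambda>n. prob_norm M (\<lambda>\<omega>. simple_integral W (k n) \<omega> + (simple_integral W (hs' n) \<omega> - J \<omega>))) \<longlonglongrightarrow> 0"
    using simple_integral_measurable[OF hs' H(2)] simple_integral_measurable[OF k H(2)]
    by (intro prob_norm_add_tendsto_0) auto
  then show ?thesis by (simp add: kI)
qed

lemma step_distance_measurable: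
  assumes "progressive F T' H" "{a..T} \<subseteq> T'" "a \<le> T" "\<And>j. j < N \<Longrightarrow> \<eta> j \<in> borel_measurable M"
  shows "(\<lambda>\<omega>. LINT u:{a..T}|lborel. (step p N (\<lambda>j. \<eta> j \<omega>) u - H u \<omega>)\<^sup>2) \<in> borel_measurable M"
proof (rule distance_measurable[OF assms(1-3)])
  show "(\<lambda>(u, \<omega>). step p N (\<lambda>j. \<eta> j \<omega>) u) \<in> borel_measurable (borel \<Otimes>\<^sub>M M)"
    unfolding step_def case_prod_unfold using assms(4)
    by (intro borel_measurable_sum borel_measurable_times)
       (auto intro: measurable_compose[OF measurable_snd] measurable_compose[OF measurable_fst])
qed

text \<open>\<open>E j\<close> is the error made when the increment of the integral process over the \<open>j\<close>-th cell is
  replaced by \<open>\<eta> j\<close> times the increment of \<open>W\<close>. A single family of weights gives a weighted sum of the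
  errors, the unit vectors give the sum of their squares.\<close>

lemma increment_error_inequality:
  fixes p :: "nat \<Rightarrow> real" and A :: "nat set"
  assumes H: "\<And>r. r \<in> {a..T} \<Longrightarrow> has_ito_integral M F W H a r (J r)"
    and p: "mono p" "p 0 = a" "p N = T" "0 \<le> a"
    and \<eta>: "\<And>j. j < N \<Longrightarrow> \<eta> j \<in> borel_measurable (F (p j))"
      "\<And>j \<omega>. j < N \<Longrightarrow> \<omega> \<in> space M \<Longrightarrow> \<bar>\<eta> j \<omega>\<bar> \<le> B"
    and A: "finite A"
    and w: "\<And>i j. i \<in> A \<Longrightarrow> j < N \<Longrightarrow> w i j \<in> borel_measurable (F (p j))"
      "\<And>i j \<omega>. i \<in> A \<Longrightarrow> j < N \<Longrightarrow> \<omega> \<in> space M \<Longrightarrow> \<bar>w i j \<omega>\<bar> \<le> B'"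
      "\<And>j \<omega>. j < N \<Longrightarrow> \<omega> \<in> space M \<Longrightarrow> (\<Sum>i\<in>A. (w i j \<omega>)\<^sup>2) \<le> K"
    and d: "0 < d" and K: "0 \<le> K"
  defines "E \<equiv> \<lambda>j \<omega>. J (p (Suc j)) \<omega> - J (p j) \<omega> - \<eta> j \<omega> * (W (p (Suc j)) \<omega> - W (p j) \<omega>)"
  shows "prob_norm M (\<lambda>\<omega>. \<Sum>i\<in>A. (\<Sum>j<N. w i j \<omega> * E j \<omega>)\<^sup>2) \<le>
    d + prob_norm M (\<lambda>\<omega>. 2 * K * (LINT u:{a..T}|lborel. (step p N (\<lambda>j. \<eta> j \<omega>) u - H u \<omega>)\<^sup>2) / d)"
proof -
  have aT: "a \<le> T" using monoD[OF p(1), of 0 N] p by simp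
  have pj: "p j \<in> {a..T}" if "j \<le> N" for j
    using monoD[OF p(1), of 0 j] monoD[OF p(1), of j N] p that by auto
  have p0: "0 \<le> p j" for j using monoD[OF p(1), of 0 j] p by simp
  have ple: "p j \<le> p (Suc j)" for j using monoD[OF p(1)] by simp
  note HT = H[of T, simplified, OF aT]
  obtain hs0 where hs0: "\<And>n. simple_on F a T (hs0 n)"
    and L0: "AE \<omega> in M. (\<lambda>n. LINT u:{a..T}|lborel. (simple_process (hs0 n) u \<omega> - H u \<omega>)\<^sup>2) \<longlonglongrightarrow> 0"
    using has_ito_integralE_AE[OF HT p(4) aT] by blast
  have prog: "progressive F {a..T} H" using HT by (simp add: has_ito_integral_def)
  have sq: "AE \<omega> in M. square_integrable_on (\<lambda>u. H u \<omega>) {a..T}"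
    by (rule has_ito_integral_square_integrable[OF HT aT])
  have J_meas: "J r \<in> borel_measurable M" if "r \<in> {a..T}" for r
    using H[OF that] by (auto simp: has_ito_integral_def tendsto_in_prob_def)
  have clip1: "simple_on F a (p j) (clip a (p j) (\<lambda>_. 1) (hs0 n))" if "j \<le> N" for j n
    using pj[OF that] by (intro simple_on_clip[OF hs0, where B=1]) auto
  have CI_meas: "simple_integral W (clip a (p j) (\<lambda>_. 1) (hs0 n)) \<in> borel_measurable M" if "j \<le> N" for j n
    by (rule simple_integral_measurable[OF clip1[OF that] p(4)])
  \<comment> \<open>The deviations at all partition points are summed so that one subsequence gives
    almost sure convergence at every point simultaneously.\<close>
  define Q where "Q n \<omega> = (\<Sum>j\<le>N. \<bar>simple_integral W (clip a (p j) (\<lambda>_. 1) (hs0 n)) \<omega> - J (p j) \<omega>\<bar>)" for n \<omega>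
  have Qj_meas: "(\<lambda>\<omega>. \<bar>simple_integral W (clip a (p j) (\<lambda>_. 1) (hs0 n)) \<omega> - J (p j) \<omega>\<bar>) \<in> borel_measurable M"
    if "j \<le> N" for j n
    using CI_meas[OF that] J_meas[OF pj[OF that]] by measurable
  have "(\<lambda>n. prob_norm M (Q n)) \<longlonglongrightarrow> 0"
    unfolding Q_def[abs_def]
  proof (rule prob_norm_sum_tendsto_0)
    fix j assume "j \<in> {..N}"
    then show "(\<lambda>n. prob_norm M (\<lambda>\<omega>. \<bar>simple_integral W (clip a (p j) (\<lambda>_. 1) (hs0 n)) \<omega> - J (p j) \<omega>\<bar>)) \<longlonglongrightarrow> 0"
      unfolding prob_norm_abs using pj[of j]
      by (intro restriction_tendsto[OF prog p(4) _ _ hs0 L0 sq] H) auto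
  qed (use Qj_meas in auto)
  moreover have "Q n \<in> borel_measurable M" for n
    unfolding Q_def[abs_def] by (intro borel_measurable_sum) (use Qj_meas in auto)
  ultimately obtain \<rho> :: "nat \<Rightarrow> nat" where \<rho>: "strict_mono \<rho>" "AE \<omega> in M. (\<lambda>n. Q (\<rho> n) \<omega>) \<longlonglongrightarrow> 0"
    using prob_norm_subseq[of Q] by blast
  define hs where "hs n = hs0 (\<rho> n)" for n
  have hs: "simple_on F a T (hs n)" for n using hs0 by (simp add: hs_def)
  have L: "AE \<omega> in M. (\<lambda>n. LINT u:{a..T}|lborel. (simple_process (hs n) u \<omega> - H u \<omega>)\<^sup>2) \<longlonglongrightarrow> 0"
    using L0 by eventually_elim (use LIMSEQ_subseq_LIMSEQ[OF _ \<rho>(1)] in \<open>simp add: hs_def comp_def\<close>)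
  have CL: "AE \<omega> in M. \<forall>j\<le>N. (\<lambda>n. simple_integral W (clip a (p j) (\<lambda>_. 1) (hs n)) \<omega>) \<longlonglongrightarrow> J (p j) \<omega>"
    using \<rho>(2)
  proof eventually_elim
    case (elim \<omega>)
    show ?case
    proof (intro allI impI)
      fix j assume j: "j \<le> N"
      have "(\<lambda>n. \<bar>simple_integral W (clip a (p j) (\<lambda>_. 1) (hs n)) \<omega> - J (p j) \<omega>\<bar>) \<longlonglongrightarrow> 0"
      proof (rule tendsto_sandwich[OF _ _ tendsto_const elim])
        show "\<forall>\<^sub>F n in sequentially. \<bar>simple_integral W (clip a (p j) (\<lambda>_. 1) (hs n)) \<omega> - J (p j) \<omega>\<bar> \<le> Q (\<rho> n) \<omega>"
          unfolding Q_def hs_def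
          by (intro always_eventually allI member_le_sum[of j "{..N}"
                "\<lambda>j. \<bar>simple_integral W (clip a (p j) (\<lambda>_. 1) (hs0 (\<rho> _))) \<omega> - J (p j) \<omega>\<bar>"]) (use j in auto)
      qed simp
      then show "(\<lambda>n. simple_integral W (clip a (p j) (\<lambda>_. 1) (hs n)) \<omega>) \<longlonglongrightarrow> J (p j) \<omega>"
        unfolding tendsto_rabs_zero_iff by (rule LIM_zero_cancel)
    qed
  qed
  \<comment> \<open>Cell by cell this is the weight times the difference of the approximant
    \<open>hs n\<close> and \<eta>. Its integral tends to the weighted sum of the errors
    \<open>E\<close>, and being simple it is subject to
    \<open>simple_family_inequality\<close>.\<close>
  define k where "k n i = concat (map (\<lambda>j. clip (p j) (p (Suc j)) (w i j) (hs n) @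
      [(p j, p (Suc j), \<lambda>\<omega>. - (w i j \<omega> * \<eta> j \<omega>))]) [0..<N])" for n i
  have concat_on: "simple_on F a T (concat (map f [0..<m]))"
    if "\<And>j. j < m \<Longrightarrow> simple_on F a T (f j)" for f :: "nat \<Rightarrow> 'a simple" and m
    using that by (induction m) auto
  have concat_I: "simple_integral W (concat (map f [0..<m])) \<omega> = (\<Sum>j<m. simple_integral W (f j) \<omega>)"
    for f :: "nat \<Rightarrow> 'a simple" and m \<omega>
    by (induction m) auto
  have concat_P: "simple_process (concat (map f [0..<m])) u \<omega> = (\<Sum>j<m. simple_process (f j) u \<omega>)"
    for f :: "nat \<Rightarrow> 'a simple" and m u \<omega>
    by (induction m) auto
  have k: "simple_on F a T (k n i)" if i: "i \<in> A" for n i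
    unfolding k_def
  proof (rule concat_on)
    fix j assume j: "j < N"
    have b: "\<bar>- (w i j \<omega> * \<eta> j \<omega>)\<bar> \<le> \<bar>B'\<bar> * \<bar>B\<bar>" if "\<omega> \<in> space M" for \<omega>
      using mult_mono[of "\<bar>w i j \<omega>\<bar>" "\<bar>B'\<bar>" "\<bar>\<eta> j \<omega>\<bar>" "\<bar>B\<bar>"] w(2)[OF i j that] \<eta>(2)[OF j that]
      by (auto simp: abs_mult)
    have "simple_on F (p j) (p (Suc j)) (clip (p j) (p (Suc j)) (w i j) (hs n))"
      by (rule simple_on_clip[OF hs ple w(1)[OF i j] w(2)[OF i j]])
    moreover have "simple_on F (p j) (p (Suc j)) [(p j, p (Suc j), \<lambda>\<omega>. - (w i j \<omega> * \<eta> j \<omega>))]"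
      by (rule simple_on_singleton[OF ple _ b])
         (intro borel_measurable_uminus borel_measurable_times w(1)[OF i j] \<eta>(1)[OF j])
    ultimately have "simple_on F (p j) (p (Suc j)) (clip (p j) (p (Suc j)) (w i j) (hs n) @
        [(p j, p (Suc j), \<lambda>\<omega>. - (w i j \<omega> * \<eta> j \<omega>))])"
      unfolding simple_on_append by (rule conjI)
    then show "simple_on F a T (clip (p j) (p (Suc j)) (w i j) (hs n) @
        [(p j, p (Suc j), \<lambda>\<omega>. - (w i j \<omega> * \<eta> j \<omega>))])"
      by (rule simple_on_mono) (use pj[of j] pj[of "Suc j"] j in auto)
  qed
  have kI: "simple_integral W (k n i) \<omega> = (\<Sum>j<N. w i j \<omega> *
      ((simple_integral W (clip a (p (Suc j)) (\<lambda>_. 1) (hs n)) \<omega> - simple_integral W (clip a (p j) (\<lambda>_. 1) (hs n)) \<omega>)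
        - \<eta> j \<omega> * (W (p (Suc j)) \<omega> - W (p j) \<omega>)))" for n i \<omega>
    unfolding k_def concat_I
  proof (intro sum.cong refl)
    fix j assume "j \<in> {..<N}"
    then have "a \<le> p j" using pj[of j] by auto
    then show "simple_integral W (clip (p j) (p (Suc j)) (w i j) (hs n) @ [(p j, p (Suc j), \<lambda>\<omega>. - (w i j \<omega> * \<eta> j \<omega>))]) \<omega> =
      w i j \<omega> * ((simple_integral W (clip a (p (Suc j)) (\<lambda>_. 1) (hs n)) \<omega> - simple_integral W (clip a (p j) (\<lambda>_. 1) (hs n)) \<omega>)
        - \<eta> j \<omega> * (W (p (Suc j)) \<omega> - W (p j) \<omega>))"
      using simple_integral_clip[OF hs _ ple, of j W "w i j" n \<omega>] by (simp add: algebra_simps)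
  qed
  have kP: "simple_process (k n i) u \<omega> =
      step p N (\<lambda>j. w i j \<omega>) u * (simple_process (hs n) u \<omega> - step p N (\<lambda>j. \<eta> j \<omega>) u)" for n i u \<omega>
  proof -
    have "simple_process (k n i) u \<omega> = step p N (\<lambda>j. w i j \<omega> * (simple_process (hs n) u \<omega> - \<eta> j \<omega>)) u"
      unfolding k_def concat_P step_def simple_process_append simple_process_clip[OF hs ple]
      by (intro sum.cong) (auto simp: algebra_simps)
    also have "\<dots> = step p N (\<lambda>j. w i j \<omega>) u * (simple_process (hs n) u \<omega> - step p N (\<lambda>j. \<eta> j \<omega>) u)"
      by (rule step_cases[OF p(1), of N u]) simp_all
    finally show ?thesis .
  qed
  define Z where "Z n \<omega> = (\<Sum>i\<in>A. (simple_integral W (k n i) \<omega>)\<^sup>2)" for n \<omega>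
  define Y where "Y n \<omega> = (\<Sum>i\<in>A. LINT u:{a..T}|lborel. (simple_process (k n i) u \<omega>)\<^sup>2)" for n \<omega>
  define X where "X n \<omega> = (LINT u:{a..T}|lborel. (simple_process (hs n) u \<omega> - H u \<omega>)\<^sup>2)" for n \<omega>
  define X' where "X' \<omega> = (LINT u:{a..T}|lborel. (step p N (\<lambda>j. \<eta> j \<omega>) u - H u \<omega>)\<^sup>2)" for \<omega>
  have XM[measurable]: "X n \<in> borel_measurable M" for n
    unfolding X_def[abs_def] by (rule distance_measurable[OF prog _ aT simple_process_measurable_pair[OF hs]]) simp
  have X'M[measurable]: "X' \<in> borel_measurable M"
    unfolding X'_def[abs_def]
    by (rule step_distance_measurable[OF prog _ aT]) (auto intro: measurable_F_M[OF \<eta>(1)])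
  have 0: "progressive F UNIV (\<lambda>_ _. 0)" by (simp add: progressive_def case_prod_unfold)
  have YM[measurable]: "Y n \<in> borel_measurable M" for n
    unfolding Y_def[abs_def]
    using distance_measurable[OF 0 _ aT simple_process_measurable_pair[OF k]] by (intro borel_measurable_sum) simp
  have ZM[measurable]: "Z n \<in> borel_measurable M" for n
    unfolding Z_def[abs_def]
    using simple_integral_measurable[OF k p(4)] by (intro borel_measurable_sum borel_measurable_power) auto
  have EM: "E j \<in> borel_measurable M" if "j < N" for j
  proof -
    have [measurable]: "J (p (Suc j)) \<in> borel_measurable M" "J (p j) \<in> borel_measurable M"
        "\<eta> j \<in> borel_measurable M" "W (p (Suc j)) \<in> borel_measurable M" "W (p j) \<in> borel_measurable M"
      using J_meas pj that measurable_F_M[OF \<eta>(1)] W_measurable p0 by auto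
    show ?thesis unfolding E_def by measurable
  qed
  \<comment> \<open>At each time only the weights of the current cell are active, so their squares
    sum to at most \<open>K\<close>. The factor 2 arises from inserting \<open>H\<close> between the
    approximant and the step process.\<close>
  have YX: "AE \<omega> in M. \<forall>n. Y n \<omega> \<le> K * (2 * X n \<omega> + 2 * X' \<omega>)"
    using sq AE_space
  proof eventually_elim
    case (elim \<omega>)
    show ?case
    proof
      fix n
      note stsq = step_square_integrable[of p N _ a T]
      define f where "f u = simple_process (hs n) u \<omega> - step p N (\<lambda>j. \<eta> j \<omega>) u" for u
      have fsq: "square_integrable_on f {a..T}"
        unfolding f_def by (intro square_integrable_on_diff(1) simple_process_square_integrable[OF hs elim(2)] stsq)
      have int: "set_integrable lborel {a..T} (\<lambda>u. (simple_process (k n i) u \<omega>)\<^sup>2)" if "i \<in> A" for i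
        using simple_process_square_integrable[OF k[OF that] elim(2)] by (auto simp: square_integrable_on_def)
      have "Y n \<omega> = (LINT u:{a..T}|lborel. (\<Sum>i\<in>A. (simple_process (k n i) u \<omega>)\<^sup>2))"
        unfolding Y_def set_lebesgue_integral_def scaleR_sum_right
        by (rule Bochner_Integration.integral_sum[symmetric]) (use int in \<open>auto simp: set_integrable_def\<close>)
      also have "\<dots> \<le> (LINT u:{a..T}|lborel. K * (f u)\<^sup>2)"
      proof (rule set_integral_mono)
        show "set_integrable lborel {a..T} (\<lambda>u. \<Sum>i\<in>A. (simple_process (k n i) u \<omega>)\<^sup>2)"
          unfolding set_integrable_def scaleR_sum_right
          by (rule Bochner_Integration.integrable_sum) (use int in \<open>auto simp: set_integrable_def\<close>)
        show "set_integrable lborel {a..T} (\<lambda>u. K * (f u)\<^sup>2)"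
          using fsq by (simp add: square_integrable_on_def)
        fix u
        have "(\<Sum>i\<in>A. (step p N (\<lambda>j. w i j \<omega>) u)\<^sup>2) \<le> K"
          by (rule step_cases[OF p(1), of N u]) (simp_all add: K w(3)[OF _ elim(2)])
        then have "(\<Sum>i\<in>A. (step p N (\<lambda>j. w i j \<omega>) u)\<^sup>2) * (f u)\<^sup>2 \<le> K * (f u)\<^sup>2"
          by (rule mult_right_mono) simp
        then show "(\<Sum>i\<in>A. (simple_process (k n i) u \<omega>)\<^sup>2) \<le> K * (f u)\<^sup>2"
          by (simp add: kP f_def[symmetric] power_mult_distrib sum_distrib_right)
      qed
      also have "\<dots> = K * (LINT u:{a..T}|lborel. ((simple_process (hs n) u \<omega> - H u \<omega>)
          - (step p N (\<lambda>j. \<eta> j \<omega>) u - H u \<omega>))\<^sup>2)"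
        by (simp add: f_def)
      also have "\<dots> \<le> K * (2 * X n \<omega> + 2 * X' \<omega>)"
        unfolding X_def X'_def
        by (intro mult_left_mono K square_integrable_on_diff simple_process_square_integrable[OF hs elim(2)] stsq elim)
      finally show "Y n \<omega> \<le> K * (2 * X n \<omega> + 2 * X' \<omega>)" .
    qed
  qed
  have le: "prob_norm M (Z n) \<le> d + prob_norm M (\<lambda>\<omega>. K * (2 * X n \<omega> + 2 * X' \<omega>) / d)" for n
  proof -
    have Ynn: "0 \<le> Y n \<omega>" for \<omega>
      unfolding Y_def by (intro sum_nonneg set_integral_square_nonneg)
    have "prob_norm M (Z n) \<le> d + prob_norm M (\<lambda>\<omega>. Y n \<omega> / d)"
      using simple_family_inequality[of A a T "k n" d] A k p(4) aT d by (simp add: Z_def[abs_def] Y_def)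
    also have "prob_norm M (\<lambda>\<omega>. Y n \<omega> / d) \<le> prob_norm M (\<lambda>\<omega>. K * (2 * X n \<omega> + 2 * X' \<omega>) / d)"
    proof (rule prob_norm_mono_AE)
      show "AE \<omega> in M. \<bar>Y n \<omega> / d\<bar> \<le> \<bar>K * (2 * X n \<omega> + 2 * X' \<omega>) / d\<bar>"
        using YX
      proof eventually_elim
        case (elim \<omega>)
        have "0 \<le> Y n \<omega>" "Y n \<omega> \<le> K * (2 * X n \<omega> + 2 * X' \<omega>)" using Ynn elim by auto
        then have "\<bar>Y n \<omega>\<bar> \<le> \<bar>K * (2 * X n \<omega> + 2 * X' \<omega>)\<bar>" by linarith
        then show ?case using d by (simp add: divide_right_mono)
      qed
    qed measurable
    finally show ?thesis by simp
  qed
  \<comment> \<open>Now \<open>n\<close> tends to infinity on both sides: the integrals become the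
    weighted errors, and of the two mean square distances only that between \<eta> and
    \<open>H\<close> survives.\<close>
  have "(\<lambda>n. prob_norm M (Z n)) \<longlonglongrightarrow> prob_norm M (\<lambda>\<omega>. \<Sum>i\<in>A. (\<Sum>j<N. w i j \<omega> * E j \<omega>)\<^sup>2)"
  proof (rule prob_norm_tendsto_AE)
    show "AE \<omega> in M. (\<lambda>n. Z n \<omega>) \<longlonglongrightarrow> (\<Sum>i\<in>A. (\<Sum>j<N. w i j \<omega> * E j \<omega>)\<^sup>2)"
      using CL by eventually_elim (auto simp: Z_def kI E_def intro!: tendsto_intros)
    show "(\<lambda>\<omega>. \<Sum>i\<in>A. (\<Sum>j<N. w i j \<omega> * E j \<omega>)\<^sup>2) \<in> borel_measurable M"
      using EM measurable_F_M[OF w(1)]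
      by (intro borel_measurable_sum borel_measurable_power borel_measurable_times) auto
  qed measurable
  moreover have "(\<lambda>n. d + prob_norm M (\<lambda>\<omega>. K * (2 * X n \<omega> + 2 * X' \<omega>) / d))
      \<longlonglongrightarrow> d + prob_norm M (\<lambda>\<omega>. 2 * K * X' \<omega> / d)"
  proof (intro tendsto_add tendsto_const prob_norm_tendsto_AE)
    show "AE \<omega> in M. (\<lambda>n. K * (2 * X n \<omega> + 2 * X' \<omega>) / d) \<longlonglongrightarrow> 2 * K * X' \<omega> / d"
      using L unfolding X_def by eventually_elim (use d in \<open>auto intro!: tendsto_eq_intros\<close>)
  qed measurable
  ultimately show ?thesis
    unfolding X'_def[symmetric] using le by (intro LIMSEQ_le) auto
qed

end

section \<open>Pathwise limits along uniform partitions\<close>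

definition grid :: "real \<Rightarrow> real \<Rightarrow> nat \<Rightarrow> nat \<Rightarrow> real" where
  "grid a T N j = a + (T - a) * real j / real N"

lemma grid_mono: "a \<le> T \<Longrightarrow> mono (grid a T N)"
  by (auto simp: mono_def grid_def intro!: divide_right_mono mult_left_mono)

lemma grid_0[simp]: "grid a T N 0 = a"
  and grid_N[simp]: "0 < N \<Longrightarrow> grid a T N N = T"
  and grid_diff: "grid a T N (Suc j) - grid a T N j = (T - a) / N"
  by (simp_all add: grid_def diff_divide_distrib[symmetric] right_diff_distrib[symmetric])

lemma grid_less: "a < T \<Longrightarrow> 0 < N \<Longrightarrow> grid a T N j < grid a T N (Suc j)"
  using grid_diff[of a T N j] by (smt (verit) divide_pos_pos of_nat_0_less_iff)

lemma grid_in: "a \<le> T \<Longrightarrow> 0 < N \<Longrightarrow> j \<le> N \<Longrightarrow> grid a T N j \<in> {a..T}"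
  using monoD[OF grid_mono, of a T 0 j N] monoD[OF grid_mono, of a T j N N] by simp

lemma mesh_tendsto_0:
  assumes "filterlim N at_top sequentially"
  shows "(\<lambda>n. c / real (N n)) \<longlonglongrightarrow> 0"
  by (rule real_tendsto_divide_at_top[OF tendsto_const filterlim_compose[OF filterlim_real_sequentially assms]])

text \<open>The step takes the value of \<open>g\<close> at the left end point of the cell
  containing \<open>u\<close>. Cells are open on the left, so this point is strictly below
  \<open>u\<close> and a left limit of \<open>g\<close> is enough.\<close>

lemma step_grid_tendsto:
  assumes N: "filterlim N at_top sequentially" "\<And>n. 0 < N n"
    and u: "u \<in> {a<..T}" and g: "(g \<longlongrightarrow> g u) (at_left u)"
  shows "(\<lambda>n. step (grid a T (N n)) (N n) (\<lambda>j. g (grid a T (N n) j)) u) \<longlonglongrightarrow> g u"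
proof -
  have m: "mono (grid a T (N n))" for n using u by (intro grid_mono) auto
  have "\<exists>j. j < N n \<and> u \<in> {grid a T (N n) j<..grid a T (N n) (Suc j)}" for n
    using step_cell[OF m[of n], of u "N n"] u N(2)[of n] by auto
  then have "\<forall>n. \<exists>j. j < N n \<and> u \<in> {grid a T (N n) j<..grid a T (N n) (Suc j)}" by blast
  from choice[OF this] obtain j where
    j: "\<And>n. j n < N n" "\<And>n. u \<in> {grid a T (N n) (j n)<..grid a T (N n) (Suc (j n))}"
    by blast
  define \<kappa> where "\<kappa> n = grid a T (N n) (j n)" for n
  have st: "step (grid a T (N n)) (N n) (\<lambda>j. g (grid a T (N n) j)) u = g (\<kappa> n)" for n
    unfolding \<kappa>_def by (rule step_eq[OF m j])
  have less: "\<kappa> n < u" and ge: "u - (T - a) / N n \<le> \<kappa> n" for n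
    using j(2)[of n] grid_diff[of a T "N n" "j n"] by (auto simp: \<kappa>_def)
  have "(\<lambda>n. u - (T - a) / N n) \<longlonglongrightarrow> u - 0"
    by (intro tendsto_diff tendsto_const mesh_tendsto_0 N)
  then have "\<kappa> \<longlonglongrightarrow> u"
    by (intro tendsto_sandwich[OF _ _ _ tendsto_const, of "\<lambda>n. u - (T - a) / N n" \<kappa> sequentially u])
       (use less ge in \<open>auto intro!: always_eventually less_imp_le\<close>)
  then have "filterlim \<kappa> (at_left u) sequentially"
    by (rule tendsto_imp_filterlim_at_left) (use less in simp)
  then show ?thesis unfolding st by (rule filterlim_compose[OF g])
qed

lemma set_lebesgue_integral_singleton[simp]: "(LINT u:{a::real}|lborel. f u :: real) = 0"
proof -
  have "AE u in lborel. indicator {a} u *\<^sub>R f u = 0"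
    using AE_lborel_singleton[of a] by eventually_elim (auto simp: indicator_def)
  then show ?thesis unfolding set_lebesgue_integral_def by (rule integral_eq_zero_AE)
qed

text \<open>Mean square convergence carries over to L1 convergence of the squares; a weighted Young
  inequality with free parameter \<theta> does the work of Cauchy-Schwarz.\<close>

lemma square_diff_tendsto_0:
  assumes g: "\<And>n. square_integrable_on (g n) A" and f: "square_integrable_on f A"
    and L: "(\<lambda>n. LINT u:A|lborel. (g n u - f u)\<^sup>2) \<longlonglongrightarrow> 0"
  shows "set_integrable lborel A (\<lambda>u. \<bar>(g n u)\<^sup>2 - (f u)\<^sup>2\<bar>)"
    and "(\<lambda>n. LINT u:A|lborel. \<bar>(g n u)\<^sup>2 - (f u)\<^sup>2\<bar>) \<longlonglongrightarrow> 0"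
proof -
  show int: "set_integrable lborel A (\<lambda>u. \<bar>(g n u)\<^sup>2 - (f u)\<^sup>2\<bar>)" for n
    using g[of n] f by (intro set_integrable_abs set_integral_diff) (auto simp: square_integrable_on_def)
  define F where "F = (LINT u:A|lborel. (f u)\<^sup>2)"
  have F: "0 \<le> F" unfolding F_def by (rule set_integral_square_nonneg)
  have dsq: "square_integrable_on (\<lambda>u. g n u - f u) A" for n
    by (intro square_integrable_on_diff g f)
  have le: "(LINT u:A|lborel. \<bar>(g n u)\<^sup>2 - (f u)\<^sup>2\<bar>) \<le>
      (1 + 1 / \<theta>) * (LINT u:A|lborel. (g n u - f u)\<^sup>2) + \<theta> * F" if "0 < \<theta>" for n \<theta>
  proof -
    \<comment> \<open>Write the difference of squares as the square of \<open>x - y\<close> plus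
      twice \<open>(x - y) * y\<close>, and split the mixed term by Young's inequality.\<close>
    have pt: "\<bar>x\<^sup>2 - y\<^sup>2\<bar> \<le> (1 + 1 / \<theta>) * (x - y)\<^sup>2 + \<theta> * y\<^sup>2" for x y :: real
    proof -
      have "0 \<le> (\<bar>x - y\<bar> - \<theta> * \<bar>y\<bar>)\<^sup>2 / \<theta>" using that by simp
      also have "\<dots> = (x - y)\<^sup>2 / \<theta> - 2 * \<bar>x - y\<bar> * \<bar>y\<bar> + \<theta> * y\<^sup>2"
        using that by (simp add: power2_diff power_mult_distrib field_simps power2_eq_square)
      finally have "2 * \<bar>x - y\<bar> * \<bar>y\<bar> \<le> (x - y)\<^sup>2 / \<theta> + \<theta> * y\<^sup>2" by simp
      moreover have "\<bar>x\<^sup>2 - y\<^sup>2\<bar> \<le> (x - y)\<^sup>2 + 2 * \<bar>x - y\<bar> * \<bar>y\<bar>"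
      proof -
        have "x\<^sup>2 - y\<^sup>2 = (x - y)\<^sup>2 + 2 * ((x - y) * y)" by (simp add: power2_eq_square algebra_simps)
        then show ?thesis
          using abs_triangle_ineq[of "(x - y)\<^sup>2" "2 * ((x - y) * y)"] by (simp add: abs_mult)
      qed
      ultimately show ?thesis by (simp add: algebra_simps)
    qed
    have "(LINT u:A|lborel. \<bar>(g n u)\<^sup>2 - (f u)\<^sup>2\<bar>)
        \<le> (LINT u:A|lborel. (1 + 1 / \<theta>) * (g n u - f u)\<^sup>2 + \<theta> * (f u)\<^sup>2)"
      using dsq[of n] f pt
      by (intro set_integral_mono int set_integral_add(1)) (auto simp: square_integrable_on_def)
    also have "\<dots> = (1 + 1 / \<theta>) * (LINT u:A|lborel. (g n u - f u)\<^sup>2) + \<theta> * F"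
      using dsq[of n] f by (subst set_integral_add(2)) (auto simp: square_integrable_on_def F_def)
    finally show ?thesis .
  qed
  show "(\<lambda>n. LINT u:A|lborel. \<bar>(g n u)\<^sup>2 - (f u)\<^sup>2\<bar>) \<longlonglongrightarrow> 0"
  proof (rule LIMSEQ_I)
    fix r :: real assume r: "0 < r"
    \<comment> \<open>Small enough for \<open>\<theta> * F\<close> to stay below
      \<open>r / 2\<close>; the summand 1 covers the case \<open>F = 0\<close>.\<close>
    define \<theta> where "\<theta> = r / (2 * (F + 1))"
    have \<theta>: "0 < \<theta>" "\<theta> * F < r / 2"
    proof -
      show "0 < \<theta>" using r F by (simp add: \<theta>_def)
      have "\<theta> * F < \<theta> * (F + 1)" using \<open>0 < \<theta>\<close> by simp
      also have "\<theta> * (F + 1) = r / 2" using F by (simp add: \<theta>_def field_simps)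
      finally show "\<theta> * F < r / 2" .
    qed
    have "(\<lambda>n. (1 + 1 / \<theta>) * (LINT u:A|lborel. (g n u - f u)\<^sup>2)) \<longlonglongrightarrow> 0"
      using tendsto_mult_left[OF L, of "1 + 1 / \<theta>"] by simp
    from LIMSEQ_D[OF this, of "r / 2"] obtain n0 where n0: "\<And>n. n \<ge> n0 \<Longrightarrow>
        \<bar>(1 + 1 / \<theta>) * (LINT u:A|lborel. (g n u - f u)\<^sup>2)\<bar> < r / 2"
      using r by (auto simp del: abs_mult)
    have "(LINT u:A|lborel. \<bar>(g n u)\<^sup>2 - (f u)\<^sup>2\<bar>) < r" if "n \<ge> n0" for n
      using le[OF \<theta>(1), of n] n0[OF that] \<theta>(2) by linarith
    moreover have "0 \<le> (LINT u:A|lborel. \<bar>(g n u)\<^sup>2 - (f u)\<^sup>2\<bar>)" for n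
      unfolding set_lebesgue_integral_def by (rule integral_nonneg_AE) auto
    ultimately show "\<exists>n0. \<forall>n\<ge>n0. norm ((LINT u:A|lborel. \<bar>(g n u)\<^sup>2 - (f u)\<^sup>2\<bar>) - 0) < r"
      by (intro exI[of _ n0]) auto
  qed
qed

text \<open>Two applications of the mean value inequality on the segment, first to the derivative
  and then to the function itself. The Taylor factor 1/6 is given up, as only the cubic order
  matters.\<close>

lemma taylor_second_order:
  fixes f f' f'' :: "real \<Rightarrow> real"
  assumes f: "\<And>x. (f has_real_derivative f' x) (at x)" "\<And>x. (f' has_real_derivative f'' x) (at x)"
    and lip: "\<And>x y. \<bar>f'' x - f'' y\<bar> \<le> B * \<bar>x - y\<bar>"
  shows "\<bar>f y - f x - f' x * (y - x) - f'' x * (y - x)\<^sup>2 / 2\<bar> \<le> B * \<bar>y - x\<bar> ^ 3"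
proof -
  have B: "0 \<le> B" using lip[of 0 1] by simp
  define h where "h z = f z - f x - f' x * (z - x) - f'' x * (z - x)\<^sup>2 / 2" for z
  define S where "S = closed_segment x y"
  have seg: "\<bar>z - x\<bar> \<le> \<bar>y - x\<bar>" if "z \<in> S" for z
    using that segment_bound(1)[of z x y] by (simp add: S_def)
  have h1: "(h has_real_derivative f' z - f' x - f'' x * (z - x)) (at z)" for z
  proof -
    have 1: "((\<lambda>z. (z - x)\<^sup>2) has_real_derivative 2 * (z - x)) (at z)"
      and 2: "((\<lambda>z. z - x) has_real_derivative 1) (at z)"
      by (auto intro!: derivative_eq_intros)
    show ?thesis
      unfolding h_def
      using DERIV_diff[OF DERIV_diff[OF DERIV_diff[OF f(1)[of z] DERIV_const[of "f x"]]
          DERIV_cmult[OF 2, of "f' x"]] DERIV_cdivide[OF DERIV_cmult[OF 1, of "f'' x"], of 2]]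
      by (rule DERIV_cong) (simp add: field_simps)
  qed
  have d: "\<bar>f' z - f' x - f'' x * (z - x)\<bar> \<le> B * \<bar>y - x\<bar> ^ 2" if "z \<in> S" for z
  proof -
    have 1: "((\<lambda>v. f' v - f'' x * v) has_real_derivative f'' v - f'' x) (at v within S)" for v
      using DERIV_diff[OF f(2)[of v] DERIV_cmult[OF DERIV_ident, of "f'' x"]]
      by (rule has_field_derivative_at_within[OF DERIV_cong]) simp
    have 2: "norm (f'' v - f'' x) \<le> B * \<bar>y - x\<bar>" if "v \<in> S" for v
      unfolding real_norm_def by (rule order_trans[OF lip mult_left_mono[OF seg[OF that] B]])
    have "norm ((f' z - f'' x * z) - (f' x - f'' x * x)) \<le> B * \<bar>y - x\<bar> * norm (z - x)"
      by (rule field_differentiable_bound[OF _ 1 2]) (use that in \<open>auto simp: S_def\<close>)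
    also have "\<dots> \<le> B * \<bar>y - x\<bar> * \<bar>y - x\<bar>"
      using seg[OF that] B by (intro mult_left_mono) auto
    finally show ?thesis by (simp add: algebra_simps power2_eq_square)
  qed
  have "norm (h y - h x) \<le> B * \<bar>y - x\<bar> ^ 2 * norm (y - x)"
    by (rule field_differentiable_bound[of S h "\<lambda>z. f' z - f' x - f'' x * (z - x)"])
       (use d h1[THEN has_field_derivative_at_within] in \<open>auto simp: S_def\<close>)
  then show ?thesis by (simp add: h_def power3_eq_cube power2_eq_square mult_ac)
qed

lemma max_increment_tendsto_0:
  fixes g :: "real \<Rightarrow> real"
  assumes "continuous_on {a..T} g" "a \<le> T" "filterlim N at_top sequentially" "\<And>n. 0 < N n" "0 < e"
  shows "\<forall>\<^sub>F n in sequentially. \<forall>j<N n. \<bar>g (grid a T (N n) (Suc j)) - g (grid a T (N n) j)\<bar> < e"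
proof -
  have "uniformly_continuous_on {a..T} g"
    by (rule compact_uniformly_continuous[OF assms(1)]) simp
  then obtain d where d: "0 < d" "\<And>x y. x \<in> {a..T} \<Longrightarrow> y \<in> {a..T} \<Longrightarrow> dist y x < d \<Longrightarrow> dist (g y) (g x) < e"
    using assms(5) unfolding uniformly_continuous_on_def by metis
  have "\<forall>\<^sub>F n in sequentially. (T - a) / N n < d"
    using order_tendstoD(2)[OF mesh_tendsto_0[OF assms(3)] d(1)] .
  then show ?thesis
  proof eventually_elim
    case (elim n)
    show ?case
    proof (intro allI impI)
      fix j assume "j < N n"
      then have in1: "grid a T (N n) j \<in> {a..T}" "grid a T (N n) (Suc j) \<in> {a..T}"
        using grid_in[OF assms(2,4), of _ n] by (simp_all only: less_imp_le Suc_leI)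
      moreover have "0 \<le> (T - a) / N n" using assms(2) by simp
      ultimately show "\<bar>g (grid a T (N n) (Suc j)) - g (grid a T (N n) j)\<bar> < e"
        using d(2)[OF in1] elim grid_diff[of a T "N n" j]
        by (simp add: dist_real_def)
    qed
  qed
qed

section \<open>Indefinite integrals and weighted sums along the grid\<close>

lemma indefinite_integral_continuous_on:
  fixes b :: "real \<Rightarrow> real"
  assumes "set_integrable lborel {a..T} b"
  shows "continuous_on {a..T} (\<lambda>t. LINT u:{a..t}|lborel. b u)"
proof -
  have "continuous_on {a..T} (\<lambda>t. integral {a..t} b)"
    by (intro indefinite_integral_continuous_1 set_borel_integral_eq_integral(1) assms)
  moreover have "(LINT u:{a..t}|lborel. b u) = integral {a..t} b" if "t \<in> {a..T}" for t
    by (rule set_borel_integral_eq_integral(2)[OF set_integrable_subset[OF assms]]) (use that in auto)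
  ultimately show ?thesis by (elim continuous_on_eq) simp
qed

lemma set_integral_split:
  fixes b :: "real \<Rightarrow> real"
  assumes "set_integrable lborel {a..T} b" "a \<le> s" "s \<le> t" "t \<le> T"
  shows "(LINT u:{a..t}|lborel. b u) - (LINT u:{a..s}|lborel. b u) = (LINT u:{s<..t}|lborel. b u)"
proof -
  have "{a..t} = {a..s} \<union> {s<..t}" using assms by auto
  moreover have "(LINT u:{a..s} \<union> {s<..t}|lborel. b u) = (LINT u:{a..s}|lborel. b u) + (LINT u:{s<..t}|lborel. b u)"
    by (rule set_integral_Un) (use assms in \<open>auto intro: set_integrable_subset[OF assms(1)]\<close>)
  ultimately show ?thesis by simp
qed

lemma set_integral_split_Icc:
  fixes b :: "real \<Rightarrow> real"
  assumes "set_integrable lborel {a..T} b" "a \<le> s" "s \<le> t" "t \<le> T"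
  shows "(LINT u:{a..t}|lborel. b u) - (LINT u:{a..s}|lborel. b u) = (LINT u:{s..t}|lborel. b u)"
proof -
  have AE: "AE u in lborel. indicator {s<..t} u *\<^sub>R b u = indicator {s..t} u *\<^sub>R b u"
    using AE_lborel_singleton[of s] by eventually_elim (auto simp: indicator_def)
  have "(LINT u:{s<..t}|lborel. b u) = (LINT u:{s..t}|lborel. b u)"
    unfolding set_lebesgue_integral_def
  proof (rule integral_cong_AE[OF _ _ AE])
    have "set_integrable lborel {s<..t} b" "set_integrable lborel {s..t} b"
      by (rule set_integrable_subset[OF assms(1)]; use assms in auto)+
    then show "(\<lambda>u. indicator {s<..t} u *\<^sub>R b u) \<in> borel_measurable lborel"
      "(\<lambda>u. indicator {s..t} u *\<^sub>R b u) \<in> borel_measurable lborel"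
      unfolding set_integrable_def by (simp_all only: borel_measurable_integrable)
  qed
  then show ?thesis using set_integral_split[OF assms] by simp
qed

text \<open>Only the continuous weight is discretised, since \<open>b\<close> is merely integrable
  and has no meaningful point values. The sampled weights stay below \<open>B\<close>, which gives
  the dominating function.\<close>

lemma step_weight_integral_tendsto:
  fixes b g :: "real \<Rightarrow> real"
  assumes b: "set_integrable lborel {a..T} b" and "a < T"
    and N: "filterlim N at_top sequentially" "\<And>n. 0 < N n"
    and g: "continuous_on {a..T} g" "\<And>u. \<bar>g u\<bar> \<le> B"
  shows "(\<lambda>n. LINT u:{a..T}|lborel. step (grid a T (N n)) (N n) (\<lambda>j. g (grid a T (N n) j)) u * b u)
    \<longlonglongrightarrow> (LINT u:{a..T}|lborel. g u * b u)"
proof -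
  have B: "0 \<le> B" using g(2)[of 0] by simp
  have m: "mono (grid a T (N n))" for n using assms(2) by (intro grid_mono) auto
  have gm: "set_borel_measurable lborel {a..T} g"
    using borel_measurable_continuous_on_indicator[OF _ g(1)] by (simp add: set_borel_measurable_def)
  have stb: "\<bar>step (grid a T (N n)) (N n) (\<lambda>j. g (grid a T (N n) j)) u\<bar> \<le> B" for n u
    by (rule step_cases[OF m[of n], of "N n" u]) (simp_all add: g(2) B)
  have bm: "set_borel_measurable lborel {a..T} b"
    using b by (auto simp: set_integrable_def set_borel_measurable_def)
  show ?thesis
  proof (rule set_integral_dominated)
    show "set_integrable lborel {a..T} (\<lambda>u. B * \<bar>b u\<bar>)" using set_integrable_abs[OF b] by simp
    show "set_borel_measurable lborel {a..T} (\<lambda>u. g u * b u)"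
      by (rule set_borel_measurable_times[OF gm bm])
    show "set_borel_measurable lborel {a..T} (\<lambda>u. step (grid a T (N n)) (N n) (\<lambda>j. g (grid a T (N n) j)) u * b u)" for n
      by (rule set_borel_measurable_times[OF _ bm]) (simp add: set_borel_measurable_def)
    show "AE u in lborel. u \<in> {a..T} \<longrightarrow>
        (\<lambda>n. step (grid a T (N n)) (N n) (\<lambda>j. g (grid a T (N n) j)) u * b u) \<longlonglongrightarrow> g u * b u"
      \<comment> \<open>At the left end point \<open>a\<close> every step function is 0, so
        convergence may fail at this single point.\<close>
      using AE_lborel_singleton[of a]
    proof (eventually_elim, intro impI)
      fix u assume "u \<noteq> a" "u \<in> {a..T}"
      then have u: "u \<in> {a<..T}" by simp
      have "(g \<longlongrightarrow> g u) (at u within {a..T})"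
        using g(1) u by (auto simp: continuous_on)
      then have "(g \<longlongrightarrow> g u) (at u within {a<..<u})"
        by (rule tendsto_within_subset) (use u in auto)
      moreover have "at u within {a<..<u} = at_left u"
        by (rule at_within_nhd[of _ "{a<..}"]) (use u in auto)
      ultimately have "(g \<longlongrightarrow> g u) (at_left u)" by simp
      from step_grid_tendsto[OF N u this]
      show "(\<lambda>n. step (grid a T (N n)) (N n) (\<lambda>j. g (grid a T (N n) j)) u * b u) \<longlonglongrightarrow> g u * b u"
        by (intro tendsto_intros)
    qed
    show "\<bar>step (grid a T (N n)) (N n) (\<lambda>j. g (grid a T (N n) j)) u * b u\<bar> \<le> B * \<bar>b u\<bar>" for n u
      unfolding abs_mult by (rule mult_right_mono[OF stb]) simp
  qed
qed

lemma step_weight_sum: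
  fixes b :: "real \<Rightarrow> real"
  assumes b: "set_integrable lborel {a..T} b" and "a \<le> T" "0 < N"
  shows "(LINT u:{a..T}|lborel. step (grid a T N) N c u * b u) =
    (\<Sum>j<N. c j * ((LINT u:{a..grid a T N (Suc j)}|lborel. b u) - (LINT u:{a..grid a T N j}|lborel. b u)))"
proof -
  have m: "mono (grid a T N)" using assms(2) by (intro grid_mono) auto
  have "(LINT u:{a..T}|lborel. step (grid a T N) N c u * b u) =
      (\<Sum>j<N. c j * (LINT u:{grid a T N j<..grid a T N (Suc j)}|lborel. b u))"
    using step_integral(2)[OF m, of N b c] b assms(3) by simp
  also have "\<dots> = (\<Sum>j<N. c j * ((LINT u:{a..grid a T N (Suc j)}|lborel. b u) - (LINT u:{a..grid a T N j}|lborel. b u)))"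
    using grid_in[OF assms(2,3)] monoD[OF m]
    by (intro sum.cong refl arg_cong2[where f="(*)"] set_integral_split[OF b, symmetric]) auto
  finally show ?thesis .
qed

lemma sum_mult_le_sqrt:
  fixes x y :: "nat \<Rightarrow> real"
  shows "\<bar>\<Sum>j<n. x j * y j\<bar> \<le> sqrt (\<Sum>j<n. (x j)\<^sup>2) * sqrt (\<Sum>j<n. (y j)\<^sup>2)"
proof -
  have "\<bar>\<Sum>j<n. x j * y j\<bar> \<le> (\<Sum>j<n. \<bar>x j\<bar> * \<bar>y j\<bar>)"
    by (rule order_trans[OF sum_abs]) (simp add: abs_mult)
  also have "\<dots> \<le> sqrt (\<Sum>j<n. (x j)\<^sup>2) * sqrt (\<Sum>j<n. (y j)\<^sup>2)"
    using L2_set_mult_ineq[of x y "{..<n}"] by (simp add: L2_set_def)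
  finally show ?thesis .
qed

text \<open>Largest factor times total mass: the maximum of the \<open>x\<close> tends to 0 while
  the sums of the \<open>y\<close> stay bounded. Dividing by \<open>l + 1\<close> keeps the case
  \<open>l = 0\<close> legitimate.\<close>

lemma sum_bounded_mult_tendsto_0:
  fixes x y :: "nat \<Rightarrow> nat \<Rightarrow> real"
  assumes x: "\<And>e. 0 < e \<Longrightarrow> \<forall>\<^sub>F n in sequentially. \<forall>j<N n. \<bar>x n j\<bar> < e"
    and y: "(\<lambda>n. \<Sum>j<N n. \<bar>y n j\<bar>) \<longlonglongrightarrow> l"
  shows "(\<lambda>n. \<Sum>j<N n. x n j * y n j) \<longlonglongrightarrow> 0"
proof (rule tendstoI)
  fix e :: real assume e: "0 < e"
  have l: "0 \<le> l"
    by (rule LIMSEQ_le_const[OF y]) (auto intro!: sum_nonneg)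
  have "\<forall>\<^sub>F n in sequentially. (\<Sum>j<N n. \<bar>y n j\<bar>) < l + 1"
    by (rule order_tendstoD(2)[OF y]) simp
  moreover have "\<forall>\<^sub>F n in sequentially. \<forall>j<N n. \<bar>x n j\<bar> < e / (l + 1)"
    using e l by (intro x) simp
  ultimately show "\<forall>\<^sub>F n in sequentially. dist (\<Sum>j<N n. x n j * y n j) 0 < e"
  proof eventually_elim
    case (elim n)
    have "\<bar>\<Sum>j<N n. x n j * y n j\<bar> \<le> (\<Sum>j<N n. e / (l + 1) * \<bar>y n j\<bar>)"
    proof (rule order_trans[OF sum_abs sum_mono])
      fix j assume "j \<in> {..<N n}"
      then have "\<bar>x n j\<bar> \<le> e / (l + 1)" using elim(2) by (simp add: less_imp_le)
      then show "\<bar>x n j * y n j\<bar> \<le> e / (l + 1) * \<bar>y n j\<bar>"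
        unfolding abs_mult by (rule mult_right_mono) simp
    qed
    also have "\<dots> = e / (l + 1) * (\<Sum>j<N n. \<bar>y n j\<bar>)" by (simp add: sum_distrib_left)
    also have "\<dots> < e / (l + 1) * (l + 1)"
      using elim(1) e l by (intro mult_strict_left_mono) auto
    also have "\<dots> = e" using l by simp
    finally show ?case by simp
  qed
qed

lemma set_borel_measurable_continuous:
  fixes g :: "real \<Rightarrow> real"
  shows "continuous_on {a..b} g \<Longrightarrow> set_borel_measurable lborel {a..b} g"
  using borel_measurable_continuous_on_indicator[of "{a..b}" g] by (simp add: set_borel_measurable_def)

lemma set_integrable_bounded_mult:
  fixes b g :: "real \<Rightarrow> real"
  assumes b: "set_integrable lborel A b" and g: "set_borel_measurable lborel A g"
    and B: "\<And>u. u \<in> A \<Longrightarrow> \<bar>g u\<bar> \<le> B"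
  shows "set_integrable lborel A (\<lambda>u. g u * b u)"
proof (rule set_integrable_bound_real)
  show "set_integrable lborel A (\<lambda>u. B * b u)" using b by simp
  have "set_borel_measurable lborel A b" using b by (auto simp: set_integrable_def set_borel_measurable_def)
  with g show "set_borel_measurable lborel A (\<lambda>u. g u * b u)" by (rule set_borel_measurable_times)
  show "\<bar>g u * b u\<bar> \<le> \<bar>B * b u\<bar>" if "u \<in> A" for u
    unfolding abs_mult using B[OF that] by (intro mult_right_mono) auto
qed

text \<open>The deterministic core of Ito's formula. Besides \<open>e\<close> and \<open>q\<close>,
  the weighted sums \<open>fe\<close> and \<open>fq\<close> are separate hypotheses: a vanishing sum
  of squares does not control a signed sum over a growing number of cells.\<close>

lemma pathwise_ito:
  fixes f f' f'' x b s :: "real \<Rightarrow> real" and N :: "nat \<Rightarrow> nat" and \<eta> dw :: "nat \<Rightarrow> nat \<Rightarrow> real"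
  assumes f: "\<And>x. (f has_real_derivative f' x) (at x)" "\<And>x. (f' has_real_derivative f'' x) (at x)"
    and bnd: "\<And>x. \<bar>f' x\<bar> \<le> B" "\<And>x. \<bar>f'' x\<bar> \<le> B" "\<And>x y. \<bar>f'' x - f'' y\<bar> \<le> B * \<bar>x - y\<bar>"
    and aT: "a < T" and N: "filterlim N at_top sequentially" "\<And>n. 0 < N n"
    and x: "continuous_on {a..T} x"
    and b: "set_integrable lborel {a..T} b"
    and s: "square_integrable_on s {a..T}"
  defines "p \<equiv> \<lambda>n. grid a T (N n)" and "b' \<equiv> \<lambda>t. LINT u:{a..t}|lborel. b u"
  defines "e \<equiv> \<lambda>n j. x (p n (Suc j)) - x (p n j) - (b' (p n (Suc j)) - b' (p n j)) - \<eta> n j * dw n j"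
  assumes st: "(\<lambda>n. LINT u:{a..T}|lborel. (step (p n) (N n) (\<eta> n) u - s u)\<^sup>2) \<longlonglongrightarrow> 0"
    and e: "(\<lambda>n. \<Sum>j<N n. (e n j)\<^sup>2) \<longlonglongrightarrow> 0"
    and fe: "(\<lambda>n. \<Sum>j<N n. f' (x (p n j)) * e n j) \<longlonglongrightarrow> 0"
    and q: "(\<lambda>n. \<Sum>j<N n. (\<eta> n j)\<^sup>2 * ((dw n j)\<^sup>2 - (p n (Suc j) - p n j))) \<longlonglongrightarrow> 0"
    and fq: "(\<lambda>n. \<Sum>j<N n. f'' (x (p n j)) * (\<eta> n j)\<^sup>2 * ((dw n j)\<^sup>2 - (p n (Suc j) - p n j))) \<longlonglongrightarrow> 0"
  shows "(\<lambda>n. \<Sum>j<N n. f' (x (p n j)) * \<eta> n j * dw n j) \<longlonglongrightarrow>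
    f (x T) - f (x a) - (LINT u:{a..T}|lborel. f' (x u) * b u + f'' (x u) * (s u)\<^sup>2 / 2)"
proof -
  have m: "mono (p n)" for n unfolding p_def using aT by (intro grid_mono) auto
  have p0: "p n 0 = a" and pN: "p n (N n) = T" for n using N(2) by (simp_all add: p_def)
  have cf': "continuous_on A f'" for A using f(2) by (meson DERIV_continuous_on has_field_derivative_at_within)
  have cf'': "continuous_on A f''" for A
    by (rule continuous_on_subset[OF lipschitz_on_continuous_on[of B UNIV f'']])
       (use bnd(3) bnd(3)[of 0 1] in \<open>auto simp: lipschitz_on_def dist_real_def\<close>)
  have g1: "continuous_on {a..T} (\<lambda>u. f' (x u))" and g2: "continuous_on {a..T} (\<lambda>u. f'' (x u))"
    by (rule continuous_on_compose2[OF _ x subset_UNIV], rule cf' cf'')+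
  define S where "S = (LINT u:{a..T}|lborel. (s u)\<^sup>2)"
  have s2: "set_integrable lborel {a..T} (\<lambda>u. (s u)\<^sup>2)" using s by (simp add: square_integrable_on_def)
  have drift: "(\<lambda>n. \<Sum>j<N n. f' (x (p n j)) * (b' (p n (Suc j)) - b' (p n j))) \<longlonglongrightarrow> (LINT u:{a..T}|lborel. f' (x u) * b u)"
    using step_weight_integral_tendsto[OF b aT N g1 bnd(1)] aT N(2)
    by (simp add: step_weight_sum[OF b] p_def b'_def)
  have sumsq: "(\<Sum>j<N n. c j * (\<eta> n j)\<^sup>2 * (p n (Suc j) - p n j)) =
      (LINT u:{a..T}|lborel. step (p n) (N n) c u * (step (p n) (N n) (\<eta> n) u)\<^sup>2)" for n c
  proof -
    have "step (p n) (N n) c u * (step (p n) (N n) (\<eta> n) u)\<^sup>2 = step (p n) (N n) (\<lambda>j. c j * (\<eta> n j)\<^sup>2) u" for u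
      by (rule step_cases[OF m[of n], of "N n" u]) simp_all
    then show ?thesis using step_integral_const(2)[OF m, of n "N n"] by (simp add: p0 pN)
  qed
  \<comment> \<open>The squared steps tend to the square of \<open>s\<close> in L1 and the weights
    are bounded by \<open>K\<close>. So the square of \<open>s\<close> can be inserted first, and
    only then are the sampled weights passed to the limit.\<close>
  have quad: "(\<lambda>n. \<Sum>j<N n. g (p n j) * (\<eta> n j)\<^sup>2 * (p n (Suc j) - p n j)) \<longlonglongrightarrow> (LINT u:{a..T}|lborel. g u * (s u)\<^sup>2)"
    if g: "continuous_on {a..T} g" "\<And>u. \<bar>g u\<bar> \<le> K" for g :: "real \<Rightarrow> real" and K
  proof -
    have K: "0 \<le> K" using g(2)[of 0] by simp
    let ?c = "\<lambda>n. step (p n) (N n) (\<lambda>j. g (p n j))" and ?h = "\<lambda>n. step (p n) (N n) (\<eta> n)"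
    have cb: "\<bar>?c n u\<bar> \<le> K" for n u
      by (rule step_cases[OF m[of n], of "N n" u]) (simp_all add: g(2) K)
    note h = step_square_integrable[of "p _" "N _" "\<eta> _" a T]
    note sd = square_diff_tendsto_0[OF h s st]
    have i1: "set_integrable lborel {a..T} (\<lambda>u. ?c n u * (s u)\<^sup>2)" for n
      using step_integral(1)[OF m, of n "N n"] s2 by (simp add: p0 pN)
    have i2: "set_integrable lborel {a..T} (\<lambda>u. ?c n u * (?h n u)\<^sup>2)" for n
      using step_integral(1)[OF m, of n "N n"] h[of n n n] by (simp add: p0 pN square_integrable_on_def)
    have "(\<lambda>n. (LINT u:{a..T}|lborel. ?c n u * (?h n u)\<^sup>2) - (LINT u:{a..T}|lborel. ?c n u * (s u)\<^sup>2)) \<longlonglongrightarrow> 0"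
    proof (rule tendsto_rabs_zero_cancel, rule tendsto_sandwich[OF _ _ tendsto_const tendsto_mult_right_zero[OF sd(2), of K]];
        intro always_eventually allI)
      fix n
      have "\<bar>(LINT u:{a..T}|lborel. ?c n u * (?h n u)\<^sup>2) - (LINT u:{a..T}|lborel. ?c n u * (s u)\<^sup>2)\<bar>
          = \<bar>LINT u:{a..T}|lborel. ?c n u * (?h n u)\<^sup>2 - ?c n u * (s u)\<^sup>2\<bar>"
        using i1 i2 by (subst set_integral_diff(2)) auto
      also have "\<dots> \<le> (LINT u:{a..T}|lborel. \<bar>?c n u * (?h n u)\<^sup>2 - ?c n u * (s u)\<^sup>2\<bar>)"
        using integral_abs_bound[of lborel "\<lambda>u. indicator {a..T} u * (?c n u * (?h n u)\<^sup>2 - ?c n u * (s u)\<^sup>2)"]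
        by (simp add: set_lebesgue_integral_def abs_mult)
      also have "\<dots> \<le> (LINT u:{a..T}|lborel. K * \<bar>(?h n u)\<^sup>2 - (s u)\<^sup>2\<bar>)"
      proof (rule set_integral_mono)
        show "set_integrable lborel {a..T} (\<lambda>u. \<bar>?c n u * (?h n u)\<^sup>2 - ?c n u * (s u)\<^sup>2\<bar>)"
          using i1 i2 by (intro set_integrable_abs set_integral_diff(1)) auto
        show "set_integrable lborel {a..T} (\<lambda>u. K * \<bar>(?h n u)\<^sup>2 - (s u)\<^sup>2\<bar>)"
          using sd(1)[of n] by simp
        show "\<bar>?c n u * (?h n u)\<^sup>2 - ?c n u * (s u)\<^sup>2\<bar> \<le> K * \<bar>(?h n u)\<^sup>2 - (s u)\<^sup>2\<bar>" for u
          using mult_right_mono[OF cb[of n u], of "\<bar>(?h n u)\<^sup>2 - (s u)\<^sup>2\<bar>"]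
          by (simp add: abs_mult[symmetric] right_diff_distrib)
      qed
      also have "\<dots> = K * (LINT u:{a..T}|lborel. \<bar>(?h n u)\<^sup>2 - (s u)\<^sup>2\<bar>)" by simp
      finally show "\<bar>(LINT u:{a..T}|lborel. ?c n u * (?h n u)\<^sup>2) - (LINT u:{a..T}|lborel. ?c n u * (s u)\<^sup>2)\<bar>
        \<le> K * (LINT u:{a..T}|lborel. \<bar>(?h n u)\<^sup>2 - (s u)\<^sup>2\<bar>)" .
    qed simp
    from tendsto_add[OF this step_weight_integral_tendsto[OF s2 aT N g]]
    show ?thesis unfolding sumsq by (simp add: p_def)
  qed
  \<comment> \<open>The increment of \<open>x\<close> splits into a martingale-like part
    \<open>V\<close>, whose squares sum to the quadratic variation, and a part \<open>U\<close> from
    drift and approximation error, whose squares vanish in the limit.\<close>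
  define V where "V n j = \<eta> n j * dw n j" for n j
  define \<beta> where "\<beta> n j = b' (p n (Suc j)) - b' (p n j)" for n j
  define U where "U n j = \<beta> n j + e n j" for n j
  define \<Delta> where "\<Delta> n j = x (p n (Suc j)) - x (p n j)" for n j
  have \<Delta>: "\<Delta> n j = V n j + U n j" for n j
    by (simp add: \<Delta>_def V_def U_def \<beta>_def e_def)
  have \<beta>1: "\<forall>\<^sub>F n in sequentially. \<forall>j<N n. \<bar>\<beta> n j\<bar> < r" if "0 < r" for r
    unfolding \<beta>_def p_def b'_def
    using max_increment_tendsto_0[OF indefinite_integral_continuous_on[OF b] less_imp_le[OF aT] N that] .
  have \<Delta>1: "\<forall>\<^sub>F n in sequentially. \<forall>j<N n. \<bar>\<Delta> n j\<bar> < r" if "0 < r" for r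
    unfolding \<Delta>_def p_def using max_increment_tendsto_0[OF x less_imp_le[OF aT] N that] .
  \<comment> \<open>The drift has total variation at most \<open>L\<close>, the integral of the
    absolute value of \<open>b\<close>. Its sum of squares is therefore at most the largest
    increment times \<open>L\<close>.\<close>
  have \<beta>2: "(\<lambda>n. \<Sum>j<N n. (\<beta> n j)\<^sup>2) \<longlonglongrightarrow> 0"
  proof (rule tendstoI)
    fix r :: real assume r: "0 < r"
    define L where "L = (LINT u:{a..T}|lborel. \<bar>b u\<bar>)"
    have ab: "set_integrable lborel {a..T} (\<lambda>u. \<bar>b u\<bar>)" using b by (rule set_integrable_abs)
    have L: "0 \<le> L" unfolding L_def set_lebesgue_integral_def by (rule integral_nonneg_AE) auto
    have le: "(\<Sum>j<N n. \<bar>\<beta> n j\<bar>) \<le> L" for n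
    proof -
      have pin: "p n j \<in> {a..T}" if "j \<le> N n" for j
        unfolding p_def using aT N(2) that by (intro grid_in) auto
      have ple: "p n j \<le> p n (Suc j)" for j using monoD[OF m] by simp
      have "(\<Sum>j<N n. \<bar>\<beta> n j\<bar>) \<le> (\<Sum>j<N n. (LINT u:{a..p n (Suc j)}|lborel. \<bar>b u\<bar>) - (LINT u:{a..p n j}|lborel. \<bar>b u\<bar>))"
      proof (rule sum_mono)
        fix j assume "j \<in> {..<N n}"
        then have "p n j \<in> {a..T}" "p n (Suc j) \<in> {a..T}" using pin by auto
        then have c: "a \<le> p n j" "p n (Suc j) \<le> T" by auto
        have "\<bar>\<beta> n j\<bar> = \<bar>LINT u:{p n j<..p n (Suc j)}|lborel. b u\<bar>"
          unfolding \<beta>_def b'_def using set_integral_split[OF b c(1) ple c(2)] by simp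
        also have "\<dots> \<le> (LINT u:{p n j<..p n (Suc j)}|lborel. \<bar>b u\<bar>)"
          using integral_abs_bound[of lborel "\<lambda>u. indicator {p n j<..p n (Suc j)} u * b u"]
          by (simp add: set_lebesgue_integral_def abs_mult)
        also have "\<dots> = (LINT u:{a..p n (Suc j)}|lborel. \<bar>b u\<bar>) - (LINT u:{a..p n j}|lborel. \<bar>b u\<bar>)"
          using set_integral_split[OF ab c(1) ple c(2)] by simp
        finally show "\<bar>\<beta> n j\<bar> \<le> (LINT u:{a..p n (Suc j)}|lborel. \<bar>b u\<bar>) - (LINT u:{a..p n j}|lborel. \<bar>b u\<bar>)" .
      qed
      also have "\<dots> = L"
        by (subst sum_lessThan_telescope) (simp add: p0 pN L_def)
      finally show ?thesis .
    qed
    have "\<forall>\<^sub>F n in sequentially. \<forall>j<N n. \<bar>\<beta> n j\<bar> < r / (L + 1)"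
      using r L by (intro \<beta>1) simp
    then show "\<forall>\<^sub>F n in sequentially. dist (\<Sum>j<N n. (\<beta> n j)\<^sup>2) 0 < r"
    proof eventually_elim
      case (elim n)
      have "(\<Sum>j<N n. (\<beta> n j)\<^sup>2) \<le> (\<Sum>j<N n. r / (L + 1) * \<bar>\<beta> n j\<bar>)"
      proof (rule sum_mono)
        fix j assume "j \<in> {..<N n}"
        then have "\<bar>\<beta> n j\<bar> * \<bar>\<beta> n j\<bar> \<le> r / (L + 1) * \<bar>\<beta> n j\<bar>"
          using elim by (intro mult_right_mono) auto
        then show "(\<beta> n j)\<^sup>2 \<le> r / (L + 1) * \<bar>\<beta> n j\<bar>" by (simp add: power2_eq_square)
      qed
      also have "\<dots> \<le> r / (L + 1) * L"
        unfolding sum_distrib_left[symmetric] by (rule mult_left_mono[OF le]) (use r L in simp)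
      also have "\<dots> < r" using r L by (simp add: field_simps)
      finally show ?case by (simp add: sum_nonneg)
    qed
  qed
  have U2: "(\<lambda>n. \<Sum>j<N n. (U n j)\<^sup>2) \<longlonglongrightarrow> 0"
  proof (rule tendsto_sandwich[OF _ _ tendsto_const])
    show "(\<lambda>n. 2 * (\<Sum>j<N n. (\<beta> n j)\<^sup>2) + 2 * (\<Sum>j<N n. (e n j)\<^sup>2)) \<longlonglongrightarrow> 0"
      using tendsto_add[OF tendsto_mult_right_zero[OF \<beta>2, of 2] tendsto_mult_right_zero[OF e, of 2]] by simp
    have "(\<Sum>j<N n. (U n j)\<^sup>2) \<le> 2 * (\<Sum>j<N n. (\<beta> n j)\<^sup>2) + 2 * (\<Sum>j<N n. (e n j)\<^sup>2)" for n
      unfolding sum_distrib_left sum.distrib[symmetric] U_def by (intro sum_mono sum_squares_le)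
    then show "\<forall>\<^sub>F n in sequentially. (\<Sum>j<N n. (U n j)\<^sup>2) \<le> 2 * (\<Sum>j<N n. (\<beta> n j)\<^sup>2) + 2 * (\<Sum>j<N n. (e n j)\<^sup>2)"
      by simp
  qed (auto intro!: always_eventually sum_nonneg)
  have V2: "(\<lambda>n. \<Sum>j<N n. (V n j)\<^sup>2) \<longlonglongrightarrow> S"
    using tendsto_add[OF q quad[of "\<lambda>_. 1" 1]]
    by (simp add: S_def V_def sum.distrib[symmetric] algebra_simps power_mult_distrib)
  have fV2: "(\<lambda>n. \<Sum>j<N n. f'' (x (p n j)) * (V n j)\<^sup>2) \<longlonglongrightarrow> (LINT u:{a..T}|lborel. f'' (x u) * (s u)\<^sup>2)"
    using tendsto_add[OF fq quad[OF g2 bnd(2)]]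
    by (simp add: V_def sum.distrib[symmetric] algebra_simps power_mult_distrib)
  \<comment> \<open>Cauchy-Schwarz: the squares of \<open>V\<close> have bounded sums and those of
    \<open>U\<close> vanishing ones.\<close>
  have cross: "(\<lambda>n. \<Sum>j<N n. c n j * V n j * U n j) \<longlonglongrightarrow> 0" if c: "\<And>n j. \<bar>c n j\<bar> \<le> K" for c K
  proof (rule tendsto_rabs_zero_cancel, rule tendsto_sandwich[OF _ _ tendsto_const])
    have K: "0 \<le> K" using c[of 0 0] by simp
    have "(\<lambda>n. K * sqrt (\<Sum>j<N n. (V n j)\<^sup>2) * sqrt (\<Sum>j<N n. (U n j)\<^sup>2)) \<longlonglongrightarrow> K * sqrt S * sqrt 0"
      by (intro tendsto_intros V2 U2)
    then show "(\<lambda>n. K * sqrt (\<Sum>j<N n. (V n j)\<^sup>2) * sqrt (\<Sum>j<N n. (U n j)\<^sup>2)) \<longlonglongrightarrow> 0" by simp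
    have "\<bar>\<Sum>j<N n. c n j * V n j * U n j\<bar> \<le> K * sqrt (\<Sum>j<N n. (V n j)\<^sup>2) * sqrt (\<Sum>j<N n. (U n j)\<^sup>2)" for n
    proof -
      have "(\<Sum>j<N n. (c n j * V n j)\<^sup>2) \<le> (\<Sum>j<N n. K\<^sup>2 * (V n j)\<^sup>2)"
      proof (rule sum_mono)
        fix j
        have "(c n j)\<^sup>2 \<le> K\<^sup>2" using power_mono[OF c[of n j], of 2] by simp
        then show "(c n j * V n j)\<^sup>2 \<le> K\<^sup>2 * (V n j)\<^sup>2"
          unfolding power_mult_distrib by (rule mult_right_mono) simp
      qed
      from real_sqrt_le_mono[OF this]
      have "sqrt (\<Sum>j<N n. (c n j * V n j)\<^sup>2) \<le> K * sqrt (\<Sum>j<N n. (V n j)\<^sup>2)"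
        using K by (simp add: sum_distrib_left[symmetric] real_sqrt_mult)
      then have "sqrt (\<Sum>j<N n. (c n j * V n j)\<^sup>2) * sqrt (\<Sum>j<N n. (U n j)\<^sup>2)
          \<le> K * sqrt (\<Sum>j<N n. (V n j)\<^sup>2) * sqrt (\<Sum>j<N n. (U n j)\<^sup>2)"
        by (rule mult_right_mono) (simp add: sum_nonneg)
      then show ?thesis
        using sum_mult_le_sqrt[of "\<lambda>j. c n j * V n j" "U n" "N n"] by linarith
    qed
    then show "\<forall>\<^sub>F n in sequentially. \<bar>\<Sum>j<N n. c n j * V n j * U n j\<bar>
        \<le> K * sqrt (\<Sum>j<N n. (V n j)\<^sup>2) * sqrt (\<Sum>j<N n. (U n j)\<^sup>2)" by simp
  qed simp
  have cU2: "(\<lambda>n. \<Sum>j<N n. c n j * (U n j)\<^sup>2) \<longlonglongrightarrow> 0" if c: "\<And>n j. \<bar>c n j\<bar> \<le> K" for c K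
  proof (rule tendsto_rabs_zero_cancel, rule tendsto_sandwich[OF _ _ tendsto_const tendsto_mult_right_zero[OF U2, of K]])
    have "\<bar>\<Sum>j<N n. c n j * (U n j)\<^sup>2\<bar> \<le> K * (\<Sum>j<N n. (U n j)\<^sup>2)" for n
      unfolding sum_distrib_left
      by (rule order_trans[OF sum_abs sum_mono]) (auto simp: abs_mult intro!: mult_right_mono c)
    then show "\<forall>\<^sub>F n in sequentially. \<bar>\<Sum>j<N n. c n j * (U n j)\<^sup>2\<bar> \<le> K * (\<Sum>j<N n. (U n j)\<^sup>2)" by simp
  qed simp
  have sq: "(\<Sum>j<N n. c n j * (\<Delta> n j)\<^sup>2) = (\<Sum>j<N n. c n j * (V n j)\<^sup>2) + 2 * (\<Sum>j<N n. c n j * V n j * U n j)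
      + (\<Sum>j<N n. c n j * (U n j)\<^sup>2)" for c :: "nat \<Rightarrow> nat \<Rightarrow> real" and n
    unfolding sum_distrib_left sum.distrib[symmetric] \<Delta>
    by (intro sum.cong) (auto simp: power2_eq_square algebra_simps)
  have f\<Delta>2: "(\<lambda>n. \<Sum>j<N n. f'' (x (p n j)) * (\<Delta> n j)\<^sup>2) \<longlonglongrightarrow> (LINT u:{a..T}|lborel. f'' (x u) * (s u)\<^sup>2)"
    unfolding sq[of "\<lambda>n j. f'' (x (p n j))"]
    using tendsto_add[OF tendsto_add[OF fV2 tendsto_mult_right_zero[OF cross[of "\<lambda>n j. f'' (x (p n j))" B], of 2]]
        cU2[of "\<lambda>n j. f'' (x (p n j))" B]] bnd(2) by simp
  have \<Delta>2: "(\<lambda>n. \<Sum>j<N n. \<bar>(\<Delta> n j)\<^sup>2\<bar>) \<longlonglongrightarrow> S"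
    using tendsto_add[OF tendsto_add[OF V2 tendsto_mult_right_zero[OF cross[of "\<lambda>n j. 1" 1], of 2]] cU2[of "\<lambda>n j. 1" 1]]
      sq[of "\<lambda>_ _. 1"] by simp
  define R where "R n j = f (x (p n (Suc j))) - f (x (p n j)) - f' (x (p n j)) * \<Delta> n j - f'' (x (p n j)) * (\<Delta> n j)\<^sup>2 / 2" for n j
  \<comment> \<open>The cubic remainder is at most the largest increment, small by uniform
    continuity, times the sum of squared increments, which converges to \<open>S\<close>.\<close>
  have R: "(\<lambda>n. \<Sum>j<N n. R n j) \<longlonglongrightarrow> 0"
  proof (rule tendsto_rabs_zero_cancel, rule tendsto_sandwich[OF _ _ tendsto_const])
    have "(\<lambda>n. \<Sum>j<N n. \<bar>\<Delta> n j\<bar> * (\<Delta> n j)\<^sup>2) \<longlonglongrightarrow> 0"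
      by (rule sum_bounded_mult_tendsto_0[OF _ \<Delta>2]) (simp add: \<Delta>1)
    from tendsto_mult_right_zero[OF this]
    show "(\<lambda>n. B * (\<Sum>j<N n. \<bar>\<Delta> n j\<bar> * (\<Delta> n j)\<^sup>2)) \<longlonglongrightarrow> 0" .
    have "\<bar>R n j\<bar> \<le> B * (\<bar>\<Delta> n j\<bar> * (\<Delta> n j)\<^sup>2)" for n j
      using taylor_second_order[OF f bnd(3), of "x (p n (Suc j))" "x (p n j)"]
      by (simp add: R_def \<Delta>_def power3_eq_cube power2_eq_square abs_mult_self_eq mult.assoc)
    then have "\<bar>\<Sum>j<N n. R n j\<bar> \<le> B * (\<Sum>j<N n. \<bar>\<Delta> n j\<bar> * (\<Delta> n j)\<^sup>2)" for n
      unfolding sum_distrib_left by (intro order_trans[OF sum_abs sum_mono])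
    then show "\<forall>\<^sub>F n in sequentially. \<bar>\<Sum>j<N n. R n j\<bar> \<le> B * (\<Sum>j<N n. \<bar>\<Delta> n j\<bar> * (\<Delta> n j)\<^sup>2)" by simp
  qed simp
  \<comment> \<open>The telescoped Taylor expansion, solved for the stochastic sum; each other term
    has a known limit.\<close>
  have eq: "(\<Sum>j<N n. f' (x (p n j)) * \<eta> n j * dw n j) = f (x T) - f (x a)
      - (\<Sum>j<N n. f' (x (p n j)) * (b' (p n (Suc j)) - b' (p n j))) - (\<Sum>j<N n. f' (x (p n j)) * e n j)
      - (\<Sum>j<N n. f'' (x (p n j)) * (\<Delta> n j)\<^sup>2) / 2 - (\<Sum>j<N n. R n j)" for n
  proof -
    have "f (x T) - f (x a) = (\<Sum>j<N n. f (x (p n (Suc j))) - f (x (p n j)))"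
      by (subst sum_lessThan_telescope) (simp add: p0 pN)
    also have "\<dots> = (\<Sum>j<N n. f' (x (p n j)) * \<eta> n j * dw n j + f' (x (p n j)) * (b' (p n (Suc j)) - b' (p n j))
        + f' (x (p n j)) * e n j + f'' (x (p n j)) * (\<Delta> n j)\<^sup>2 / 2 + R n j)"
      by (intro sum.cong refl) (simp add: R_def \<Delta> V_def U_def \<beta>_def algebra_simps)
    finally show ?thesis by (simp add: sum.distrib sum_divide_distrib)
  qed
  have i1: "set_integrable lborel {a..T} (\<lambda>u. f' (x u) * b u)"
    by (rule set_integrable_bounded_mult[OF b set_borel_measurable_continuous[OF g1] bnd(1)])
  have i2: "set_integrable lborel {a..T} (\<lambda>u. f'' (x u) * (s u)\<^sup>2)"
    by (rule set_integrable_bounded_mult[OF s2 set_borel_measurable_continuous[OF g2] bnd(2)])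
  have "(LINT u:{a..T}|lborel. f' (x u) * b u + f'' (x u) * (s u)\<^sup>2 / 2)
      = (LINT u:{a..T}|lborel. f' (x u) * b u) + (LINT u:{a..T}|lborel. f'' (x u) * (s u)\<^sup>2) / 2"
    using i1 i2 by (subst set_integral_add(2)) auto
  then have "f (x T) - f (x a) - (LINT u:{a..T}|lborel. f' (x u) * b u + f'' (x u) * (s u)\<^sup>2 / 2) =
      f (x T) - f (x a) - (LINT u:{a..T}|lborel. f' (x u) * b u) - 0
      - (LINT u:{a..T}|lborel. f'' (x u) * (s u)\<^sup>2) / 2 - 0" by simp
  then show ?thesis
    unfolding eq by (simp only:) (intro tendsto_diff tendsto_divide tendsto_const drift fe f\<Delta>2 R; simp)
qed

text \<open>With \<open>c\<close> the sampled \<open>g\<close> and \<open>h\<close> the steps of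
  \<eta>, the error \<open>c * h - g * s\<close> is \<open>c * (h - s)\<close> plus
  \<open>(c - g) * s\<close>. The first part is controlled by the bound on \<open>g\<close>, the
  second by convergence of the sampled weights.\<close>

lemma step_product_tendsto:
  fixes g s :: "real \<Rightarrow> real" and \<eta> :: "nat \<Rightarrow> nat \<Rightarrow> real"
  assumes aT: "a < T" and N: "filterlim N at_top sequentially" "\<And>n. 0 < N n"
    and g: "continuous_on {a..T} g" "\<And>u. \<bar>g u\<bar> \<le> B"
    and s: "square_integrable_on s {a..T}"
    and st: "(\<lambda>n. LINT u:{a..T}|lborel. (step (grid a T (N n)) (N n) (\<eta> n) u - s u)\<^sup>2) \<longlonglongrightarrow> 0"
  shows "(\<lambda>n. LINT u:{a..T}|lborel.
    (step (grid a T (N n)) (N n) (\<lambda>j. g (grid a T (N n) j) * \<eta> n j) u - g u * s u)\<^sup>2) \<longlonglongrightarrow> 0"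
proof -
  have B: "0 \<le> B" using g(2)[of 0] by simp
  define p where "p n = grid a T (N n)" for n
  have m: "mono (p n)" for n unfolding p_def using aT by (intro grid_mono) auto
  have p0: "p n 0 = a" and pN: "p n (N n) = T" for n using N(2) by (simp_all add: p_def)
  define c where "c n = step (p n) (N n) (\<lambda>j. g (p n j))" for n
  define h where "h n = step (p n) (N n) (\<eta> n)" for n
  have ch: "step (p n) (N n) (\<lambda>j. g (p n j) * \<eta> n j) u = c n u * h n u"
    and c2: "(c n u)\<^sup>2 = step (p n) (N n) (\<lambda>j. (g (p n j))\<^sup>2) u"
    and cb: "\<bar>c n u\<bar> \<le> B" for n u
    by (rule step_cases[OF m[of n], of "N n" u]; simp add: c_def h_def g(2) B)+
  have gm: "set_borel_measurable lborel {a..T} g" by (rule set_borel_measurable_continuous[OF g(1)])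
  have cm: "set_borel_measurable lborel {a..T} (c n)" for n
    by (simp add: set_borel_measurable_def c_def)
  have s2: "set_integrable lborel {a..T} (\<lambda>u. (s u)\<^sup>2)" using s by (simp add: square_integrable_on_def)
  have hsq: "square_integrable_on (h n) {a..T}" for n unfolding h_def by (rule step_square_integrable)
  have B2: "\<bar>(g u)\<^sup>2\<bar> \<le> B\<^sup>2" "(c n u)\<^sup>2 \<le> B\<^sup>2" for n u
    using power_mono[OF g(2)[of u], of 2] power_mono[OF cb[of n u], of 2] by auto
  have c2B: "((c n u) - g u)\<^sup>2 \<le> 2 * B\<^sup>2 + 2 * B\<^sup>2" for n u
    using diff_squares_le[of "c n u" "g u"] B2(1)[of u] B2(2)[of n u] by simp
  have cg: "set_borel_measurable lborel {a..T} (\<lambda>u. c n u - g u)" for n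
    using set_borel_measurable_linear[OF gm cm, of "-1"] by simp
  have gs2: "set_integrable lborel {a..T} (\<lambda>u. g u * (s u)\<^sup>2)"
    by (rule set_integrable_bounded_mult[OF s2 gm g(2)])
  have ggs2: "set_integrable lborel {a..T} (\<lambda>u. g u * (g u * (s u)\<^sup>2))"
    by (rule set_integrable_bounded_mult[OF gs2 gm g(2)])
  have ccs2: "set_integrable lborel {a..T} (\<lambda>u. (c n u)\<^sup>2 * (s u)\<^sup>2)" for n
    unfolding c2 using step_integral(1)[OF m, of n "N n"] s2 by (simp add: p0 pN)
  have cgs2: "set_integrable lborel {a..T} (\<lambda>u. c n u * (g u * (s u)\<^sup>2))" for n
    unfolding c_def using step_integral(1)[OF m, of n "N n"] gs2 by (simp add: p0 pN)
  \<comment> \<open>The square of \<open>(c - g) * s\<close> is expanded so that each term is a step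
    weight against a fixed integrable function, where \<open>step_weight_integral_tendsto\<close>
    applies.\<close>
  have "(\<lambda>n. (LINT u:{a..T}|lborel. (c n u)\<^sup>2 * (s u)\<^sup>2) - 2 * (LINT u:{a..T}|lborel. c n u * (g u * (s u)\<^sup>2))
      + (LINT u:{a..T}|lborel. g u * (g u * (s u)\<^sup>2))) \<longlonglongrightarrow>
      (LINT u:{a..T}|lborel. (g u)\<^sup>2 * (s u)\<^sup>2) - 2 * (LINT u:{a..T}|lborel. g u * (g u * (s u)\<^sup>2))
      + (LINT u:{a..T}|lborel. g u * (g u * (s u)\<^sup>2))"
    unfolding c2 unfolding c_def p_def
    by (intro tendsto_intros step_weight_integral_tendsto[OF s2 aT N _ B2(1)]
        step_weight_integral_tendsto[OF gs2 aT N g] continuous_intros g)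
  moreover have "(LINT u:{a..T}|lborel. ((c n u - g u) * s u)\<^sup>2) =
      (LINT u:{a..T}|lborel. (c n u)\<^sup>2 * (s u)\<^sup>2) - 2 * (LINT u:{a..T}|lborel. c n u * (g u * (s u)\<^sup>2))
      + (LINT u:{a..T}|lborel. g u * (g u * (s u)\<^sup>2))" for n
  proof -
    have "((c n u - g u) * s u)\<^sup>2 = ((c n u)\<^sup>2 * (s u)\<^sup>2 - 2 * (c n u * (g u * (s u)\<^sup>2))) + g u * (g u * (s u)\<^sup>2)" for u
      by (simp add: power2_eq_square algebra_simps)
    then show ?thesis
      using ccs2[of n] cgs2[of n] ggs2
      by (simp add: set_integral_add(2) set_integral_diff(1,2))
  qed
  ultimately have D: "(\<lambda>n. LINT u:{a..T}|lborel. ((c n u - g u) * s u)\<^sup>2) \<longlonglongrightarrow> 0"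
    by (simp add: power2_eq_square mult.assoc)
  have lim: "(\<lambda>n. 2 * (B\<^sup>2 * (LINT u:{a..T}|lborel. (h n u - s u)\<^sup>2)) + 2 * (LINT u:{a..T}|lborel. ((c n u - g u) * s u)\<^sup>2)) \<longlonglongrightarrow> 0"
    using D st unfolding h_def p_def by (auto intro!: tendsto_eq_intros)
  show ?thesis
    unfolding p_def[symmetric] ch
  proof (rule tendsto_sandwich[OF _ _ tendsto_const lim]; intro always_eventually allI)
    fix n
    have 1: "square_integrable_on (\<lambda>u. c n u * (h n u - s u)) {a..T}"
      "(LINT u:{a..T}|lborel. (c n u * (h n u - s u))\<^sup>2) \<le> B\<^sup>2 * (LINT u:{a..T}|lborel. (h n u - s u)\<^sup>2)"
      using square_integrable_on_mult_bounded[OF square_integrable_on_diff(1)[OF hsq s] cm B2(2)] by auto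
    have 2: "square_integrable_on (\<lambda>u. (c n u - g u) * s u) {a..T}"
      by (rule square_integrable_on_mult_bounded(1)[OF s cg c2B])
    have 3: "square_integrable_on (\<lambda>u. (-1) * ((c n u - g u) * s u)) {a..T}"
      by (rule square_integrable_on_mult_bounded(1)[OF 2, of _ 1]) (auto simp: set_borel_measurable_def)
    have "(LINT u:{a..T}|lborel. (c n u * h n u - g u * s u)\<^sup>2) =
        (LINT u:{a..T}|lborel. (c n u * (h n u - s u) - (-1) * ((c n u - g u) * s u))\<^sup>2)"
      by (simp add: algebra_simps)
    also have "\<dots> \<le> 2 * (LINT u:{a..T}|lborel. (c n u * (h n u - s u))\<^sup>2)
        + 2 * (LINT u:{a..T}|lborel. ((-1) * ((c n u - g u) * s u))\<^sup>2)"
      by (rule square_integrable_on_diff(2)[OF 1(1) 3])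
    also have "\<dots> \<le> 2 * (B\<^sup>2 * (LINT u:{a..T}|lborel. (h n u - s u)\<^sup>2))
        + 2 * (LINT u:{a..T}|lborel. ((c n u - g u) * s u)\<^sup>2)"
      using 1(2) by (simp add: power_mult_distrib)
    finally show "(LINT u:{a..T}|lborel. (c n u * h n u - g u * s u)\<^sup>2) \<le>
        2 * (B\<^sup>2 * (LINT u:{a..T}|lborel. (h n u - s u)\<^sup>2)) + 2 * (LINT u:{a..T}|lborel. ((c n u - g u) * s u)\<^sup>2)" .
  qed (rule set_integral_square_nonneg)
qed

section \<open>Approximation by step processes on uniform grids\<close>

text \<open>The intervals are open on the left and closed on the right, so membership does not
  change on a short stretch immediately below \<open>u\<close>. This is the regularity that
  \<open>step_grid_tendsto\<close> asks for.\<close>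

lemma simple_process_left_continuous:
  "((\<lambda>v. simple_process hs v \<omega>) \<longlongrightarrow> simple_process hs u \<omega>) (at_left u)"
proof (induction hs)
  case (Cons h hs)
  obtain s t \<xi> where h: "h = (s, t, \<xi>)" by (cases h)
  have "\<forall>\<^sub>F v in at_left u. indicator {s<..t} v = (indicator {s<..t} u :: real)"
  proof -
    consider "u \<le> s" | "s < u" "u \<le> t" | "s < u" "t < u" by linarith
    then show ?thesis
    proof cases
      case 1
      show ?thesis
        unfolding eventually_at_filter using 1 by (intro always_eventually) (auto simp: indicator_def)
    next
      case 2
      have "\<forall>\<^sub>F v in at_left u. v \<in> {s<..<u}" by (rule eventually_at_leftI[OF _ 2(1)]) simp
      then show ?thesis by eventually_elim (use 2 in \<open>auto simp: indicator_def\<close>)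
    next
      case 3
      have "\<forall>\<^sub>F v in at_left u. v \<in> {t<..<u}" by (rule eventually_at_leftI[OF _ 3(2)]) simp
      then show ?thesis by eventually_elim (use 3 in \<open>auto simp: indicator_def\<close>)
    qed
  qed
  then have "((\<lambda>v. indicator {s<..t} v) \<longlongrightarrow> (indicator {s<..t} u :: real)) (at_left u)"
    by (rule tendsto_eventually)
  then show ?case using Cons.IH by (auto simp: h intro!: tendsto_intros)
qed simp

lemma (in filtered_prob_space) simple_process_adapted:
  assumes "simple_on F a b hs"
  shows "simple_process hs v \<in> borel_measurable (F v)"
  using assms
proof (induction hs)
  case (Cons h hs)
  obtain s t \<xi> where h: "h = (s, t, \<xi>)" by (cases h)
  have [measurable]: "simple_process hs v \<in> borel_measurable (F v)" using Cons by (simp add: h)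
  have [measurable]: "(\<lambda>\<omega>. \<xi> \<omega> * indicator {s<..t} v) \<in> borel_measurable (F v)"
  proof (cases "s < v")
    case True
    have "\<xi> \<in> borel_measurable (F s)" using Cons.prems by (simp add: h)
    then have "\<xi> \<in> borel_measurable (F v)" by (rule measurable_F_mono[OF less_imp_le[OF True]])
    then show ?thesis by (intro borel_measurable_times borel_measurable_const)
  qed simp
  show ?case unfolding h simple_process_Cons by measurable
next
  case Nil
  have "simple_process [] v = (\<lambda>_::'a. 0)" by auto
  then show ?case by simp
qed

lemma (in filtered_prob_space) simple_process_grid_tendsto:
  assumes hs: "simple_on F a T hs" and aT: "a < T" and \<omega>: "\<omega> \<in> space M"
  shows "(\<lambda>n. LINT u:{a..T}|lborel. (step (grid a T (Suc n)) (Suc n)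
      (\<lambda>j. simple_process hs (grid a T (Suc n) j) \<omega>) u - simple_process hs u \<omega>)\<^sup>2) \<longlonglongrightarrow> 0"
proof -
  obtain C where C: "\<And>u. \<bar>simple_process hs u \<omega>\<bar> \<le> C"
    using simple_process_bounded[OF hs] \<omega> by blast
  have C0: "0 \<le> C" using C[of 0] by simp
  let ?st = "\<lambda>n. step (grid a T (Suc n)) (Suc n) (\<lambda>j. simple_process hs (grid a T (Suc n) j) \<omega>)"
  have m: "mono (grid a T n)" for n using aT by (intro grid_mono) auto
  have stb: "\<bar>?st n u\<bar> \<le> C" for n u
    by (rule step_cases[OF m[of "Suc n"], of "Suc n" u]) (simp_all add: C C0)
  have "(\<lambda>n. LINT u:{a..T}|lborel. (?st n u - simple_process hs u \<omega>)\<^sup>2) \<longlonglongrightarrow> (LINT u:{a..T}|lborel. 0)"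
  proof (rule set_integral_dominated)
    show "set_integrable lborel {a..T} (\<lambda>_. (2 * C)\<^sup>2)"
      using borel_integrable_atLeastAtMost'[of a T "\<lambda>_. (2 * C)\<^sup>2"] by simp
    show "AE u in lborel. u \<in> {a..T} \<longrightarrow> (\<lambda>n. (?st n u - simple_process hs u \<omega>)\<^sup>2) \<longlonglongrightarrow> 0"
      using AE_lborel_singleton[of a]
    proof (eventually_elim, intro impI)
      fix u assume "u \<noteq> a" "u \<in> {a..T}"
      then have "(\<lambda>n. ?st n u) \<longlonglongrightarrow> simple_process hs u \<omega>"
        by (intro step_grid_tendsto[OF filterlim_Suc _ _ simple_process_left_continuous]) auto
      then show "(\<lambda>n. (?st n u - simple_process hs u \<omega>)\<^sup>2) \<longlonglongrightarrow> 0"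
        by (auto intro!: tendsto_eq_intros)
    qed
    fix n u
    have "\<bar>?st n u - simple_process hs u \<omega>\<bar> \<le> 2 * C"
      using stb[of n u] C[of u] abs_triangle_ineq4[of "?st n u" "simple_process hs u \<omega>"] by linarith
    from power_mono[OF this, of 2]
    show "\<bar>(?st n u - simple_process hs u \<omega>)\<^sup>2\<bar> \<le> (2 * C)\<^sup>2" by simp
  qed (simp_all add: set_borel_measurable_def)
  then show ?thesis by simp
qed

context wiener_space
begin

text \<open>A diagonal construction in two levels: simple processes close to \<open>H\<close>, then
  their samples on uniform grids. The condition on \<open>C n ^ 4 / N n\<close> is a quantitative
  coupling of bound and mesh for the quadratic variation in
  \<open>ito_formula_integral\<close>.\<close>

lemma step_approximation:
  assumes H: "has_ito_integral M F W H a T I" and a: "0 \<le> a" "a < T"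
  obtains N :: "nat \<Rightarrow> nat" and \<eta> C where "\<And>n. 0 < N n" "filterlim N at_top sequentially"
    "\<And>n j. \<eta> n j \<in> borel_measurable (F (grid a T (N n) j))"
    "\<And>n j \<omega>. \<omega> \<in> space M \<Longrightarrow> \<bar>\<eta> n j \<omega>\<bar> \<le> C n"
    "(\<lambda>n. C n ^ 4 / N n) \<longlonglongrightarrow> 0"
    "AE \<omega> in M. (\<lambda>n. LINT u:{a..T}|lborel. (step (grid a T (N n)) (N n) (\<lambda>j. \<eta> n j \<omega>) u - H u \<omega>)\<^sup>2) \<longlonglongrightarrow> 0"
proof -
  have aT: "a \<le> T" using a by simp
  obtain hs where hs: "\<And>n. simple_on F a T (hs n)"
    and L: "AE \<omega> in M. (\<lambda>n. LINT u:{a..T}|lborel. (simple_process (hs n) u \<omega> - H u \<omega>)\<^sup>2) \<longlonglongrightarrow> 0"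
    using has_ito_integralE_AE[OF H a(1) aT] by blast
  have prog: "progressive F {a..T} H" using H by (simp add: has_ito_integral_def)
  have sq: "AE \<omega> in M. square_integrable_on (\<lambda>u. H u \<omega>) {a..T}"
    by (rule has_ito_integral_square_integrable[OF H aT])
  obtain C where C: "\<And>n u \<omega>. \<omega> \<in> space M \<Longrightarrow> \<bar>simple_process (hs n) u \<omega>\<bar> \<le> C n"
    using choice[of "\<lambda>n C. \<forall>u. \<forall>\<omega>\<in>space M. \<bar>simple_process (hs n) u \<omega>\<bar> \<le> C"] simple_process_bounded[OF hs] by blast
  let ?st = "\<lambda>n k \<omega>. step (grid a T (Suc k)) (Suc k) (\<lambda>j. simple_process (hs n) (grid a T (Suc k) j) \<omega>)"
  define X where "X n k \<omega> = (LINT u:{a..T}|lborel. (?st n k \<omega> u - simple_process (hs n) u \<omega>)\<^sup>2)" for n k \<omega>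
  define Y where "Y n \<omega> = (LINT u:{a..T}|lborel. (simple_process (hs n) u \<omega> - H u \<omega>)\<^sup>2)" for n \<omega>
  define Z where "Z n k \<omega> = (LINT u:{a..T}|lborel. (?st n k \<omega> u - H u \<omega>)\<^sup>2)" for n k \<omega>
  have sp_meas: "simple_process (hs n) u \<in> borel_measurable M" for n u
    by (rule measurable_F_M[OF simple_process_adapted[OF hs]])
  have 0: "progressive F UNIV (\<lambda>_ _. 0)" by (simp add: progressive_def case_prod_unfold)
  have XM[measurable]: "X n k \<in> borel_measurable M" for n k
    unfolding X_def[abs_def]
  proof -
    have "(\<lambda>(u, \<omega>). ?st n k \<omega> u - simple_process (hs n) u \<omega>) \<in> borel_measurable (borel \<Otimes>\<^sub>M M)"
    proof -
      note [measurable] = simple_process_measurable_pair[OF hs[of n]]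
      have [measurable]: "(\<lambda>(u, \<omega>). ?st n k \<omega> u) \<in> borel_measurable (borel \<Otimes>\<^sub>M M)"
        unfolding step_def case_prod_unfold using sp_meas
        by (intro borel_measurable_sum borel_measurable_times)
           (auto intro: measurable_compose[OF measurable_snd] measurable_compose[OF measurable_fst])
      show ?thesis by measurable
    qed
    from distance_measurable[OF 0 _ aT this]
    show "(\<lambda>\<omega>. LINT u:{a..T}|lborel. (?st n k \<omega> u - simple_process (hs n) u \<omega>)\<^sup>2) \<in> borel_measurable M" by simp
  qed
  have YM[measurable]: "Y n \<in> borel_measurable M" for n
    unfolding Y_def[abs_def] by (rule distance_measurable[OF prog _ aT simple_process_measurable_pair[OF hs]]) simp
  have ZM[measurable]: "Z n k \<in> borel_measurable M" for n k
    unfolding Z_def[abs_def] by (rule step_distance_measurable[OF prog _ aT sp_meas]) simp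
  \<comment> \<open>The bound \<open>C n\<close> is fixed before the grid is refined, so all
    requirements hold for large \<open>k\<close>. \<open>n \<le> k\<close> makes the number of cells
    tend to infinity.\<close>
  have "\<exists>k. n \<le> k \<and> prob_norm M (X n k) < inverse (real (Suc n)) \<and> \<bar>C n ^ 4 / Suc k\<bar> < inverse (real (Suc n))" for n
  proof -
    have p: "0 < inverse (real (Suc n))" by simp
    have "(\<lambda>k. prob_norm M (X n k)) \<longlonglongrightarrow> 0"
      unfolding X_def[abs_def]
      by (rule prob_norm_tendsto_0_AE)
         (use XM simple_process_grid_tendsto[OF hs a(2)] in \<open>auto simp: X_def[abs_def]\<close>)
    then have 1: "\<forall>\<^sub>F k in sequentially. prob_norm M (X n k) < inverse (real (Suc n))"
      by (rule order_tendstoD(2)[OF _ p])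
    have "(\<lambda>k. \<bar>C n ^ 4 / Suc k\<bar>) \<longlonglongrightarrow> \<bar>0\<bar>"
      by (intro tendsto_rabs mesh_tendsto_0 filterlim_Suc)
    then have 2: "\<forall>\<^sub>F k in sequentially. \<bar>C n ^ 4 / Suc k\<bar> < inverse (real (Suc n))"
      using order_tendstoD(2)[OF _ p] by simp
    from eventually_conj[OF eventually_ge_at_top[of n] eventually_conj[OF 1 2]]
    show ?thesis by (rule eventually_happens'[OF sequentially_bot])
  qed
  then obtain k where k: "\<And>n. n \<le> k n" "\<And>n. prob_norm M (X n (k n)) < inverse (real (Suc n))"
      "\<And>n. \<bar>C n ^ 4 / Suc (k n)\<bar> < inverse (real (Suc n))"
    using choice[of "\<lambda>n k. n \<le> k \<and> prob_norm M (X n k) < inverse (real (Suc n)) \<and> \<bar>C n ^ 4 / Suc k\<bar> < inverse (real (Suc n))"]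
    by blast
  have Xk: "(\<lambda>n. prob_norm M (X n (k n))) \<longlonglongrightarrow> 0"
    by (rule tendsto_sandwich[OF _ _ tendsto_const LIMSEQ_inverse_real_of_nat])
       (use k(2) prob_norm_nonneg in \<open>auto intro!: always_eventually less_imp_le\<close>)
  have Yn: "(\<lambda>n. prob_norm M (Y n)) \<longlonglongrightarrow> 0"
    by (rule prob_norm_tendsto_0_AE) (use L YM in \<open>auto simp: Y_def\<close>)
  have "(\<lambda>n. prob_norm M (Z n (k n))) \<longlonglongrightarrow> 0"
  proof (rule prob_norm_combination_tendsto_0[OF _ _ _ Xk Yn])
    fix n
    show "AE \<omega> in M. 0 \<le> Z n (k n) \<omega> \<and> Z n (k n) \<omega> \<le> 2 * X n (k n) \<omega> + 2 * Y n \<omega>"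
      using sq AE_space
    proof eventually_elim
      case (elim \<omega>)
      then show ?case
        unfolding X_def Y_def Z_def
        by (intro conjI set_integral_square_nonneg mean_square_triangle step_square_integrable
            simple_process_square_integrable[OF hs])
    qed
  qed measurable
  then obtain \<rho> :: "nat \<Rightarrow> nat" where \<rho>: "strict_mono \<rho>" "AE \<omega> in M. (\<lambda>n. Z (\<rho> n) (k (\<rho> n)) \<omega>) \<longlonglongrightarrow> 0"
    using prob_norm_subseq[of "\<lambda>n. Z n (k n)"] by auto
  show ?thesis
  proof (rule that[of "\<lambda>n. Suc (k (\<rho> n))" "\<lambda>n j. simple_process (hs (\<rho> n)) (grid a T (Suc (k (\<rho> n))) j)" "\<lambda>n. C (\<rho> n)"])
    have "filterlim (\<lambda>n. Suc (k n)) at_top sequentially"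
      by (rule filterlim_at_top_mono[OF filterlim_ident]) (use k(1) in \<open>auto intro!: always_eventually le_SucI\<close>)
    then show "filterlim (\<lambda>n. Suc (k (\<rho> n))) at_top sequentially"
      by (rule filterlim_compose[OF _ filterlim_subseq[OF \<rho>(1)]])
    have "(\<lambda>n. C n ^ 4 / Suc (k n)) \<longlonglongrightarrow> 0"
    proof (rule tendsto_rabs_zero_cancel, rule tendsto_sandwich[OF _ _ tendsto_const LIMSEQ_inverse_real_of_nat])
      show "\<forall>\<^sub>F n in sequentially. \<bar>C n ^ 4 / Suc (k n)\<bar> \<le> inverse (real (Suc n))"
        by (intro always_eventually allI less_imp_le k(3))
    qed simp
    from LIMSEQ_subseq_LIMSEQ[OF this \<rho>(1)]
    show "(\<lambda>n. C (\<rho> n) ^ 4 / Suc (k (\<rho> n))) \<longlonglongrightarrow> 0" by (simp add: comp_def)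
    show "AE \<omega> in M. (\<lambda>n. LINT u:{a..T}|lborel. (?st (\<rho> n) (k (\<rho> n)) \<omega> u - H u \<omega>)\<^sup>2) \<longlonglongrightarrow> 0"
      using \<rho>(2) by (simp add: Z_def)
  qed (auto intro: simple_process_adapted[OF hs] C)
qed

end

section \<open>Ito's formula\<close>

context filtered_prob_space
begin

lemma progressive_compose:
  assumes "progressive F T X" "g \<in> borel_measurable borel"
  shows "progressive F T (\<lambda>t \<omega>. g (X t \<omega>))"
  using assms(1) unfolding progressive_def case_prod_unfold
  by (auto intro: measurable_compose[OF _ assms(2)])

lemma progressive_add:
  "progressive F T X \<Longrightarrow> progressive F T Y \<Longrightarrow> progressive F T (\<lambda>t \<omega>. X t \<omega> + Y t \<omega>)"
  unfolding progressive_def case_prod_unfold by (auto intro: borel_measurable_add)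

lemma progressive_times:
  "progressive F T X \<Longrightarrow> progressive F T Y \<Longrightarrow> progressive F T (\<lambda>t \<omega>. X t \<omega> * Y t \<omega>)"
  unfolding progressive_def case_prod_unfold by (auto intro: borel_measurable_times)

lemma progressive_const: "progressive F T (\<lambda>_ _. c)"
  by (simp add: progressive_def case_prod_unfold)

end

context wiener_space
begin

lemma has_differential_ito_integral:
  assumes "has_differential M F W a X b s" "a \<le> t"
  shows "has_ito_integral M F W s a t (\<lambda>\<omega>. X t \<omega> - X a \<omega> - (LINT u:{a..t}|lborel. b u \<omega>))"
  using assms by (simp add: has_differential_def)

text \<open>The simple processes with coefficient \<open>f' (X) * \<eta>\<close> at the left grid
  points approximate \<open>f' (X) * s\<close>. Their elementary integrals are the stochastic sums
  of \<open>pathwise_ito\<close>, which identifies the limit as \<open>I\<close>.\<close>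

lemma ito_formula_integral:
  fixes f f' f'' :: "real \<Rightarrow> real"
  assumes X: "has_differential M F W a X b s" and a: "0 \<le> a" "a < T"
    and f: "\<And>x. (f has_real_derivative f' x) (at x)" "\<And>x. (f' has_real_derivative f'' x) (at x)"
    and bnd: "\<And>x. \<bar>f' x\<bar> \<le> B" "\<And>x. \<bar>f'' x\<bar> \<le> B" "\<And>x y. \<bar>f'' x - f'' y\<bar> \<le> B * \<bar>x - y\<bar>"
    and prog: "progressive F {a..T} (\<lambda>t \<omega>. f' (X t \<omega>) * s t \<omega>)"
    and sqi: "AE \<omega> in M. set_integrable lborel {a..T} (\<lambda>u. (f' (X u \<omega>) * s u \<omega>)\<^sup>2)"
    and I: "I \<in> borel_measurable M"
    and I_eq: "\<And>\<omega>. I \<omega> = f (X T \<omega>) - f (X a \<omega>)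
      - (LINT u:{a..T}|lborel. f' (X u \<omega>) * b u \<omega> + f'' (X u \<omega>) * (s u \<omega>)\<^sup>2 / 2)"
  shows "has_ito_integral M F W (\<lambda>t \<omega>. f' (X t \<omega>) * s t \<omega>) a T I"
proof -
  have aT: "a \<le> T" using a by simp
  have B: "0 \<le> B" using bnd(1)[of 0] by simp
  note HT = has_differential_ito_integral[OF X aT]
  have pX: "progressive F {a..} X" and ps: "progressive F {a..} s"
    using X by (auto simp: has_differential_def)
  have ctsX: "AE \<omega> in M. continuous_on {a..T} (\<lambda>t. X t \<omega>)"
  proof -
    have "AE \<omega> in M. continuous_on {a..} (\<lambda>t. X t \<omega>)" using X by (simp add: has_differential_def)
    then show ?thesis by eventually_elim (auto elim: continuous_on_subset)
  qed
  have bint: "AE \<omega> in M. set_integrable lborel {a..T} (\<lambda>u. b u \<omega>)"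
  proof -
    have "AE \<omega> in M. \<forall>t\<ge>a. set_integrable lborel {a..t} (\<lambda>u. b u \<omega>)" using X by (simp add: has_differential_def)
    then show ?thesis by eventually_elim (use aT in simp)
  qed
  have ssq: "AE \<omega> in M. square_integrable_on (\<lambda>u. s u \<omega>) {a..T}"
    by (rule has_ito_integral_square_integrable[OF HT aT])
  have cf': "continuous_on UNIV f'"
    using f(2) by (meson DERIV_continuous_on has_field_derivative_at_within)
  have cf'': "continuous_on UNIV f''"
    by (rule lipschitz_on_continuous_on[of B UNIV f''])
       (use bnd(3) B in \<open>auto simp: lipschitz_on_def dist_real_def\<close>)
  have [measurable]: "f' \<in> borel_measurable borel" "f'' \<in> borel_measurable borel"
    using borel_measurable_continuous_onI cf' cf'' by auto
  obtain N :: "nat \<Rightarrow> nat" and \<eta> C where N: "\<And>n. 0 < N n" "filterlim N at_top sequentially"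
    and \<eta>: "\<And>n j. \<eta> n j \<in> borel_measurable (F (grid a T (N n) j))"
      "\<And>n j \<omega>. \<omega> \<in> space M \<Longrightarrow> \<bar>\<eta> n j \<omega>\<bar> \<le> C n"
    and C: "(\<lambda>n. C n ^ 4 / N n) \<longlonglongrightarrow> 0"
    and st: "AE \<omega> in M. (\<lambda>n. LINT u:{a..T}|lborel. (step (grid a T (N n)) (N n) (\<lambda>j. \<eta> n j \<omega>) u - s u \<omega>)\<^sup>2) \<longlonglongrightarrow> 0"
    using step_approximation[OF HT a] by blast
  define p where "p n = grid a T (N n)" for n
  have m: "mono (p n)" for n unfolding p_def using aT by (rule grid_mono)
  have p0: "p n 0 = a" and pN: "p n (N n) = T" for n using N(1) by (simp_all add: p_def)
  have pa: "a \<le> p n j" for n j using monoD[OF m[of n], of 0 j] p0[of n] by simp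
  have pT: "p n j \<le> T" if "j \<le> N n" for n j using monoD[OF m[of n] that] pN[of n] by simp
  have pless: "p n j < p n (Suc j)" for n j unfolding p_def using a N(1) by (intro grid_less) auto
  define J where "J r \<omega> = X r \<omega> - X a \<omega> - (LINT u:{a..r}|lborel. b u \<omega>)" for r \<omega>
  have J: "has_ito_integral M F W s a r (J r)" if "r \<in> {a..T}" for r
    unfolding J_def[abs_def] using has_differential_ito_integral[OF X] that by simp
  define dw where "dw n j \<omega> = W (p n (Suc j)) \<omega> - W (p n j) \<omega>" for n j \<omega>
  define e where "e n j \<omega> = J (p n (Suc j)) \<omega> - J (p n j) \<omega> - \<eta> n j \<omega> * dw n j \<omega>" for n j \<omega>
  define Y where "Y n \<omega> = (LINT u:{a..T}|lborel. (step (p n) (N n) (\<lambda>j. \<eta> n j \<omega>) u - s u \<omega>)\<^sup>2)" for n \<omega>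
  have \<eta>M: "\<eta> n j \<in> borel_measurable M" for n j by (rule measurable_F_M[OF \<eta>(1)])
  have \<eta>p: "\<eta> n j \<in> borel_measurable (F (p n j))" for n j using \<eta>(1) by (simp add: p_def)
  have WM: "W (p n j) \<in> borel_measurable M" for n j
    using W_measurable pa[of n j] a by auto
  have XF: "X (p n j) \<in> borel_measurable (F (p n j))" for n j
    by (rule progressive_adapted[OF pX]) (use pa in auto)
  have XM: "X (p n j) \<in> borel_measurable M" for n j by (rule measurable_F_M[OF XF])
  have JM: "J (p n j) \<in> borel_measurable M" if "j \<le> N n" for n j
    using J[of "p n j"] pa pT[OF that] by (auto simp: has_ito_integral_def tendsto_in_prob_def)
  have dwM: "dw n j \<in> borel_measurable M" for n j
    unfolding dw_def[abs_def] by (intro borel_measurable_diff WM)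
  have eM: "e n j \<in> borel_measurable M" if "j < N n" for n j
    unfolding e_def[abs_def] using that by (intro borel_measurable_diff borel_measurable_times JM \<eta>M dwM) auto
  have YM[measurable]: "Y n \<in> borel_measurable M" for n
    unfolding Y_def[abs_def]
    by (rule step_distance_measurable[OF _ _ aT \<eta>M]) (use ps in auto)
  have Y0: "AE \<omega> in M. (\<lambda>n. Y n \<omega>) \<longlonglongrightarrow> 0" using st by (simp add: Y_def p_def)
  \<comment> \<open>These are the four errors required by \<open>pathwise_ito\<close>:
    \<open>Q1\<close> and \<open>Q2\<close> for the increments of the integral process,
    \<open>Q\<close> with \<open>g\<close> equal to 1 or \<open>f''\<close> for the quadratic
    variation.\<close>
  define Q1 where "Q1 n \<omega> = (\<Sum>j<N n. (e n j \<omega>)\<^sup>2)" for n \<omega>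
  define Q2 where "Q2 n \<omega> = (\<Sum>j<N n. f' (X (p n j) \<omega>) * e n j \<omega>)\<^sup>2" for n \<omega>
  define Q where "Q g n \<omega> = (\<Sum>j<N n. g (X (p n j) \<omega>) * (\<eta> n j \<omega>)\<^sup>2 * ((dw n j \<omega>)\<^sup>2 - (p n (Suc j) - p n j)))\<^sup>2"
    for g :: "real \<Rightarrow> real" and n \<omega>
  have Q1M: "Q1 n \<in> borel_measurable M" for n
    unfolding Q1_def[abs_def] by (intro borel_measurable_sum borel_measurable_power eM) simp
  have Q2M: "Q2 n \<in> borel_measurable M" for n
    unfolding Q2_def[abs_def]
    by (intro borel_measurable_sum borel_measurable_power borel_measurable_times eM measurable_compose[OF XM]) auto
  have QM: "Q g n \<in> borel_measurable M" if "g \<in> borel_measurable borel" for g n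
    unfolding Q_def[abs_def]
    by (intro borel_measurable_sum borel_measurable_power borel_measurable_times borel_measurable_diff
        borel_measurable_const \<eta>M dwM measurable_compose[OF XM that])
  have "(\<lambda>n. prob_norm M (Q1 n)) \<longlonglongrightarrow> 0"
  proof (rule budget_tendsto_0[OF _ YM Y0])
    fix n and d :: real assume d: "0 < d"
    have "(\<Sum>i<N n. (\<Sum>j<N n. (if i = j then 1 else 0) * e n j \<omega>)\<^sup>2) = Q1 n \<omega>" for \<omega>
      unfolding Q1_def
    proof (intro sum.cong refl arg_cong[where f="\<lambda>x. x\<^sup>2"])
      fix i assume "i \<in> {..<N n}"
      moreover have "(\<Sum>j<N n. (if i = j then 1 else 0) * e n j \<omega>) = (\<Sum>j<N n. if i = j then e n j \<omega> else 0)"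
        by (intro sum.cong) auto
      ultimately show "(\<Sum>j<N n. (if i = j then 1 else 0) * e n j \<omega>) = e n i \<omega>" by simp
    qed
    \<comment> \<open>For a fixed cell at most one unit vector is nonzero, hence \<open>K\<close> is
      1 whatever the number of cells.\<close>
    moreover have "(\<Sum>i<N n. (if i = j then 1 else 0 :: real)\<^sup>2) \<le> 1" for j
    proof -
      have "(\<Sum>i<N n. (if i = j then 1 else 0 :: real)\<^sup>2) = (\<Sum>i<N n. if i = j then 1 else 0)"
        by (intro sum.cong) auto
      then show ?thesis by simp
    qed
    moreover have "prob_norm M (\<lambda>\<omega>. \<Sum>i<N n. (\<Sum>j<N n. (if i = j then 1 else 0) * e n j \<omega>)\<^sup>2) \<le>
        d + prob_norm M (\<lambda>\<omega>. 2 * 1 * Y n \<omega> / d)"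
      unfolding e_def dw_def Y_def
      by (rule increment_error_inequality[OF J m p0 pN a(1) \<eta>p \<eta>(2), where B'=1])
         (use calculation(2) d in auto)
    ultimately show "prob_norm M (Q1 n) \<le> d + prob_norm M (\<lambda>\<omega>. 2 * Y n \<omega> / d)" by simp
  qed
  moreover have "(\<lambda>n. prob_norm M (Q2 n)) \<longlonglongrightarrow> 0"
  proof (rule budget_tendsto_0[OF _ YM Y0])
    fix n and d :: real assume d: "0 < d"
    have "(f' (X (p n j) \<omega>))\<^sup>2 \<le> B\<^sup>2" for j \<omega>
      using power_mono[OF bnd(1)[of "X (p n j) \<omega>"], of 2] by simp
    then have "prob_norm M (\<lambda>\<omega>. \<Sum>i\<in>{0::nat}. (\<Sum>j<N n. f' (X (p n j) \<omega>) * e n j \<omega>)\<^sup>2) \<le>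
        d + prob_norm M (\<lambda>\<omega>. 2 * B\<^sup>2 * Y n \<omega> / d)"
      unfolding e_def dw_def Y_def
      by (intro increment_error_inequality[OF J m p0 pN a(1) \<eta>p \<eta>(2), where B'=B])
         (use d bnd(1) in \<open>auto intro: measurable_compose[OF XF]\<close>)
    then show "prob_norm M (Q2 n) \<le> d + prob_norm M (\<lambda>\<omega>. (2 * B\<^sup>2) * Y n \<omega> / d)"
      by (simp add: Q2_def[abs_def])
  qed
  moreover have Qlim: "(\<lambda>n. prob_norm M (Q g n)) \<longlonglongrightarrow> 0"
    if g: "g \<in> borel_measurable borel" "\<And>x. \<bar>g x\<bar> \<le> K" for g K
  \<comment> \<open>The \<open>N n\<close> compensated squares have variance twice the squared mesh
    \<open>(T - a) / N n\<close>, and their weights are at most \<open>K\<close> times the square of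
    \<open>C n\<close>. Multiplying out gives \<open>c\<close> times
    \<open>C n ^ 4 / N n\<close>.\<close>
  proof (rule budget_tendsto_0[where Y="\<lambda>n \<omega>. C n ^ 4 / N n" and c="2 * K\<^sup>2 * (T - a)\<^sup>2"])
    fix n and d :: real assume d: "0 < d"
    define \<delta> where "\<delta> = (T - a) / N n"
    have pd: "p n (Suc j) - p n j = \<delta>" for j by (simp add: p_def grid_diff \<delta>_def)
    interpret I: increments M "\<lambda>j. F (p n j)" "\<lambda>j \<omega>. (W (p n (Suc j)) \<omega> - W (p n j) \<omega>)\<^sup>2 - (p n (Suc j) - p n j)"
        "\<lambda>j. 2 * (p n (Suc j) - p n j)\<^sup>2" "N n"
      by (rule increments_W_squared[OF m pless]) (simp add: p0 a)
    define w where "w j \<omega> = g (X (p n j) \<omega>) * (\<eta> n j \<omega>)\<^sup>2" for j \<omega>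
    have wF: "w j \<in> borel_measurable (F (p n j))" for j
      unfolding w_def[abs_def]
      by (intro borel_measurable_times borel_measurable_power \<eta>p measurable_compose[OF XF g(1)])
    have wB: "\<bar>w j \<omega>\<bar> \<le> K * (C n)\<^sup>2" if "\<omega> \<in> space M" for j \<omega>
    proof -
      have "(\<eta> n j \<omega>)\<^sup>2 \<le> (C n)\<^sup>2" using power_mono[OF \<eta>(2)[OF that, of n j], of 2] by simp
      moreover have "0 \<le> K" using g(2)[of 0] by simp
      ultimately show ?thesis unfolding w_def abs_mult using g(2) by (intro mult_mono) auto
    qed
    have "prob_norm M (Q g n) \<le> d + prob_norm M (\<lambda>\<omega>. (\<Sum>j<N n. (w j \<omega>)\<^sup>2 * (2 * (p n (Suc j) - p n j)\<^sup>2)) / d)"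
      using I.budget_inequality[of "{0::nat}" "\<lambda>i. w" "K * (C n)\<^sup>2" d] wF wB d
      by (simp add: Q_def[abs_def] w_def dw_def)
    also have "prob_norm M (\<lambda>\<omega>. (\<Sum>j<N n. (w j \<omega>)\<^sup>2 * (2 * (p n (Suc j) - p n j)\<^sup>2)) / d) \<le>
        prob_norm M (\<lambda>\<omega>. 2 * K\<^sup>2 * (T - a)\<^sup>2 * (C n ^ 4 / N n) / d)"
    proof (rule prob_norm_mono_AE)
      show "(\<lambda>\<omega>. (\<Sum>j<N n. (w j \<omega>)\<^sup>2 * (2 * (p n (Suc j) - p n j)\<^sup>2)) / d) \<in> borel_measurable M"
        by (intro borel_measurable_divide borel_measurable_sum borel_measurable_times borel_measurable_power
            borel_measurable_const measurable_F_M[OF wF])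
      show "AE \<omega> in M. \<bar>(\<Sum>j<N n. (w j \<omega>)\<^sup>2 * (2 * (p n (Suc j) - p n j)\<^sup>2)) / d\<bar>
          \<le> \<bar>2 * K\<^sup>2 * (T - a)\<^sup>2 * (C n ^ 4 / N n) / d\<bar>"
      proof (rule AE_I2)
        fix \<omega> assume \<omega>: "\<omega> \<in> space M"
        have "(w j \<omega>)\<^sup>2 \<le> K\<^sup>2 * C n ^ 4" for j
          using power_mono[OF wB[OF \<omega>, of j], of 2] by (simp add: power_mult_distrib)
        then have "(\<Sum>j<N n. (w j \<omega>)\<^sup>2 * (2 * (p n (Suc j) - p n j)\<^sup>2)) \<le> (\<Sum>j<N n. K\<^sup>2 * C n ^ 4 * (2 * \<delta>\<^sup>2))"
          unfolding pd by (intro sum_mono mult_right_mono) auto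
        also have "\<dots> = 2 * K\<^sup>2 * (T - a)\<^sup>2 * (C n ^ 4 / N n)"
          using N(1)[of n] by (simp add: \<delta>_def power_divide power2_eq_square field_simps)
        finally have le: "(\<Sum>j<N n. (w j \<omega>)\<^sup>2 * (2 * (p n (Suc j) - p n j)\<^sup>2)) \<le> 2 * K\<^sup>2 * (T - a)\<^sup>2 * (C n ^ 4 / N n)" .
        have "0 \<le> (\<Sum>j<N n. (w j \<omega>)\<^sup>2 * (2 * (p n (Suc j) - p n j)\<^sup>2))" by (intro sum_nonneg) simp
        with le show "\<bar>(\<Sum>j<N n. (w j \<omega>)\<^sup>2 * (2 * (p n (Suc j) - p n j)\<^sup>2)) / d\<bar>
          \<le> \<bar>2 * K\<^sup>2 * (T - a)\<^sup>2 * (C n ^ 4 / N n) / d\<bar>"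
          unfolding abs_divide by (intro divide_right_mono) linarith+
      qed
    qed simp
    finally show "prob_norm M (Q g n) \<le> d + prob_norm M (\<lambda>\<omega>. 2 * K\<^sup>2 * (T - a)\<^sup>2 * (C n ^ 4 / N n) / d)"
      by simp
  qed (use C in auto)
  ultimately have "(\<lambda>n. prob_norm M (\<lambda>\<omega>. (Q1 n \<omega> + Q2 n \<omega>) + (Q (\<lambda>_. 1) n \<omega> + Q f'' n \<omega>))) \<longlonglongrightarrow> 0"
    using Qlim[of "\<lambda>_. 1" 1] Qlim[of f'' B] bnd(2)
    by (intro prob_norm_add_tendsto_0 borel_measurable_add Q1M Q2M QM) auto
  then obtain \<rho> :: "nat \<Rightarrow> nat" where \<rho>: "strict_mono \<rho>" and
    lim: "AE \<omega> in M. (\<lambda>n. (Q1 (\<rho> n) \<omega> + Q2 (\<rho> n) \<omega>) + (Q (\<lambda>_. 1) (\<rho> n) \<omega> + Q f'' (\<rho> n) \<omega>)) \<longlonglongrightarrow> 0"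
    using prob_norm_subseq[of "\<lambda>n \<omega>. (Q1 n \<omega> + Q2 n \<omega>) + (Q (\<lambda>_. 1) n \<omega> + Q f'' n \<omega>)"] Q1M Q2M QM by auto
  have Qnn: "0 \<le> Q1 n \<omega>" "0 \<le> Q2 n \<omega>" "0 \<le> Q g n \<omega>" for n \<omega> g
    by (auto simp: Q1_def Q2_def Q_def sum_nonneg)
  \<comment> \<open>\<open>Q2\<close> and \<open>Q\<close> are squares of sums, the form that the
    budget inequality controls; the sums themselves are recovered here.\<close>
  have sqrt0: "x \<longlonglongrightarrow> 0" if "(\<lambda>n. (x n)\<^sup>2) \<longlonglongrightarrow> 0" for x :: "nat \<Rightarrow> real"
    using tendsto_real_sqrt[OF that] by (simp add: tendsto_rabs_zero_iff)
  define hs where "hs n = map (\<lambda>j. (p (\<rho> n) j, p (\<rho> n) (Suc j), \<lambda>\<omega>. f' (X (p (\<rho> n) j) \<omega>) * \<eta> (\<rho> n) j \<omega>)) [0..<N (\<rho> n)]" for n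
  have hsP: "simple_process (hs n) u \<omega> = step (p (\<rho> n)) (N (\<rho> n)) (\<lambda>j. f' (X (p (\<rho> n) j) \<omega>) * \<eta> (\<rho> n) j \<omega>) u" for n u \<omega>
    by (simp add: hs_def simple_process_def step_def comp_def interv_sum_list_conv_sum_set_nat atLeast0LessThan)
  have hsI: "simple_integral W (hs n) \<omega> = (\<Sum>j<N (\<rho> n). f' (X (p (\<rho> n) j) \<omega>) * \<eta> (\<rho> n) j \<omega> * dw (\<rho> n) j \<omega>)" for n \<omega>
    by (simp add: hs_def simple_integral_def dw_def comp_def interv_sum_list_conv_sum_set_nat atLeast0LessThan)
  have hs_on: "simple_on F a T (hs n)" for n
    unfolding simple_on_def
  proof (intro ballI, clarify)
    fix l r \<xi> assume "(l, r, \<xi>) \<in> set (hs n)"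
    then obtain j where j: "j < N (\<rho> n)" "l = p (\<rho> n) j" "r = p (\<rho> n) (Suc j)"
      "\<xi> = (\<lambda>\<omega>. f' (X (p (\<rho> n) j) \<omega>) * \<eta> (\<rho> n) j \<omega>)" by (auto simp: hs_def)
    have "\<xi> \<in> borel_measurable (F l)"
      unfolding j by (intro borel_measurable_times \<eta>p measurable_compose[OF XF]) simp
    moreover have "\<bar>\<xi> \<omega>\<bar> \<le> B * C (\<rho> n)" if "\<omega> \<in> space M" for \<omega>
      unfolding j abs_mult using bnd(1) \<eta>(2)[OF that] B by (intro mult_mono) auto
    ultimately show "a \<le> l \<and> l \<le> r \<and> r \<le> T \<and> \<xi> \<in> borel_measurable (F l) \<and> (\<exists>C. \<forall>\<omega>\<in>space (F l). \<bar>\<xi> \<omega>\<bar> \<le> C)"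
      using j pa pless[THEN less_imp_le] pT by (auto simp: space_F)
  qed
  have N\<rho>: "filterlim (\<lambda>n. N (\<rho> n)) at_top sequentially"
    by (rule filterlim_compose[OF N(2) filterlim_subseq[OF \<rho>]])
  have both: "AE \<omega> in M.
    (\<lambda>n. LINT u:{a..T}|lborel. (simple_process (hs n) u \<omega> - f' (X u \<omega>) * s u \<omega>)\<^sup>2) \<longlonglongrightarrow> 0 \<and>
    (\<lambda>n. simple_integral W (hs n) \<omega>) \<longlonglongrightarrow> I \<omega>"
    using lim Y0 ctsX bint ssq
  proof eventually_elim
    case (elim \<omega>)
    have st': "(\<lambda>n. LINT u:{a..T}|lborel. (step (grid a T (N (\<rho> n))) (N (\<rho> n)) (\<lambda>j. \<eta> (\<rho> n) j \<omega>) u - s u \<omega>)\<^sup>2) \<longlonglongrightarrow> 0"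
      using LIMSEQ_subseq_LIMSEQ[OF elim(2) \<rho>] by (simp add: Y_def p_def comp_def)
    have q: "(\<lambda>n. Q1 (\<rho> n) \<omega>) \<longlonglongrightarrow> 0" "(\<lambda>n. Q2 (\<rho> n) \<omega>) \<longlonglongrightarrow> 0"
        "(\<lambda>n. Q (\<lambda>_. 1) (\<rho> n) \<omega>) \<longlonglongrightarrow> 0" "(\<lambda>n. Q f'' (\<rho> n) \<omega>) \<longlonglongrightarrow> 0"
      by (rule tendsto_sandwich[OF _ _ tendsto_const elim(1)];
          use Qnn in \<open>auto intro!: always_eventually add_increasing add_increasing2\<close>)+
    have g: "continuous_on {a..T} (\<lambda>u. f' (X u \<omega>))"
      by (rule continuous_on_compose2[OF cf' elim(3)]) simp
    have 1: "(\<lambda>n. LINT u:{a..T}|lborel. (simple_process (hs n) u \<omega> - f' (X u \<omega>) * s u \<omega>)\<^sup>2) \<longlonglongrightarrow> 0"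
      unfolding hsP p_def by (rule step_product_tendsto[OF a(2) N\<rho> N(1) g bnd(1) elim(5) st'])
    have 2: "(\<lambda>n. simple_integral W (hs n) \<omega>) \<longlonglongrightarrow> I \<omega>"
      unfolding hsI I_eq p_def
    proof (rule pathwise_ito[OF f bnd a(2) N\<rho> N(1) elim(3-5) st'], unfold p_def[symmetric])
      have e_eq: "X (p (\<rho> n) (Suc j)) \<omega> - X (p (\<rho> n) j) \<omega> -
          ((LINT u:{a..p (\<rho> n) (Suc j)}|lborel. b u \<omega>) - (LINT u:{a..p (\<rho> n) j}|lborel. b u \<omega>)) - \<eta> (\<rho> n) j \<omega> * dw (\<rho> n) j \<omega>
          = e (\<rho> n) j \<omega>" for n j
        by (simp add: e_def J_def)
      show "(\<lambda>n. \<Sum>j<N (\<rho> n). (X (p (\<rho> n) (Suc j)) \<omega> - X (p (\<rho> n) j) \<omega> -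
          ((LINT u:{a..p (\<rho> n) (Suc j)}|lborel. b u \<omega>) - (LINT u:{a..p (\<rho> n) j}|lborel. b u \<omega>)) - \<eta> (\<rho> n) j \<omega> * dw (\<rho> n) j \<omega>)\<^sup>2) \<longlonglongrightarrow> 0"
        unfolding e_eq using q(1) by (simp add: Q1_def)
      show "(\<lambda>n. \<Sum>j<N (\<rho> n). f' (X (p (\<rho> n) j) \<omega>) * (X (p (\<rho> n) (Suc j)) \<omega> - X (p (\<rho> n) j) \<omega> -
          ((LINT u:{a..p (\<rho> n) (Suc j)}|lborel. b u \<omega>) - (LINT u:{a..p (\<rho> n) j}|lborel. b u \<omega>)) - \<eta> (\<rho> n) j \<omega> * dw (\<rho> n) j \<omega>)) \<longlonglongrightarrow> 0"
        unfolding e_eq by (rule sqrt0) (use q(2) in \<open>simp add: Q2_def\<close>)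
      show "(\<lambda>n. \<Sum>j<N (\<rho> n). (\<eta> (\<rho> n) j \<omega>)\<^sup>2 * ((dw (\<rho> n) j \<omega>)\<^sup>2 - (p (\<rho> n) (Suc j) - p (\<rho> n) j))) \<longlonglongrightarrow> 0"
        by (rule sqrt0) (use q(3) in \<open>simp add: Q_def\<close>)
      show "(\<lambda>n. \<Sum>j<N (\<rho> n). f'' (X (p (\<rho> n) j) \<omega>) * (\<eta> (\<rho> n) j \<omega>)\<^sup>2 * ((dw (\<rho> n) j \<omega>)\<^sup>2 - (p (\<rho> n) (Suc j) - p (\<rho> n) j))) \<longlonglongrightarrow> 0"
        by (rule sqrt0) (use q(4) in \<open>simp add: Q_def\<close>)
    qed
    from 1 2 show ?case by blast
  qed
  show ?thesis
    by (rule has_ito_integralI_AE[OF prog a(1) aT sqi hs_on _ I]) (use both in auto)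
qed

text \<open>\<open>ito_formula_integral\<close> works with grids on an interval of positive length;
  this supplies the start time itself.\<close>

lemma has_ito_integral_degenerate:
  assumes "progressive F {a..a} H" "0 \<le> a"
  shows "has_ito_integral M F W H a a (\<lambda>_. 0)"
proof (rule has_ito_integralI_AE[OF assms order_refl, of "\<lambda>_. []"])
  show "AE \<omega> in M. set_integrable lborel {a..a} (\<lambda>u. (H u \<omega>)\<^sup>2)"
  proof (rule AE_I2)
    fix \<omega>
    have "(\<lambda>u. indicator {a..a} u *\<^sub>R (H u \<omega>)\<^sup>2) = (\<lambda>u. indicator {a} u * (H a \<omega>)\<^sup>2)"
      by (auto simp: indicator_def)
    then show "set_integrable lborel {a..a} (\<lambda>u. (H u \<omega>)\<^sup>2)"
      by (simp add: set_integrable_def)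
  qed
qed auto

text \<open>Bounded derivatives make the new coefficients integrable along every good path, so no
  localisation enters. The Lipschitz condition on \<open>f''\<close> takes the place of a bounded
  third derivative in the Taylor remainder.\<close>

theorem ito_formula:
  fixes f f' f'' :: "real \<Rightarrow> real"
  assumes X: "has_differential M F W a X b s" and a: "0 \<le> a"
    and f: "\<And>x. (f has_real_derivative f' x) (at x)" "\<And>x. (f' has_real_derivative f'' x) (at x)"
    and bnd: "\<And>x. \<bar>f' x\<bar> \<le> B" "\<And>x. \<bar>f'' x\<bar> \<le> B" "\<And>x y. \<bar>f'' x - f'' y\<bar> \<le> B * \<bar>x - y\<bar>"
  shows "has_differential M F W a (\<lambda>t \<omega>. f (X t \<omega>))
    (\<lambda>t \<omega>. f' (X t \<omega>) * b t \<omega> + f'' (X t \<omega>) * (s t \<omega>)\<^sup>2 / 2) (\<lambda>t \<omega>. f' (X t \<omega>) * s t \<omega>)"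
proof -
  have B: "0 \<le> B" using bnd(1)[of 0] by simp
  have pX: "progressive F {a..} X" and pb: "progressive F {a..} b" and ps: "progressive F {a..} s"
    and cX: "AE \<omega> in M. continuous_on {a..} (\<lambda>t. X t \<omega>)"
    and ib: "AE \<omega> in M. \<forall>t\<ge>a. set_integrable lborel {a..t} (\<lambda>u. b u \<omega>)"
    and iss: "AE \<omega> in M. \<forall>t\<ge>a. set_integrable lborel {a..t} (\<lambda>u. (s u \<omega>)\<^sup>2)"
    using X by (auto simp: has_differential_def)
  have cf: "continuous_on UNIV f"
    using f(1) by (meson DERIV_continuous_on has_field_derivative_at_within)
  have cf': "continuous_on UNIV f'"
    using f(2) by (meson DERIV_continuous_on has_field_derivative_at_within)
  have cf'': "continuous_on UNIV f''"
    by (rule lipschitz_on_continuous_on[of B UNIV f''])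
       (use bnd(3) B in \<open>auto simp: lipschitz_on_def dist_real_def\<close>)
  have [measurable]: "f \<in> borel_measurable borel" "f' \<in> borel_measurable borel" "f'' \<in> borel_measurable borel"
    using borel_measurable_continuous_onI cf cf' cf'' by auto
  have 1: "progressive F {a..} (\<lambda>t \<omega>. f (X t \<omega>))"
    "progressive F {a..} (\<lambda>t \<omega>. f' (X t \<omega>) * b t \<omega> + f'' (X t \<omega>) * (s t \<omega>)\<^sup>2 / 2)"
    "progressive F {a..} (\<lambda>t \<omega>. f' (X t \<omega>) * s t \<omega>)"
  proof -
    have g: "progressive F {a..} (\<lambda>t \<omega>. f (X t \<omega>))" "progressive F {a..} (\<lambda>t \<omega>. f' (X t \<omega>))"
        "progressive F {a..} (\<lambda>t \<omega>. f'' (X t \<omega>))" "progressive F {a..} (\<lambda>t \<omega>. (s t \<omega>)\<^sup>2 / 2)"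
      using progressive_compose[OF pX, of f] progressive_compose[OF pX, of f'] progressive_compose[OF pX, of f'']
        progressive_compose[OF ps, of "\<lambda>x. x\<^sup>2 / 2"] by simp_all
    show "progressive F {a..} (\<lambda>t \<omega>. f (X t \<omega>))"
      "progressive F {a..} (\<lambda>t \<omega>. f' (X t \<omega>) * b t \<omega> + f'' (X t \<omega>) * (s t \<omega>)\<^sup>2 / 2)"
      "progressive F {a..} (\<lambda>t \<omega>. f' (X t \<omega>) * s t \<omega>)"
      using progressive_add[OF progressive_times[OF g(2) pb] progressive_times[OF g(3,4)]]
        progressive_times[OF g(2) ps] g(1) by simp_all
  qed
  have 2: "AE \<omega> in M. continuous_on {a..} (\<lambda>t. f (X t \<omega>))"
    using cX by eventually_elim (rule continuous_on_compose2[OF cf], auto)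
  have both: "AE \<omega> in M. \<forall>t\<ge>a. set_integrable lborel {a..t} (\<lambda>u. f' (X u \<omega>) * b u \<omega> + f'' (X u \<omega>) * (s u \<omega>)\<^sup>2 / 2)
      \<and> set_integrable lborel {a..t} (\<lambda>u. (f' (X u \<omega>) * s u \<omega>)\<^sup>2)"
    using cX ib iss
  proof (eventually_elim, intro allI impI conjI)
    fix \<omega> t assume c: "continuous_on {a..} (\<lambda>t. X t \<omega>)" and t: "a \<le> t"
      and ib: "\<forall>t\<ge>a. set_integrable lborel {a..t} (\<lambda>u. b u \<omega>)"
      and iss: "\<forall>t\<ge>a. set_integrable lborel {a..t} (\<lambda>u. (s u \<omega>)\<^sup>2)"
    have "continuous_on {a..t} (\<lambda>t. X t \<omega>)" using c by (rule continuous_on_subset) auto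
    then have g: "continuous_on {a..t} (\<lambda>u. f' (X u \<omega>))" "continuous_on {a..t} (\<lambda>u. f'' (X u \<omega>))"
      by (auto intro: continuous_on_compose2[OF cf'] continuous_on_compose2[OF cf''])
    have "set_integrable lborel {a..t} (\<lambda>u. f' (X u \<omega>) * b u \<omega>)"
      by (rule set_integrable_bounded_mult[OF _ set_borel_measurable_continuous[OF g(1)] bnd(1)]) (use ib t in auto)
    moreover have "set_integrable lborel {a..t} (\<lambda>u. f'' (X u \<omega>) * (s u \<omega>)\<^sup>2)"
      by (rule set_integrable_bounded_mult[OF _ set_borel_measurable_continuous[OF g(2)] bnd(2)]) (use iss t in auto)
    ultimately show "set_integrable lborel {a..t} (\<lambda>u. f' (X u \<omega>) * b u \<omega> + f'' (X u \<omega>) * (s u \<omega>)\<^sup>2 / 2)"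
      by (intro set_integral_add(1)) auto
    have "set_integrable lborel {a..t} (\<lambda>u. (f' (X u \<omega>))\<^sup>2 * (s u \<omega>)\<^sup>2)"
    proof (rule set_integrable_bounded_mult)
      show "set_borel_measurable lborel {a..t} (\<lambda>u. (f' (X u \<omega>))\<^sup>2)"
        by (intro set_borel_measurable_continuous continuous_on_power g)
      show "\<bar>(f' (X u \<omega>))\<^sup>2\<bar> \<le> B\<^sup>2" for u
        using power_mono[OF bnd(1)[of "X u \<omega>"], of 2] by simp
    qed (use iss t in auto)
    then show "set_integrable lborel {a..t} (\<lambda>u. (f' (X u \<omega>) * s u \<omega>)\<^sup>2)"
      by (simp add: power_mult_distrib)
  qed
  have 3: "AE \<omega> in M. \<forall>t\<ge>a. set_integrable lborel {a..t} (\<lambda>u. f' (X u \<omega>) * b u \<omega> + f'' (X u \<omega>) * (s u \<omega>)\<^sup>2 / 2)"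
    and 4: "AE \<omega> in M. \<forall>t\<ge>a. set_integrable lborel {a..t} (\<lambda>u. (f' (X u \<omega>) * s u \<omega>)\<^sup>2)"
    using both by auto
  have 5: "has_ito_integral M F W (\<lambda>t \<omega>. f' (X t \<omega>) * s t \<omega>) a t
      (\<lambda>\<omega>. f (X t \<omega>) - f (X a \<omega>) - (LINT u:{a..t}|lborel. f' (X u \<omega>) * b u \<omega> + f'' (X u \<omega>) * (s u \<omega>)\<^sup>2 / 2))"
    if t: "a \<le> t" for t
  proof (cases "a = t")
    case True
    then show ?thesis
      using has_ito_integral_degenerate[OF progressive_subset[OF 1(3), of "{a..a}"] a] by simp
  next
    case False
    have XM: "X r \<in> borel_measurable M" if "a \<le> r" for r
      by (rule measurable_F_M[OF progressive_adapted[OF pX]]) (use that in simp)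
    show ?thesis
    proof (rule ito_formula_integral[OF X a _ f bnd _ _ _ refl])
      show "a < t" using t False by simp
      show "progressive F {a..t} (\<lambda>t \<omega>. f' (X t \<omega>) * s t \<omega>)"
        by (rule progressive_subset[OF 1(3)]) auto
      show "AE \<omega> in M. set_integrable lborel {a..t} (\<lambda>u. (f' (X u \<omega>) * s u \<omega>)\<^sup>2)"
        using 4 by eventually_elim (use t in simp)
      have "(\<lambda>\<omega>. LINT u:{a..t}|lborel. f' (X u \<omega>) * b u \<omega> + f'' (X u \<omega>) * (s u \<omega>)\<^sup>2 / 2) \<in> borel_measurable M"
        by (rule measurable_F_M[OF progressive_path_integral[OF 1(2) _ t]]) auto
      then show "(\<lambda>\<omega>. f (X t \<omega>) - f (X a \<omega>) - (LINT u:{a..t}|lborel. f' (X u \<omega>) * b u \<omega> + f'' (X u \<omega>) * (s u \<omega>)\<^sup>2 / 2)) \<in> borel_measurable M"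
        using XM[OF t] XM[OF order_refl] by measurable
    qed
  qed
  show ?thesis
    unfolding has_differential_def using 1 2 3 4 5 by blast
qed

end

section \<open>A maximal inequality and limits of Ito integrals\<close>

context wiener_space
begin

text \<open>The weights switch the increments off as soon as the process has left the interval
  \<open>[- c, c]\<close>, so that the weighted sum stays at the first value outside.\<close>

lemma maximal_inequality:
  assumes H: "\<And>r. r \<in> {a..T} \<Longrightarrow> has_ito_integral M F W H a r (J r)"
    and JF: "\<And>r. r \<in> {a..T} \<Longrightarrow> J r \<in> borel_measurable (F r)"
    and J0: "\<And>\<omega>. J a \<omega> = 0"
    and a: "0 \<le> a" "a \<le> T" and N: "0 < N" and cd: "0 < c" "0 < d"
  shows "prob {\<omega> \<in> space M. \<exists>k\<le>N. c < \<bar>J (grid a T N k) \<omega>\<bar>} \<le>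
    d + prob_norm M (\<lambda>\<omega>. 2 * (1 / c\<^sup>2) * (LINT u:{a..T}|lborel. (H u \<omega>)\<^sup>2) / d)"
proof -
  define p where "p = grid a T N"
  have m: "mono p" unfolding p_def using a(2) by (rule grid_mono)
  have p0: "p 0 = a" and pN: "p N = T" using N by (simp_all add: p_def)
  have pin: "p j \<in> {a..T}" if "j \<le> N" for j unfolding p_def using a(2) N that by (intro grid_in) auto
  \<comment> \<open>The test includes time \<open>j\<close> itself: the increment that leaves the
    interval is still counted, and everything after it is switched off.\<close>
  define w where "w j \<omega> = (if \<forall>i\<in>{..j}. \<bar>J (p i) \<omega>\<bar> \<le> c then 1 / c else 0)" for j \<omega>
  have JM: "J (p j) \<in> borel_measurable M" if "j \<le> N" for j
    by (rule measurable_F_M[OF JF[OF pin[OF that]]])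
  have wF: "w j \<in> borel_measurable (F (p j))" if "j < N" for j
  proof -
    have "J (p i) \<in> borel_measurable (F (p j))" if "i \<in> {..j}" for i
      by (rule measurable_F_mono[OF monoD[OF m]  JF[OF pin]]) (use that \<open>j < N\<close> in auto)
    then have "Measurable.pred (F (p j)) (\<lambda>\<omega>. \<forall>i\<in>{..j}. \<bar>J (p i) \<omega>\<bar> \<le> c)"
      by (intro pred_intros_finite) (auto intro!: borel_measurable_le borel_measurable_abs)
    then show ?thesis unfolding w_def[abs_def] by (intro measurable_If) auto
  qed
  define Z where "Z \<omega> = (\<Sum>j<N. w j \<omega> * (J (p (Suc j)) \<omega> - J (p j) \<omega>))\<^sup>2" for \<omega>
  have ZM: "Z \<in> borel_measurable M"
    unfolding Z_def[abs_def]
    by (intro borel_measurable_power borel_measurable_sum borel_measurable_times borel_measurable_diff JM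
        measurable_F_M[OF wF]) auto
  define E where "E = {\<omega> \<in> space M. \<exists>k\<le>N. c < \<bar>J (p k) \<omega>\<bar>}"
  have EM: "E \<in> sets M"
  proof -
    have "E = (\<Union>k\<in>{..N}. {\<omega> \<in> space M. c < \<bar>J (p k) \<omega>\<bar>})" by (auto simp: E_def)
    moreover have "{\<omega> \<in> space M. c < \<bar>J (p k) \<omega>\<bar>} \<in> sets M" if "k \<le> N" for k
      using JM[OF that] by measurable
    ultimately show ?thesis by (auto intro!: sets.finite_UN)
  qed
  \<comment> \<open>The weighted sum telescopes from the value 0 at \<open>a\<close> to the first
    value outside the interval, divided by \<open>c\<close>.\<close>
  have Z1: "1 \<le> Z \<omega>" if "\<omega> \<in> E" for \<omega>
  proof -
    define k where "k = (LEAST k. c < \<bar>J (p k) \<omega>\<bar>)"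
    from that obtain l where l: "l \<le> N" "c < \<bar>J (p l) \<omega>\<bar>" by (auto simp: E_def)
    have k: "c < \<bar>J (p k) \<omega>\<bar>" unfolding k_def by (rule LeastI[of "\<lambda>k. c < \<bar>J (p k) \<omega>\<bar>", OF l(2)])
    have kN: "k \<le> N" using Least_le[of "\<lambda>k. c < \<bar>J (p k) \<omega>\<bar>", OF l(2)] l(1) by (simp add: k_def)
    have before: "\<bar>J (p i) \<omega>\<bar> \<le> c" if "i < k" for i
      using not_less_Least[of i "\<lambda>k. c < \<bar>J (p k) \<omega>\<bar>"] that by (simp add: k_def not_less)
    have "(\<Sum>j<N. w j \<omega> * (J (p (Suc j)) \<omega> - J (p j) \<omega>)) = (\<Sum>j<k. 1 / c * (J (p (Suc j)) \<omega> - J (p j) \<omega>))"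
    proof (rule sum.mono_neutral_cong_right)
      show "\<forall>j\<in>{..<N} - {..<k}. w j \<omega> * (J (p (Suc j)) \<omega> - J (p j) \<omega>) = 0"
      proof
        fix j assume "j \<in> {..<N} - {..<k}"
        then have "k \<in> {..j}" by auto
        with k have "w j \<omega> = 0" unfolding w_def by (meson not_less)
        then show "w j \<omega> * (J (p (Suc j)) \<omega> - J (p j) \<omega>) = 0" by simp
      qed
      show "w j \<omega> * (J (p (Suc j)) \<omega> - J (p j) \<omega>) = 1 / c * (J (p (Suc j)) \<omega> - J (p j) \<omega>)" if "j \<in> {..<k}" for j
        using before that by (simp add: w_def)
    qed (use kN in auto)
    also have "\<dots> = J (p k) \<omega> / c"
      unfolding sum_distrib_left[symmetric]
      by (subst sum_lessThan_telescope) (simp add: p0 J0)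
    finally have "Z \<omega> = (J (p k) \<omega> / c)\<^sup>2" by (simp add: Z_def)
    moreover have "1 \<le> \<bar>J (p k) \<omega> / c\<bar>" using k cd by (simp add: field_simps)
    then have "1 \<le> \<bar>J (p k) \<omega> / c\<bar>\<^sup>2" by (rule one_le_power)
    ultimately show ?thesis by (simp only: power2_abs)
  qed
  then have Z1: "1 \<le> \<bar>Z \<omega>\<bar>" if "\<omega> \<in> E" for \<omega>
    using that abs_ge_self order_trans by blast
  have "prob E = (\<integral>\<omega>. indicator E \<omega> \<partial>M)" using EM by simp
  also have "\<dots> \<le> prob_norm M Z"
    unfolding prob_norm_def using EM Z1
    by (intro integral_mono prob_norm_integrable ZM integrable_real_indicator)
       (auto simp: less_top[symmetric] split: split_indicator intro: min.boundedI)
  also have "prob_norm M Z \<le> d + prob_norm M (\<lambda>\<omega>. 2 * (1 / c\<^sup>2) * (LINT u:{a..T}|lborel. (H u \<omega>)\<^sup>2) / d)"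
  proof -
    have wb: "\<bar>w j \<omega>\<bar> \<le> 1 / c" "(w j \<omega>)\<^sup>2 \<le> 1 / c\<^sup>2" for j \<omega>
      using cd by (auto simp: w_def power_divide)
    \<comment> \<open>With \<eta> = 0 the error of a cell is the plain increment of
      \<open>J\<close>, and the mean square distance becomes the integral of the square of
      \<open>H\<close>.\<close>
    have "prob_norm M (\<lambda>\<omega>. \<Sum>i\<in>{0::nat}. (\<Sum>j<N. w j \<omega> * (J (p (Suc j)) \<omega> - J (p j) \<omega> - 0 * (W (p (Suc j)) \<omega> - W (p j) \<omega>)))\<^sup>2)
      \<le> d + prob_norm M (\<lambda>\<omega>. 2 * (1 / c\<^sup>2) * (LINT u:{a..T}|lborel. (step p N (\<lambda>j. 0) u - H u \<omega>)\<^sup>2) / d)"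
      by (rule increment_error_inequality[OF H m p0 pN a(1), where B=0 and B'="1 / c"])
         (use cd wF wb in auto)
    then show ?thesis by (simp add: Z_def[abs_def] step_def)
  qed
  finally show ?thesis by (simp add: E_def p_def)
qed

text \<open>A diagonal argument: for each \<open>n\<close> pick one simple process that is within
  \<open>inverse (real (Suc n))\<close> of \<open>H n\<close> and whose integral is that close to
  \<open>I n\<close>, both in the sense of \<open>prob_norm\<close>.\<close>

lemma has_ito_integral_limit:
  assumes Hn: "\<And>n. has_ito_integral M F W (H n) a t (I n)"
    and H0: "progressive F {a..t} H0" and at: "0 \<le> a" "a \<le> t"
    and sq: "AE \<omega> in M. set_integrable lborel {a..t} (\<lambda>u. (H0 u \<omega>)\<^sup>2)"
    and I0: "I0 \<in> borel_measurable M"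
    and L: "AE \<omega> in M. (\<lambda>n. LINT u:{a..t}|lborel. (H n u \<omega> - H0 u \<omega>)\<^sup>2) \<longlonglongrightarrow> 0"
    and IL: "AE \<omega> in M. (\<lambda>n. I n \<omega>) \<longlonglongrightarrow> I0 \<omega>"
  shows "has_ito_integral M F W H0 a t I0"
proof -
  have pH: "progressive F {a..t} (H n)" and IM[measurable]: "I n \<in> borel_measurable M" for n
    using Hn[of n] by (auto simp: has_ito_integral_def tendsto_in_prob_def)
  note I0[measurable]
  have "\<exists>hs. simple_on F a t hs \<and>
      prob_norm M (\<lambda>\<omega>. LINT u:{a..t}|lborel. (simple_process hs u \<omega> - H n u \<omega>)\<^sup>2) < inverse (real (Suc n)) \<and>
      prob_norm M (\<lambda>\<omega>. simple_integral W hs \<omega> - I n \<omega>) < inverse (real (Suc n))" for n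
  proof -
    have p: "0 < inverse (real (Suc n))" by simp
    obtain hs where hs: "\<And>k. simple_on F a t (hs k)"
      and 1: "tendsto_in_prob M (\<lambda>k \<omega>. LINT u:{a..t}|lborel. (simple_process (hs k) u \<omega> - H n u \<omega>)\<^sup>2) (\<lambda>_. 0)"
      and 2: "tendsto_in_prob M (\<lambda>k. simple_integral W (hs k)) (I n)"
      using Hn[of n] by (auto simp: has_ito_integral_def)
    have "\<forall>\<^sub>F k in sequentially. prob_norm M (\<lambda>\<omega>. LINT u:{a..t}|lborel. (simple_process (hs k) u \<omega> - H n u \<omega>)\<^sup>2) < inverse (real (Suc n))"
      using order_tendstoD(2)[OF tendsto_in_prob_diff_0[OF 1] p] by simp
    from eventually_conj[OF this order_tendstoD(2)[OF tendsto_in_prob_diff_0[OF 2] p]]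
    obtain k where "prob_norm M (\<lambda>\<omega>. LINT u:{a..t}|lborel. (simple_process (hs k) u \<omega> - H n u \<omega>)\<^sup>2) < inverse (real (Suc n))"
      "prob_norm M (\<lambda>\<omega>. simple_integral W (hs k) \<omega> - I n \<omega>) < inverse (real (Suc n))"
      by (auto dest!: eventually_happens'[OF sequentially_bot])
    then show ?thesis using hs by blast
  qed
  then obtain hs where hs: "\<And>n. simple_on F a t (hs n)"
    and h1: "\<And>n. prob_norm M (\<lambda>\<omega>. LINT u:{a..t}|lborel. (simple_process (hs n) u \<omega> - H n u \<omega>)\<^sup>2) < inverse (real (Suc n))"
    and h2: "\<And>n. prob_norm M (\<lambda>\<omega>. simple_integral W (hs n) \<omega> - I n \<omega>) < inverse (real (Suc n))"
    using choice[of "\<lambda>n hs. simple_on F a t hs \<and>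
      prob_norm M (\<lambda>\<omega>. LINT u:{a..t}|lborel. (simple_process hs u \<omega> - H n u \<omega>)\<^sup>2) < inverse (real (Suc n)) \<and>
      prob_norm M (\<lambda>\<omega>. simple_integral W hs \<omega> - I n \<omega>) < inverse (real (Suc n))"] by blast
  define X where "X n \<omega> = (LINT u:{a..t}|lborel. (simple_process (hs n) u \<omega> - H n u \<omega>)\<^sup>2)" for n \<omega>
  define Y where "Y n \<omega> = (LINT u:{a..t}|lborel. (H n u \<omega> - H0 u \<omega>)\<^sup>2)" for n \<omega>
  define Z where "Z n \<omega> = (LINT u:{a..t}|lborel. (simple_process (hs n) u \<omega> - H0 u \<omega>)\<^sup>2)" for n \<omega>
  have [measurable]: "X n \<in> borel_measurable M" "Z n \<in> borel_measurable M" for n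
    unfolding X_def[abs_def] Z_def[abs_def] using at(2)
    by (auto intro!: distance_measurable[OF pH] distance_measurable[OF H0] simple_process_measurable_pair[OF hs])
  have YM[measurable]: "Y n \<in> borel_measurable M" for n
  proof -
    \<comment> \<open>\<open>H n\<close> is jointly measurable on the whole line only after
      multiplication by the indicator, which leaves the integral over \<open>{a..t}\<close>
      unchanged.\<close>
    have "(\<lambda>\<omega>. LINT u:{a..t}|lborel. (indicator {a..t} u * H n u \<omega> - H0 u \<omega>)\<^sup>2) \<in> borel_measurable M"
      by (rule distance_measurable[OF H0 order_refl at(2) progressive_joint_M[OF pH order_refl at(2)]])
    moreover have "(LINT u:{a..t}|lborel. (indicator {a..t} u * H n u \<omega> - H0 u \<omega>)\<^sup>2) = Y n \<omega>" for \<omega>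
      unfolding Y_def by (rule set_lebesgue_integral_cong) auto
    ultimately show ?thesis by simp
  qed
  have ZXY: "AE \<omega> in M. 0 \<le> Z n \<omega> \<and> Z n \<omega> \<le> 2 * X n \<omega> + 2 * Y n \<omega>" for n
    using sq has_ito_integral_square_integrable[OF Hn[of n] at(2)] AE_space
  proof eventually_elim
    case (elim \<omega>)
    have "square_integrable_on (\<lambda>u. H0 u \<omega>) {a..t}"
      using elim(1) progressive_path_measurable[OF H0 order_refl at(2) elim(3)] by (simp add: square_integrable_on_def)
    then show ?case
      unfolding X_def Y_def Z_def
      by (intro conjI set_integral_square_nonneg mean_square_triangle elim simple_process_square_integrable[OF hs])
  qed
  have X0: "(\<lambda>n. prob_norm M (X n)) \<longlonglongrightarrow> 0"
    by (rule tendsto_sandwich[OF _ _ tendsto_const LIMSEQ_inverse_real_of_nat])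
       (use h1 prob_norm_nonneg in \<open>auto simp: X_def[abs_def] intro!: always_eventually less_imp_le\<close>)
  have Y0: "(\<lambda>n. prob_norm M (Y n)) \<longlonglongrightarrow> 0"
    by (rule prob_norm_tendsto_0_AE) (use L in \<open>auto simp: Y_def\<close>)
  have "(\<lambda>n. prob_norm M (Z n)) \<longlonglongrightarrow> 0"
    by (rule prob_norm_combination_tendsto_0[OF _ _ _ X0 Y0 ZXY]) measurable
  then have Zp: "tendsto_in_prob M Z (\<lambda>_. 0)"
    by (subst tendsto_in_prob_iff_prob_norm) auto
  have sI[measurable]: "simple_integral W (hs n) \<in> borel_measurable M" for n
    by (rule simple_integral_measurable[OF hs at(1)])
  have "(\<lambda>n. prob_norm M (\<lambda>\<omega>. simple_integral W (hs n) \<omega> - I n \<omega>)) \<longlonglongrightarrow> 0"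
    by (rule tendsto_sandwich[OF _ _ tendsto_const LIMSEQ_inverse_real_of_nat])
       (use h2 prob_norm_nonneg in \<open>auto intro!: always_eventually less_imp_le\<close>)
  moreover have "(\<lambda>n. prob_norm M (\<lambda>\<omega>. I n \<omega> - I0 \<omega>)) \<longlonglongrightarrow> 0"
    by (intro tendsto_in_prob_diff_0 tendsto_in_prob_AE IM I0 IL)
  ultimately have "(\<lambda>n. prob_norm M (\<lambda>\<omega>. (simple_integral W (hs n) \<omega> - I n \<omega>) + (I n \<omega> - I0 \<omega>))) \<longlonglongrightarrow> 0"
    by (intro prob_norm_add_tendsto_0) measurable
  then have Ip: "tendsto_in_prob M (\<lambda>n. simple_integral W (hs n)) I0"
    by (subst tendsto_in_prob_iff_prob_norm) auto
  show ?thesis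
    unfolding has_ito_integral_def using H0 sq hs Zp Ip by (auto simp: Z_def[abs_def])
qed

end

section \<open>The regularised logarithm\<close>

text \<open>The point of this regularisation is that \<open>x * rlog' e x\<close> and \<open>x\<^sup>2 * rlog'' e x\<close> are bounded
  uniformly in \<open>e\<close>, while \<open>rlog e 0\<close> tends to \<open>- \<infinity>\<close> as \<open>e\<close> tends to \<open>0\<close>.\<close>

definition rlog :: "real \<Rightarrow> real \<Rightarrow> real" where "rlog e x = ln (x\<^sup>2 + e\<^sup>2) / 2"
definition rlog' :: "real \<Rightarrow> real \<Rightarrow> real" where "rlog' e x = x / (x\<^sup>2 + e\<^sup>2)"
definition rlog'' :: "real \<Rightarrow> real \<Rightarrow> real" where "rlog'' e x = (e\<^sup>2 - x\<^sup>2) / (x\<^sup>2 + e\<^sup>2)\<^sup>2"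

text \<open>This is \<open>x * rlog' e x\<close>. Through it the coefficients of the regularised
  logarithm are those of the logarithm damped by factors that approach the true ones as
  \<open>e\<close> tends to 0, provided \<open>x\<close> is not 0.\<close>

definition rweight :: "real \<Rightarrow> real \<Rightarrow> real" where "rweight e x = x\<^sup>2 / (x\<^sup>2 + e\<^sup>2)"

lemma rweight_bounds: "0 \<le> rweight e x" "rweight e x \<le> 1"
proof -
  \<comment> \<open>In the second alternative \<open>x\<close> and \<open>e\<close> are 0, and
    division by zero makes the weight 0.\<close>
  have "0 < x\<^sup>2 + e\<^sup>2 \<or> x\<^sup>2 + e\<^sup>2 = 0" using order_le_less[of 0 "x\<^sup>2 + e\<^sup>2"] by auto
  then show "0 \<le> rweight e x" "rweight e x \<le> 1"
    by (auto simp: rweight_def divide_le_eq_1)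
qed

context
  fixes e :: real assumes e: "0 < e"
begin

lemma rlog_denominator_pos: "0 < x\<^sup>2 + e\<^sup>2" using e by (simp add: add_nonneg_pos)

lemma rlog'_mult: "rlog' e x * (x * y) = rweight e x * y"
  by (simp add: rlog'_def rweight_def power2_eq_square)

text \<open>The second order coefficient is a polynomial in the weight. It equals -1 at weight 1,
  which yields the Ito correction of the logarithm in the limit.\<close>

lemma rlog''_mult: "rlog'' e x * (x * y)\<^sup>2 = rweight e x * (1 - 2 * rweight e x) * y\<^sup>2"
proof -
  have "rlog'' e x * x\<^sup>2 = rweight e x * (1 - 2 * rweight e x)"
  proof -
    define r where "r = x\<^sup>2 + e\<^sup>2"
    have r: "0 < r" using rlog_denominator_pos by (simp add: r_def)
    have "1 - 2 * rweight e x = (r - 2 * x\<^sup>2) / r"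
      using r by (simp add: rweight_def r_def[symmetric] diff_divide_distrib)
    also have "r - 2 * x\<^sup>2 = e\<^sup>2 - x\<^sup>2" by (simp add: r_def)
    finally have eq: "1 - 2 * rweight e x = (e\<^sup>2 - x\<^sup>2) / r" .
    show ?thesis
      unfolding eq by (simp add: rlog''_def rweight_def r_def[symmetric] power2_eq_square[of r])
  qed
  then show ?thesis by (metis mult.assoc power_mult_distrib)
qed

lemma rlog_deriv: "(rlog e has_real_derivative rlog' e x) (at x)"
proof -
  have "((\<lambda>x. x\<^sup>2 + e\<^sup>2) has_real_derivative 2 * x) (at x)"
    by (auto intro!: derivative_eq_intros)
  from DERIV_cdivide[OF DERIV_chain2[OF DERIV_ln[OF rlog_denominator_pos] this], of 2]
  have "((\<lambda>x. ln (x\<^sup>2 + e\<^sup>2) / 2) has_real_derivative inverse (x\<^sup>2 + e\<^sup>2) * (2 * x) / 2) (at x)" .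
  moreover have "inverse q * (2 * x) / 2 = x / q" for q :: real
    by (cases "q = 0") (auto simp: field_simps)
  then have "inverse (x\<^sup>2 + e\<^sup>2) * (2 * x) / 2 = rlog' e x" unfolding rlog'_def .
  ultimately show ?thesis by (simp add: rlog_def[abs_def])
qed

lemma rlog'_deriv: "(rlog' e has_real_derivative rlog'' e x) (at x)"
proof -
  have "((\<lambda>x. x / (x\<^sup>2 + e\<^sup>2)) has_real_derivative (1 * (x\<^sup>2 + e\<^sup>2) - x * (2 * x)) / ((x\<^sup>2 + e\<^sup>2) * (x\<^sup>2 + e\<^sup>2))) (at x)"
    using rlog_denominator_pos[of x] by (auto intro!: derivative_eq_intros)
  also have "1 * (x\<^sup>2 + e\<^sup>2) - x * (2 * x) = e\<^sup>2 - x\<^sup>2" by (simp add: power2_eq_square)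
  finally show ?thesis by (simp add: rlog'_def[abs_def] rlog''_def power2_eq_square)
qed

lemma rlog''_deriv: "(rlog'' e has_real_derivative 2 * x * (x\<^sup>2 - 3 * e\<^sup>2) / (x\<^sup>2 + e\<^sup>2) ^ 3) (at x)"
proof -
  define r where "r = x\<^sup>2 + e\<^sup>2"
  have r: "0 < r" using rlog_denominator_pos by (simp add: r_def)
  have "((\<lambda>x. (e\<^sup>2 - x\<^sup>2) / (x\<^sup>2 + e\<^sup>2)\<^sup>2) has_real_derivative
      ((- 2 * x) * r\<^sup>2 - (e\<^sup>2 - x\<^sup>2) * (2 * r * (2 * x))) / (r\<^sup>2 * r\<^sup>2)) (at x)"
    using r unfolding r_def by (auto intro!: derivative_eq_intros)
  also have "((- 2 * x) * r\<^sup>2 - (e\<^sup>2 - x\<^sup>2) * (2 * r * (2 * x))) / (r\<^sup>2 * r\<^sup>2) = ((- 2 * x) * r - (e\<^sup>2 - x\<^sup>2) * (4 * x)) / r ^ 3"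
    using r by (simp add: field_simps power2_eq_square power3_eq_cube)
  also have "(- 2 * x) * r - (e\<^sup>2 - x\<^sup>2) * (4 * x) = 2 * x * (x\<^sup>2 - 3 * e\<^sup>2)"
    by (simp add: r_def algebra_simps power2_eq_square)
  finally show ?thesis unfolding rlog''_def[abs_def] r_def .
qed

lemma rlog_bounds:
  obtains B where "\<And>x. \<bar>rlog' e x\<bar> \<le> B" "\<And>x. \<bar>rlog'' e x\<bar> \<le> B" "\<And>x y. \<bar>rlog'' e x - rlog'' e y\<bar> \<le> B * \<bar>x - y\<bar>"
proof -
  \<comment> \<open>The sum of three separate bounds, for the first, second and third derivative. It
    explodes as \<open>e\<close> tends to 0, but it serves only to license Ito's formula for each
    fixed \<open>e\<close>.\<close>
  define B where "B = 1 / e + 1 / e\<^sup>2 + 6 / e ^ 3"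
  have 1: "\<bar>rlog' e x\<bar> \<le> 1 / e" for x
  proof -
    have "2 * \<bar>x\<bar> * e \<le> x\<^sup>2 + e\<^sup>2" using sum_squares_bound[of "\<bar>x\<bar>" e] by simp
    moreover have "0 \<le> \<bar>x\<bar> * e" using e by simp
    ultimately have "\<bar>x\<bar> * e \<le> x\<^sup>2 + e\<^sup>2" by linarith
    then show ?thesis using rlog_denominator_pos[of x] e by (simp add: rlog'_def field_simps)
  qed
  have r: "1 / (x\<^sup>2 + e\<^sup>2) \<le> 1 / e\<^sup>2" for x
    using e rlog_denominator_pos[of x] by (intro divide_left_mono) auto
  have 2: "\<bar>rlog'' e x\<bar> \<le> 1 / e\<^sup>2" for x
  proof -
    have "\<bar>e\<^sup>2 - x\<^sup>2\<bar> \<le> x\<^sup>2 + e\<^sup>2" by (simp add: abs_le_iff)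
    then have "\<bar>rlog'' e x\<bar> \<le> (x\<^sup>2 + e\<^sup>2) / (x\<^sup>2 + e\<^sup>2)\<^sup>2"
      unfolding rlog''_def abs_divide using rlog_denominator_pos[of x] by (simp add: divide_right_mono)
    also have "\<dots> = 1 / (x\<^sup>2 + e\<^sup>2)" by (simp add: power2_eq_square)
    finally show ?thesis using r[of x] by simp
  qed
  have 3: "\<bar>2 * x * (x\<^sup>2 - 3 * e\<^sup>2) / (x\<^sup>2 + e\<^sup>2) ^ 3\<bar> \<le> 6 / e ^ 3" for x
  proof -
    define q where "q = x\<^sup>2 + e\<^sup>2"
    have q: "0 < q" using rlog_denominator_pos by (simp add: q_def)
    have "\<bar>x\<^sup>2 - 3 * e\<^sup>2\<bar> \<le> 3 * q" unfolding q_def by (auto simp: abs_le_iff)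
    then have "2 * \<bar>x\<bar> * \<bar>x\<^sup>2 - 3 * e\<^sup>2\<bar> \<le> 2 * \<bar>x\<bar> * (3 * q)" by (intro mult_left_mono) auto
    then have "\<bar>2 * x * (x\<^sup>2 - 3 * e\<^sup>2)\<bar> / q ^ 3 \<le> 2 * \<bar>x\<bar> * (3 * q) / q ^ 3"
      using q by (intro divide_right_mono) (auto simp: abs_mult)
    also have "\<dots> = 6 * (\<bar>x\<bar> / q) * (1 / q)" using q by (simp add: power3_eq_cube)
    also have "\<dots> \<le> 6 * (1 / e) * (1 / e\<^sup>2)"
      using 1[of x] r[of x] q e by (intro mult_mono) (auto simp: rlog'_def q_def)
    also have "\<dots> = 6 / e ^ 3" by (simp add: power3_eq_cube power2_eq_square)
    finally show ?thesis using q by (simp add: q_def abs_mult)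
  qed
  have lip: "\<bar>rlog'' e x - rlog'' e y\<bar> \<le> 6 / e ^ 3 * \<bar>x - y\<bar>" for x y
    using field_differentiable_bound[of UNIV "rlog'' e" "\<lambda>x. 2 * x * (x\<^sup>2 - 3 * e\<^sup>2) / (x\<^sup>2 + e\<^sup>2) ^ 3" "6 / e ^ 3" x y]
      rlog''_deriv 3 by simp
  have le: "1 / e \<le> B" "1 / e\<^sup>2 \<le> B" "6 / e ^ 3 \<le> B" using e by (auto simp: B_def)
  show ?thesis
  proof (rule that[of B])
    show "\<bar>rlog'' e x - rlog'' e y\<bar> \<le> B * \<bar>x - y\<bar>" for x y
      by (rule order_trans[OF lip mult_right_mono[OF le(3)]]) simp
    show "\<bar>rlog' e x\<bar> \<le> B" for x by (rule order_trans[OF 1 le(1)])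
    show "\<bar>rlog'' e x\<bar> \<le> B" for x by (rule order_trans[OF 2 le(2)])
  qed
qed

end

lemma rweight_tendsto_1: "x \<noteq> 0 \<Longrightarrow> (\<lambda>n. rweight (inverse (real (Suc n))) x) \<longlonglongrightarrow> 1"
proof -
  assume x: "x \<noteq> 0"
  have "(\<lambda>n. x\<^sup>2 / (x\<^sup>2 + (inverse (real (Suc n)))\<^sup>2)) \<longlonglongrightarrow> x\<^sup>2 / (x\<^sup>2 + 0\<^sup>2)"
    using x by (intro tendsto_intros LIMSEQ_inverse_real_of_nat) auto
  then show ?thesis using x by (simp add: rweight_def)
qed

lemma rlog_tendsto_ln: "0 < x \<Longrightarrow> (\<lambda>n. rlog (inverse (real (Suc n))) x) \<longlonglongrightarrow> ln x"
proof -
  assume x: "0 < x"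
  have "(\<lambda>n. ln (x\<^sup>2 + (inverse (real (Suc n)))\<^sup>2) / 2) \<longlonglongrightarrow> ln (x\<^sup>2 + 0\<^sup>2) / 2"
    using x by (intro tendsto_intros LIMSEQ_inverse_real_of_nat) auto
  then show ?thesis using x by (simp add: rlog_def ln_realpow)
qed

section \<open>Positivity and logarithm of stochastic exponentials\<close>

text \<open>The coefficients are prescribed only almost surely: for the portfolio they contain the
  quotient of \<open>S\<close> by itself, which cancels only where \<open>S\<close> is nonzero. The
  locale is used for \<open>S\<close> from time 0 and for \<open>Q\<close> from
  \<open>L\<^sub>2\<close>.\<close>

locale exponential_sde = wiener_space M F W
  for M :: "'a measure" and F :: "real \<Rightarrow> 'a measure" and W :: "real \<Rightarrow> 'a \<Rightarrow> real" +
  fixes a x :: real and X b s \<beta> \<phi> :: "real \<Rightarrow> 'a \<Rightarrow> real"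
  assumes a: "0 \<le> a" and x: "0 < x"
    and X: "has_differential M F W a X b s"
    and \<beta>: "progressive F {a..} \<beta>" and \<phi>: "progressive F {a..} \<phi>"
    and coeff: "AE \<omega> in M. \<forall>t\<ge>a. b t \<omega> = X t \<omega> * \<beta> t \<omega> \<and> s t \<omega> = X t \<omega> * \<phi> t \<omega>"
    and \<beta>_int: "AE \<omega> in M. \<forall>t\<ge>a. set_integrable lborel {a..t} (\<lambda>u. \<beta> u \<omega>)"
    and \<phi>_int: "AE \<omega> in M. \<forall>t\<ge>a. set_integrable lborel {a..t} (\<lambda>u. (\<phi> u \<omega>)\<^sup>2)"
    and X_start: "AE \<omega> in M. X a \<omega> = x"
begin

definition rdrift :: "real \<Rightarrow> real \<Rightarrow> 'a \<Rightarrow> real" where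
  "rdrift e t \<omega> = rlog' e (X t \<omega>) * b t \<omega> + rlog'' e (X t \<omega>) * (s t \<omega>)\<^sup>2 / 2"

definition rdiffusion :: "real \<Rightarrow> real \<Rightarrow> 'a \<Rightarrow> real" where
  "rdiffusion e t \<omega> = rlog' e (X t \<omega>) * s t \<omega>"

text \<open>A version of the Ito integral of \<open>rdiffusion e\<close>, written through the path
  of \<open>X\<close>. It is adapted and exactly 0 at \<open>a\<close>, as
  \<open>maximal_inequality\<close> requires.\<close>

definition rnoise :: "real \<Rightarrow> real \<Rightarrow> 'a \<Rightarrow> real" where
  "rnoise e t \<omega> = rlog e (X t \<omega>) - rlog e (X a \<omega>) - (LINT u:{a..t}|lborel. rdrift e u \<omega>)"

definition regular_path :: "'a \<Rightarrow> bool" where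
  "regular_path \<omega> \<longleftrightarrow> \<omega> \<in> space M \<and> continuous_on {a..} (\<lambda>t. X t \<omega>) \<and>
    (\<forall>t\<ge>a. b t \<omega> = X t \<omega> * \<beta> t \<omega> \<and> s t \<omega> = X t \<omega> * \<phi> t \<omega>) \<and>
    (\<forall>t\<ge>a. set_integrable lborel {a..t} (\<lambda>u. \<beta> u \<omega>)) \<and>
    (\<forall>t\<ge>a. set_integrable lborel {a..t} (\<lambda>u. (\<phi> u \<omega>)\<^sup>2)) \<and> X a \<omega> = x"

lemma AE_regular_path: "AE \<omega> in M. regular_path \<omega>"
proof -
  have "AE \<omega> in M. continuous_on {a..} (\<lambda>t. X t \<omega>)" using X by (simp add: has_differential_def)
  with AE_space coeff \<beta>_int \<phi>_int X_start show ?thesis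
    by eventually_elim (simp add: regular_path_def)
qed

lemma X_progressive: "progressive F {a..} X"
  using X by (simp add: has_differential_def)

lemma rlog_differential:
  assumes "0 < e"
  shows "has_differential M F W a (\<lambda>t \<omega>. rlog e (X t \<omega>)) (rdrift e) (rdiffusion e)"
proof -
  obtain B where "\<And>x. \<bar>rlog' e x\<bar> \<le> B" "\<And>x. \<bar>rlog'' e x\<bar> \<le> B" "\<And>x y. \<bar>rlog'' e x - rlog'' e y\<bar> \<le> B * \<bar>x - y\<bar>"
    by (rule rlog_bounds[OF assms]) blast
  from ito_formula[OF X a rlog_deriv[OF assms] rlog'_deriv[OF assms] this]
  show ?thesis by (simp add: rdrift_def[abs_def] rdiffusion_def[abs_def])
qed

lemma rdrift_progressive: "0 < e \<Longrightarrow> progressive F {a..} (rdrift e)"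
  using rlog_differential by (simp add: has_differential_def)

lemma rnoise_ito:
  assumes "0 < e" "a \<le> t"
  shows "has_ito_integral M F W (rdiffusion e) a t (rnoise e t)"
  using has_differential_ito_integral[OF rlog_differential[OF assms(1)] assms(2)]
  by (simp add: rnoise_def[abs_def])

lemma rlog_measurable: "0 < e \<Longrightarrow> rlog e \<in> borel_measurable borel"
  unfolding rlog_def[abs_def] by measurable

lemma rnoise_adapted:
  assumes "0 < e" "a \<le> t"
  shows "rnoise e t \<in> borel_measurable (F t)"
proof -
  have "X t \<in> borel_measurable (F t)" "X a \<in> borel_measurable (F a)"
    using assms(2) by (auto intro!: progressive_adapted[OF X_progressive])
  then have "X t \<in> borel_measurable (F t)" "X a \<in> borel_measurable (F t)"
    using measurable_F_mono[OF assms(2)] by auto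
  then show ?thesis
    unfolding rnoise_def[abs_def] using assms
    by (intro borel_measurable_diff progressive_path_integral[OF rdrift_progressive]
        measurable_compose[OF _ rlog_measurable]) auto
qed

lemma rcoefficients:
  assumes "regular_path \<omega>" "0 < e" "a \<le> u"
  shows "rdiffusion e u \<omega> = rweight e (X u \<omega>) * \<phi> u \<omega>"
    and "rdrift e u \<omega> = rweight e (X u \<omega>) * \<beta> u \<omega>
      + rweight e (X u \<omega>) * (1 - 2 * rweight e (X u \<omega>)) * (\<phi> u \<omega>)\<^sup>2 / 2"
proof -
  have c: "b u \<omega> = X u \<omega> * \<beta> u \<omega>" "s u \<omega> = X u \<omega> * \<phi> u \<omega>"
    using assms(1,3) by (auto simp: regular_path_def)
  show "rdiffusion e u \<omega> = rweight e (X u \<omega>) * \<phi> u \<omega>"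
    unfolding rdiffusion_def c by (rule rlog'_mult[OF assms(2)])
  show "rdrift e u \<omega> = rweight e (X u \<omega>) * \<beta> u \<omega>
      + rweight e (X u \<omega>) * (1 - 2 * rweight e (X u \<omega>)) * (\<phi> u \<omega>)\<^sup>2 / 2"
    unfolding rdrift_def c rlog'_mult[OF assms(2)] rlog''_mult[OF assms(2)] ..
qed

lemma rdrift_bound:
  assumes "regular_path \<omega>" "0 < e" "a \<le> u"
  shows "\<bar>rdrift e u \<omega>\<bar> \<le> \<bar>\<beta> u \<omega>\<bar> + (\<phi> u \<omega>)\<^sup>2 / 2"
proof -
  define q where "q = rweight e (X u \<omega>)"
  have q: "0 \<le> q" "q \<le> 1" unfolding q_def by (rule rweight_bounds)+
  have "\<bar>q * (1 - 2 * q)\<bar> \<le> 1 * 1" unfolding abs_mult using q by (intro mult_mono) (auto simp: abs_le_iff)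
  then have "\<bar>q * (1 - 2 * q)\<bar> * ((\<phi> u \<omega>)\<^sup>2 / 2) \<le> 1 * ((\<phi> u \<omega>)\<^sup>2 / 2)" by (intro mult_right_mono) auto
  moreover have "\<bar>q\<bar> * \<bar>\<beta> u \<omega>\<bar> \<le> 1 * \<bar>\<beta> u \<omega>\<bar>" using q by (intro mult_right_mono) auto
  moreover have "\<bar>rdrift e u \<omega>\<bar> \<le> \<bar>q * \<beta> u \<omega>\<bar> + \<bar>q * (1 - 2 * q) * ((\<phi> u \<omega>)\<^sup>2 / 2)\<bar>"
    unfolding rcoefficients(2)[OF assms] q_def[symmetric] using abs_triangle_ineq by (simp add: mult.assoc)
  ultimately show ?thesis by (simp add: abs_mult)
qed

lemma bound_integrable:
  assumes "regular_path \<omega>" "a \<le> t"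
  shows "set_integrable lborel {a..t} (\<lambda>u. \<bar>\<beta> u \<omega>\<bar> + (\<phi> u \<omega>)\<^sup>2 / 2)"
  using assms by (intro set_integral_add(1) set_integrable_abs) (auto simp: regular_path_def)

lemma rdrift_path_measurable:
  assumes "regular_path \<omega>" "0 < e" "a \<le> t"
  shows "set_borel_measurable lborel {a..t} (\<lambda>u. rdrift e u \<omega>)"
  by (rule progressive_path_measurable[OF rdrift_progressive[OF assms(2)] _ assms(3)])
     (use assms in \<open>auto simp: regular_path_def\<close>)

lemma rdrift_integral_bound:
  assumes "regular_path \<omega>" "0 < e" "a \<le> r" "r \<le> t"
  shows "\<bar>LINT u:{a..r}|lborel. rdrift e u \<omega>\<bar> \<le> (LINT u:{a..t}|lborel. \<bar>\<beta> u \<omega>\<bar> + (\<phi> u \<omega>)\<^sup>2 / 2)"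
proof -
  note i = bound_integrable[OF assms(1,3)]
  have D: "set_integrable lborel {a..r} (\<lambda>u. rdrift e u \<omega>)"
    by (rule set_integrable_bound_real[OF i rdrift_path_measurable[OF assms(1-3)]])
       (use rdrift_bound[OF assms(1,2)] abs_ge_self order_trans in fastforce)
  have "\<bar>LINT u:{a..r}|lborel. rdrift e u \<omega>\<bar> \<le> (LINT u:{a..r}|lborel. \<bar>rdrift e u \<omega>\<bar>)"
    using integral_abs_bound[of lborel "\<lambda>u. indicator {a..r} u * rdrift e u \<omega>"]
    by (simp add: set_lebesgue_integral_def abs_mult)
  also have "\<dots> \<le> (LINT u:{a..r}|lborel. \<bar>\<beta> u \<omega>\<bar> + (\<phi> u \<omega>)\<^sup>2 / 2)"
    using rdrift_bound[OF assms(1,2)] by (intro set_integral_mono set_integrable_abs D i) auto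
  also have "\<dots> \<le> (LINT u:{a..t}|lborel. \<bar>\<beta> u \<omega>\<bar> + (\<phi> u \<omega>)\<^sup>2 / 2)"
    by (rule set_integral_nonneg_mono_set[OF bound_integrable[OF assms(1)]]) (use assms in auto)
  finally show ?thesis .
qed

text \<open>If a path reached \<open>0\<close> before \<open>T\<close>, then \<open>rnoise e\<close> would drop below any given level for
  small \<open>e\<close>, uniformly in the drift; the maximal inequality makes this unlikely.\<close>

lemma AE_nonzero:
  assumes aT: "a < T"
  shows "AE \<omega> in M. \<forall>t\<in>{a..T}. X t \<omega> \<noteq> 0"
proof -
  have aT': "a \<le> T" using aT by simp
  \<comment> \<open>At a point where the path is below \<open>\<epsilon> n\<close>, the regularised
    logarithm is at most \<open>ln 2 / 2 - 2 * real (Suc n)\<close>. This lies below the level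
    \<open>- real (Suc n)\<close> by a margin of about \<open>n\<close>, which absorbs drift and
    starting value.\<close>
  define \<epsilon> where "\<epsilon> n = exp (- 2 * real (Suc n))" for n
  have \<epsilon>: "0 < \<epsilon> n" for n by (simp add: \<epsilon>_def)
  define \<Phi> where "\<Phi> \<omega> = (LINT u:{a..T}|lborel. (\<phi> u \<omega>)\<^sup>2)" for \<omega>
  have \<Phi>M[measurable]: "\<Phi> \<in> borel_measurable M"
    unfolding \<Phi>_def[abs_def]
    by (rule measurable_F_M[OF progressive_path_integral[OF progressive_compose[OF \<phi>, of "\<lambda>y. y\<^sup>2"] _ aT']]) auto
  have \<Phi>0: "0 \<le> \<Phi> \<omega>" for \<omega> unfolding \<Phi>_def by (rule set_integral_square_nonneg)
  \<comment> \<open>The grids are dyadic, hence nested, so these events increase with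
    \<open>l\<close>.\<close>
  define A where "A n l = {\<omega> \<in> space M. \<exists>k\<le>2 ^ l. real (Suc n) < \<bar>rnoise (\<epsilon> n) (grid a T (2 ^ l) k) \<omega>\<bar>}" for n l
  have gin: "grid a T (2 ^ l) k \<in> {a..T}" if "k \<le> 2 ^ l" for k l
    using grid_in[OF aT' _ that] by simp
  have AM: "A n l \<in> sets M" for n l
  proof -
    have "A n l = (\<Union>k\<in>{..2 ^ l}. {\<omega> \<in> space M. real (Suc n) < \<bar>rnoise (\<epsilon> n) (grid a T (2 ^ l) k) \<omega>\<bar>})"
      by (auto simp: A_def)
    moreover have "{\<omega> \<in> space M. real (Suc n) < \<bar>rnoise (\<epsilon> n) (grid a T (2 ^ l) k) \<omega>\<bar>} \<in> sets M" if "k \<le> 2 ^ l" for k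
    proof -
      have [measurable]: "rnoise (\<epsilon> n) (grid a T (2 ^ l) k) \<in> borel_measurable M"
        using gin[OF that] by (intro measurable_F_M[OF rnoise_adapted[OF \<epsilon>]]) auto
      show ?thesis by measurable
    qed
    ultimately show ?thesis by (auto intro!: sets.finite_UN)
  qed
  have inc: "incseq (A n)" for n
  proof (rule incseq_SucI, rule subsetI)
    fix l \<omega> assume "\<omega> \<in> A n l"
    then obtain k where k: "\<omega> \<in> space M" "k \<le> 2 ^ l" "real (Suc n) < \<bar>rnoise (\<epsilon> n) (grid a T (2 ^ l) k) \<omega>\<bar>"
      by (auto simp: A_def)
    have "grid a T (2 ^ l) k = grid a T (2 ^ Suc l) (2 * k)" by (simp add: grid_def)
    with k show "\<omega> \<in> A n (Suc l)" unfolding A_def by (auto intro!: exI[of _ "2 * k"])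
  qed
  have S_le: "AE \<omega> in M. (LINT u:{a..T}|lborel. (rdiffusion e u \<omega>)\<^sup>2) \<le> \<Phi> \<omega>" if e: "0 < e" for e
    using AE_regular_path
  proof eventually_elim
    case (elim \<omega>)
    have pm: "set_borel_measurable lborel {a..T} (\<lambda>u. \<phi> u \<omega>)"
      by (rule progressive_path_measurable[OF \<phi> _ aT']) (use elim in \<open>auto simp: regular_path_def\<close>)
    have sq: "square_integrable_on (\<lambda>u. \<phi> u \<omega>) {a..T}"
      using elim aT' pm by (auto simp: regular_path_def square_integrable_on_def)
    have "continuous_on {a..T} (\<lambda>t. X t \<omega>)"
      using elim by (auto simp: regular_path_def intro: continuous_on_subset)
    then have "continuous_on {a..T} (\<lambda>u. rweight e (X u \<omega>))"
      unfolding rweight_def using rlog_denominator_pos[OF e]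
      by (intro continuous_intros) (auto simp: less_imp_neq[symmetric])
    then have "(LINT u:{a..T}|lborel. (rweight e (X u \<omega>) * \<phi> u \<omega>)\<^sup>2) \<le> 1 * \<Phi> \<omega>"
      unfolding \<Phi>_def
      by (intro square_integrable_on_mult_bounded(2)[OF sq] set_borel_measurable_continuous)
         (use rweight_bounds in \<open>auto intro: power_le_one\<close>)
    also have "(LINT u:{a..T}|lborel. (rweight e (X u \<omega>) * \<phi> u \<omega>)\<^sup>2) = (LINT u:{a..T}|lborel. (rdiffusion e u \<omega>)\<^sup>2)"
      by (rule set_lebesgue_integral_cong) (use rcoefficients(1)[OF elim e] in auto)
    finally show ?case by simp
  qed
  have A_le: "prob (A n l) \<le> inverse (real (Suc n)) + prob_norm M (\<lambda>\<omega>. 2 * \<Phi> \<omega> / real (Suc n))" for n l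
  proof -
    have sm: "(\<lambda>\<omega>. LINT u:{a..T}|lborel. (rdiffusion (\<epsilon> n) u \<omega>)\<^sup>2) \<in> borel_measurable M"
    proof -
      have "progressive F {a..} (rdiffusion (\<epsilon> n))"
        using rlog_differential[OF \<epsilon>] by (simp add: has_differential_def)
      from progressive_path_integral[OF progressive_compose[OF this, of "\<lambda>y. y\<^sup>2"] _ aT']
      show ?thesis by (intro measurable_F_M[of _ T]) auto
    qed
    \<comment> \<open>The maximal inequality is used with \<open>c = real (Suc n)\<close> and
      \<open>d\<close> its inverse; the square in the denominator beats the division by
      \<open>d\<close>, and both summands tend to 0.\<close>
    have eq: "2 * (1 / (real (Suc n))\<^sup>2) * y / inverse (real (Suc n)) = 2 * y / real (Suc n)" for y
      by (simp add: power2_eq_square field_simps del: of_nat_Suc)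
    have "prob (A n l) \<le> inverse (real (Suc n)) +
        prob_norm M (\<lambda>\<omega>. 2 * (1 / (real (Suc n))\<^sup>2) * (LINT u:{a..T}|lborel. (rdiffusion (\<epsilon> n) u \<omega>)\<^sup>2) / inverse (real (Suc n)))"
      unfolding A_def
    proof (rule maximal_inequality[OF _ _ _ a aT'])
      show "rnoise (\<epsilon> n) a \<omega> = 0" for \<omega> by (simp add: rnoise_def)
    qed (use \<epsilon> in \<open>auto intro: rnoise_ito rnoise_adapted\<close>)
    also have "prob_norm M (\<lambda>\<omega>. 2 * (1 / (real (Suc n))\<^sup>2) * (LINT u:{a..T}|lborel. (rdiffusion (\<epsilon> n) u \<omega>)\<^sup>2) / inverse (real (Suc n)))
        \<le> prob_norm M (\<lambda>\<omega>. 2 * \<Phi> \<omega> / real (Suc n))"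
      unfolding eq
    proof (rule prob_norm_mono_AE)
      show "AE \<omega> in M. \<bar>2 * (LINT u:{a..T}|lborel. (rdiffusion (\<epsilon> n) u \<omega>)\<^sup>2) / real (Suc n)\<bar> \<le> \<bar>2 * \<Phi> \<omega> / real (Suc n)\<bar>"
        using S_le[OF \<epsilon>[of n]]
      proof eventually_elim
        case (elim \<omega>)
        then show ?case
          using \<Phi>0[of \<omega>] set_integral_square_nonneg[of "{a..T}" "\<lambda>u. rdiffusion (\<epsilon> n) u \<omega>"]
          by (simp add: abs_mult divide_right_mono del: of_nat_Suc)
      qed
      show "(\<lambda>\<omega>. 2 * (LINT u:{a..T}|lborel. (rdiffusion (\<epsilon> n) u \<omega>)\<^sup>2) / real (Suc n)) \<in> borel_measurable M"
        using sm by measurable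
    qed measurable
    finally show ?thesis by simp
  qed
  \<comment> \<open>The bound on \<open>A n l\<close> does not depend on \<open>l\<close>, so
    continuity from below transfers it to the union over all dyadic grids.\<close>
  define A' where "A' n = (\<Union>l. A n l)" for n
  have A'M[measurable]: "A' n \<in> sets M" for n unfolding A'_def using AM by auto
  have A'_le: "prob (A' n) \<le> inverse (real (Suc n)) + prob_norm M (\<lambda>\<omega>. 2 * \<Phi> \<omega> / real (Suc n))" for n
  proof -
    have "(\<lambda>l. prob (A n l)) \<longlonglongrightarrow> prob (A' n)"
      unfolding A'_def by (rule finite_Lim_measure_incseq[OF _ inc]) (use AM in auto)
    then show ?thesis by (rule LIMSEQ_le_const2) (use A_le in auto)
  qed
  \<comment> \<open>For indicators, almost sure convergence to 0 along a subsequence means that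
    almost every path eventually avoids the events \<open>A' (\<rho> n)\<close>.\<close>
  have "(\<lambda>n. prob_norm M (indicator (A' n))) \<longlonglongrightarrow> 0"
  proof (rule tendsto_sandwich[OF _ _ tendsto_const])
    have "(\<lambda>n. prob_norm M (\<lambda>\<omega>. 2 * \<Phi> \<omega> / real (Suc n))) \<longlonglongrightarrow> 0"
    proof (rule prob_norm_tendsto_0_AE)
      have "(\<lambda>n. 2 * \<Phi> \<omega> * inverse (real (Suc n))) \<longlonglongrightarrow> 0" for \<omega>
        by (rule tendsto_mult_right_zero[OF LIMSEQ_inverse_real_of_nat])
      then show "AE \<omega> in M. (\<lambda>n. 2 * \<Phi> \<omega> / real (Suc n)) \<longlonglongrightarrow> 0" by (simp add: divide_inverse)
    qed measurable
    from tendsto_add[OF LIMSEQ_inverse_real_of_nat this]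
    show "(\<lambda>n. inverse (real (Suc n)) + prob_norm M (\<lambda>\<omega>. 2 * \<Phi> \<omega> / real (Suc n))) \<longlonglongrightarrow> 0" by simp
    have "prob_norm M (indicator (A' n)) = prob (A' n)" for n
    proof -
      have "min 1 \<bar>indicator (A' n) \<omega> :: real\<bar> = indicator (A' n) \<omega>" for \<omega> by (auto simp: indicator_def)
      then show ?thesis by (simp add: prob_norm_def)
    qed
    then show "\<forall>\<^sub>F n in sequentially. prob_norm M (indicator (A' n)) \<le> inverse (real (Suc n)) + prob_norm M (\<lambda>\<omega>. 2 * \<Phi> \<omega> / real (Suc n))"
      using A'_le by simp
  qed (use prob_norm_nonneg in auto)
  then obtain \<rho> :: "nat \<Rightarrow> nat" where \<rho>: "strict_mono \<rho>" "AE \<omega> in M. (\<lambda>n. indicator (A' (\<rho> n)) \<omega> :: real) \<longlonglongrightarrow> 0"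
    using prob_norm_subseq[of "\<lambda>n. indicator (A' n)"] by auto
  show ?thesis
    using AE_regular_path \<rho>(2)
  proof eventually_elim
    case (elim \<omega>)
    have \<omega>: "\<omega> \<in> space M" "X a \<omega> = x" using elim by (auto simp: regular_path_def)
    show ?case
    proof (intro ballI notI)
      fix t assume t: "t \<in> {a..T}" and Xt: "X t \<omega> = 0"
      have t': "t \<in> {a<..T}" using t Xt \<omega>(2) x by (cases "t = a") auto
      define R where "R = (LINT u:{a..T}|lborel. \<bar>\<beta> u \<omega>\<bar> + (\<phi> u \<omega>)\<^sup>2 / 2)"
      have "\<forall>\<^sub>F n in sequentially. indicator (A' (\<rho> n)) \<omega> < (1 :: real)"
        by (rule order_tendstoD(2)[OF elim(2)]) simp
      moreover have "\<forall>\<^sub>F n in sequentially. R + 1 - ln x < real n"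
        by (rule filterlim_at_top_dense[THEN iffD1, rule_format, OF filterlim_real_sequentially])
      ultimately have "\<forall>\<^sub>F n in sequentially. indicator (A' (\<rho> n)) \<omega> < (1 :: real) \<and> R + 1 - ln x < real n"
        by (rule eventually_conj)
      then obtain n where n: "indicator (A' (\<rho> n)) \<omega> < (1 :: real)" "R + 1 - ln x < real n"
        by (auto dest!: eventually_happens'[OF sequentially_bot])
      define m where "m = \<rho> n"
      have mA: "\<omega> \<notin> A' m" using n(1) by (auto simp: m_def indicator_def split: if_splits)
      have "n \<le> m" using \<rho>(1) by (simp add: m_def seq_suble)
      then have mR: "R + 1 - ln x < real (Suc m)" using n(2) by simp
      \<comment> \<open>The step function at \<open>t\<close> is the value of the path at the left
        end of the dyadic cell of \<open>t\<close>. By continuity it tends to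
        \<open>X t \<omega>\<close>, which is 0, so some grid point \<open>r\<close> has a value
        below \<open>\<epsilon> m\<close>.\<close>
      have lim: "(\<lambda>l. step (grid a T (2 ^ l)) (2 ^ l) (\<lambda>j. X (grid a T (2 ^ l) j) \<omega>) t) \<longlonglongrightarrow> X t \<omega>"
      proof (rule step_grid_tendsto[OF _ _ t'])
        show "filterlim (\<lambda>l. 2 ^ l :: nat) at_top sequentially"
          by (rule filterlim_at_top_mono[OF filterlim_ident]) (auto intro!: always_eventually less_imp_le less_exp)
        have "continuous_on {a..} (\<lambda>t. X t \<omega>)" using elim by (simp add: regular_path_def)
        then have "((\<lambda>t. X t \<omega>) \<longlongrightarrow> X t \<omega>) (at t within {a..})" using t by (auto simp: continuous_on)
        then have "((\<lambda>t. X t \<omega>) \<longlongrightarrow> X t \<omega>) (at t within {a<..<t})" by (rule tendsto_within_subset) auto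
        moreover have "at t within {a<..<t} = at_left t" by (rule at_within_nhd[of _ "{a<..}"]) (use t' in auto)
        ultimately show "((\<lambda>t. X t \<omega>) \<longlongrightarrow> X t \<omega>) (at_left t)" by simp
      qed simp
      have "\<forall>\<^sub>F l in sequentially. \<bar>step (grid a T (2 ^ l)) (2 ^ l) (\<lambda>j. X (grid a T (2 ^ l) j) \<omega>) t\<bar> < \<epsilon> m"
        using order_tendstoD(2)[OF tendsto_rabs[OF lim], of "\<epsilon> m"] Xt \<epsilon>[of m] by simp
      then obtain l where l: "\<bar>step (grid a T (2 ^ l)) (2 ^ l) (\<lambda>j. X (grid a T (2 ^ l) j) \<omega>) t\<bar> < \<epsilon> m"
        by (auto dest!: eventually_happens'[OF sequentially_bot])
      obtain k where k: "k < 2 ^ l" "t \<in> {grid a T (2 ^ l) k<..grid a T (2 ^ l) (Suc k)}"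
        using step_cell[OF grid_mono[OF aT'], of t "2 ^ l" "2 ^ l"] t' by auto
      define r where "r = grid a T (2 ^ l) k"
      have Xr: "\<bar>X r \<omega>\<bar> < \<epsilon> m" using l step_eq[OF grid_mono[OF aT'] k] by (simp add: r_def)
      have r: "a \<le> r" "r \<le> T" using gin[of k l] k(1) by (auto simp: r_def)
      \<comment> \<open>With \<open>S\<close> the level, the noise is at most
        \<open>1 - 2 * S - y + R'\<close>, which is below \<open>- S\<close> by the last condition;
        so its absolute value exceeds \<open>S\<close>.\<close>
      have arith: "S < \<bar>A - B - v\<bar>" if "A \<le> l / 2 - 2 * S" "l / 2 \<le> 1" "y \<le> B" "\<bar>v\<bar> \<le> R'" "R' + 1 - y < S"
        for A l S y B v R' :: real
        using that by linarith
      have "rlog (\<epsilon> m) (X r \<omega>) \<le> ln 2 / 2 - 2 * real (Suc m)"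
      proof -
        have "(X r \<omega>)\<^sup>2 \<le> (\<epsilon> m)\<^sup>2" using power_mono[of "\<bar>X r \<omega>\<bar>" "\<epsilon> m" 2] Xr by simp
        then have "ln ((X r \<omega>)\<^sup>2 + (\<epsilon> m)\<^sup>2) \<le> ln (2 * (\<epsilon> m)\<^sup>2)"
          using \<epsilon>[of m] rlog_denominator_pos[OF \<epsilon>[of m]] by (subst ln_le_cancel_iff) auto
        also have "\<dots> = ln 2 + 2 * ln (\<epsilon> m)" using \<epsilon>[of m] by (simp add: ln_mult ln_realpow)
        also have "ln (\<epsilon> m) = - 2 * real (Suc m)" by (simp add: \<epsilon>_def)
        finally show ?thesis by (simp add: rlog_def)
      qed
      moreover have "ln 2 / 2 \<le> (1 :: real)" using ln_2_less_1 by simp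
      moreover have "ln x \<le> rlog (\<epsilon> m) (X a \<omega>)"
      proof -
        have "2 * ln x = ln (x\<^sup>2)" using x by (simp add: ln_realpow)
        also have "\<dots> \<le> ln (x\<^sup>2 + (\<epsilon> m)\<^sup>2)" using x by (subst ln_le_cancel_iff) (auto intro: add_pos_nonneg)
        finally show ?thesis by (simp add: rlog_def \<omega>)
      qed
      moreover have "\<bar>LINT u:{a..r}|lborel. rdrift (\<epsilon> m) u \<omega>\<bar> \<le> R"
        unfolding R_def by (rule rdrift_integral_bound[OF elim(1) \<epsilon> r])
      ultimately have "real (Suc m) < \<bar>rnoise (\<epsilon> m) r \<omega>\<bar>"
        unfolding rnoise_def using mR arith by blast
      then have "\<omega> \<in> A m l" using k(1) \<omega>(1) unfolding A_def r_def by (auto intro!: exI[of _ k])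
      with mA show False by (auto simp: A'_def)
    qed
  qed
qed

text \<open>By the intermediate value theorem a continuous path that starts at \<open>x > 0\<close>
  and has no zero cannot become negative. Countably many bounded intervals cover all times.\<close>

lemma AE_positive: "AE \<omega> in M. \<forall>t\<ge>a. 0 < X t \<omega>"
proof -
  have "AE \<omega> in M. \<forall>n. \<forall>t\<in>{a..a + real (Suc n)}. X t \<omega> \<noteq> 0"
    unfolding AE_all_countable by (intro allI AE_nonzero) simp
  with AE_regular_path show ?thesis
  proof eventually_elim
    case (elim \<omega>)
    show ?case
    proof (intro allI impI, rule ccontr)
      fix t assume t: "a \<le> t" "\<not> 0 < X t \<omega>"
      have c: "continuous_on {a..t} (\<lambda>t. X t \<omega>)" and xa: "X a \<omega> = x"
        using elim(1) by (auto simp: regular_path_def intro: continuous_on_subset)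
      obtain u where u: "a \<le> u" "u \<le> t" "X u \<omega> = 0"
        using IVT2'[of "\<lambda>t. X t \<omega>" t 0 a, OF _ _ t(1) c] t(2) xa x by auto
      obtain n :: nat where "t - a \<le> real n" using real_arch_simple by blast
      then have "u \<in> {a..a + real (Suc n)}" using u by auto
      with elim(2) u(3) show False by blast
    qed
  qed
qed

text \<open>\<open>has_ito_integral_limit\<close> along \<epsilon> n tending to 0. On a positive
  path the weight tends to 1, so diffusion and drift of the regularised logarithm converge to those
  stated; their bounds uniform in \<open>e\<close> give domination.\<close>

theorem log_differential:
  "has_differential M F W a (\<lambda>t \<omega>. ln (X t \<omega>)) (\<lambda>t \<omega>. \<beta> t \<omega> - (\<phi> t \<omega>)\<^sup>2 / 2) \<phi>"
proof -
  define \<epsilon> where "\<epsilon> n = inverse (real (Suc n))" for n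
  have \<epsilon>: "0 < \<epsilon> n" for n by (simp add: \<epsilon>_def)
  define D where "D u \<omega> = \<beta> u \<omega> - (\<phi> u \<omega>)\<^sup>2 / 2" for u \<omega>
  have p1: "progressive F {a..} (\<lambda>t \<omega>. ln (X t \<omega>))"
    by (rule progressive_compose[OF X_progressive]) simp
  have p2: "progressive F {a..} D"
    using progressive_add[OF \<beta> progressive_compose[OF \<phi>, of "\<lambda>y. - (y\<^sup>2 / 2)"]] by (simp add: D_def[abs_def])
  have cont: "AE \<omega> in M. continuous_on {a..} (\<lambda>t. ln (X t \<omega>))"
    using AE_regular_path AE_positive
    by eventually_elim (auto simp: regular_path_def intro!: continuous_on_ln)
  have D_int: "AE \<omega> in M. \<forall>t\<ge>a. set_integrable lborel {a..t} (\<lambda>u. D u \<omega>)"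
    using AE_regular_path
  proof eventually_elim
    case (elim \<omega>)
    then show ?case
      unfolding D_def by (auto simp: regular_path_def intro!: set_integral_diff(1))
  qed
  have ito: "has_ito_integral M F W \<phi> a t (\<lambda>\<omega>. ln (X t \<omega>) - ln (X a \<omega>) - (LINT u:{a..t}|lborel. D u \<omega>))"
    if t: "a \<le> t" for t
  proof (rule has_ito_integral_limit[OF rnoise_ito[OF \<epsilon> t] _ a t])
    show "progressive F {a..t} \<phi>" by (rule progressive_subset[OF \<phi>]) auto
    show "AE \<omega> in M. set_integrable lborel {a..t} (\<lambda>u. (\<phi> u \<omega>)\<^sup>2)"
      using \<phi>_int by eventually_elim (use t in simp)
    have "X t \<in> borel_measurable M" "X a \<in> borel_measurable M"
      using t by (auto intro!: measurable_F_M[OF progressive_adapted[OF X_progressive]])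
    moreover have "(\<lambda>\<omega>. LINT u:{a..t}|lborel. D u \<omega>) \<in> borel_measurable M"
      by (rule measurable_F_M[OF progressive_path_integral[OF p2 _ t]]) auto
    ultimately show "(\<lambda>\<omega>. ln (X t \<omega>) - ln (X a \<omega>) - (LINT u:{a..t}|lborel. D u \<omega>)) \<in> borel_measurable M"
      by measurable
    show "AE \<omega> in M. (\<lambda>n. LINT u:{a..t}|lborel. (rdiffusion (\<epsilon> n) u \<omega> - \<phi> u \<omega>)\<^sup>2) \<longlonglongrightarrow> 0"
      using AE_regular_path AE_positive
    proof eventually_elim
      case (elim \<omega>)
      have pm: "set_borel_measurable lborel {a..t} (\<lambda>u. \<phi> u \<omega>)"
        by (rule progressive_path_measurable[OF \<phi> _ t]) (use elim in \<open>auto simp: regular_path_def\<close>)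
      have dm: "set_borel_measurable lborel {a..t} (\<lambda>u. rdiffusion (\<epsilon> n) u \<omega>)" for n
      proof (rule progressive_path_measurable[OF _ _ t])
        show "progressive F {a..} (rdiffusion (\<epsilon> n))"
          using rlog_differential[OF \<epsilon>] by (simp add: has_differential_def)
      qed (use elim in \<open>auto simp: regular_path_def\<close>)
      \<comment> \<open>The difference is \<open>(q - 1) * \<phi>\<close> with a weight
        \<open>q\<close> between 0 and 1, so its square is dominated by the square of
        \<phi>.\<close>
      have "(\<lambda>n. LINT u:{a..t}|lborel. (rdiffusion (\<epsilon> n) u \<omega> - \<phi> u \<omega>)\<^sup>2) \<longlonglongrightarrow> (LINT u:{a..t}|lborel. 0)"
      proof (rule set_integral_dominated)
        show "set_integrable lborel {a..t} (\<lambda>u. (\<phi> u \<omega>)\<^sup>2)"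
          using elim t by (simp add: regular_path_def)
        have m: "set_borel_measurable lborel {a..t} (\<lambda>u. rdiffusion (\<epsilon> n) u \<omega> - \<phi> u \<omega>)" for n
          using set_borel_measurable_linear[OF pm dm[of n], of "-1"] by simp
        show "set_borel_measurable lborel {a..t} (\<lambda>u. (rdiffusion (\<epsilon> n) u \<omega> - \<phi> u \<omega>)\<^sup>2)" for n
          unfolding power2_eq_square by (rule set_borel_measurable_times[OF m m])
        show "AE u in lborel. u \<in> {a..t} \<longrightarrow> (\<lambda>n. (rdiffusion (\<epsilon> n) u \<omega> - \<phi> u \<omega>)\<^sup>2) \<longlonglongrightarrow> 0"
        proof (intro AE_I2 impI)
          fix u assume u: "u \<in> {a..t}"
          then have "X u \<omega> \<noteq> 0" using elim(2) by fastforce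
          from rweight_tendsto_1[OF this]
          have "(\<lambda>n. (rweight (\<epsilon> n) (X u \<omega>) * \<phi> u \<omega> - \<phi> u \<omega>)\<^sup>2) \<longlonglongrightarrow> (1 * \<phi> u \<omega> - \<phi> u \<omega>)\<^sup>2"
            unfolding \<epsilon>_def by (intro tendsto_intros)
          then show "(\<lambda>n. (rdiffusion (\<epsilon> n) u \<omega> - \<phi> u \<omega>)\<^sup>2) \<longlonglongrightarrow> 0"
            using u rcoefficients(1)[OF elim(1) \<epsilon>] by simp
        qed
        fix n u assume u: "u \<in> {a..t}"
        define q where "q = rweight (\<epsilon> n) (X u \<omega>)"
        have "\<bar>q - 1\<bar> \<le> 1" using rweight_bounds[of "\<epsilon> n" "X u \<omega>"] by (auto simp: q_def)
        then have "(q - 1)\<^sup>2 \<le> 1" using power_mono[of "\<bar>q - 1\<bar>" 1 2] by simp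
        then have "(q - 1)\<^sup>2 * (\<phi> u \<omega>)\<^sup>2 \<le> 1 * (\<phi> u \<omega>)\<^sup>2" by (rule mult_right_mono) simp
        moreover have "(rdiffusion (\<epsilon> n) u \<omega> - \<phi> u \<omega>)\<^sup>2 = (q - 1)\<^sup>2 * (\<phi> u \<omega>)\<^sup>2"
          using u rcoefficients(1)[OF elim(1) \<epsilon>, of u n]
          by (simp add: q_def power_mult_distrib[symmetric] left_diff_distrib)
        ultimately show "\<bar>(rdiffusion (\<epsilon> n) u \<omega> - \<phi> u \<omega>)\<^sup>2\<bar> \<le> (\<phi> u \<omega>)\<^sup>2" by simp
      qed (simp add: set_borel_measurable_def)
      then show ?case by simp
    qed
    show "AE \<omega> in M. (\<lambda>n. rnoise (\<epsilon> n) t \<omega>) \<longlonglongrightarrow> ln (X t \<omega>) - ln (X a \<omega>) - (LINT u:{a..t}|lborel. D u \<omega>)"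
      using AE_regular_path AE_positive
    proof eventually_elim
      case (elim \<omega>)
      have "(\<lambda>n. LINT u:{a..t}|lborel. rdrift (\<epsilon> n) u \<omega>) \<longlonglongrightarrow> (LINT u:{a..t}|lborel. D u \<omega>)"
      proof (rule set_integral_dominated[OF bound_integrable[OF elim(1) t]])
        show "set_borel_measurable lborel {a..t} (\<lambda>u. D u \<omega>)"
          using progressive_path_measurable[OF p2 _ t] elim(1) by (auto simp: regular_path_def)
        show "set_borel_measurable lborel {a..t} (\<lambda>u. rdrift (\<epsilon> n) u \<omega>)" for n
          by (rule rdrift_path_measurable[OF elim(1) \<epsilon> t])
        show "AE u in lborel. u \<in> {a..t} \<longrightarrow> (\<lambda>n. rdrift (\<epsilon> n) u \<omega>) \<longlonglongrightarrow> D u \<omega>"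
        proof (intro AE_I2 impI)
          fix u assume u: "u \<in> {a..t}"
          then have "X u \<omega> \<noteq> 0" using elim(2) by fastforce
          from rweight_tendsto_1[OF this]
          have "(\<lambda>n. rweight (\<epsilon> n) (X u \<omega>) * \<beta> u \<omega>
              + rweight (\<epsilon> n) (X u \<omega>) * (1 - 2 * rweight (\<epsilon> n) (X u \<omega>)) * (\<phi> u \<omega>)\<^sup>2 / 2)
            \<longlonglongrightarrow> 1 * \<beta> u \<omega> + 1 * (1 - 2 * 1) * (\<phi> u \<omega>)\<^sup>2 / 2"
            unfolding \<epsilon>_def by (intro tendsto_intros) auto
          then show "(\<lambda>n. rdrift (\<epsilon> n) u \<omega>) \<longlonglongrightarrow> D u \<omega>"
            using u rcoefficients(2)[OF elim(1) \<epsilon>] by (simp add: D_def)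
        qed
        show "\<bar>rdrift (\<epsilon> n) u \<omega>\<bar> \<le> \<bar>\<beta> u \<omega>\<bar> + (\<phi> u \<omega>)\<^sup>2 / 2" if "u \<in> {a..t}" for n u
          using rdrift_bound[OF elim(1) \<epsilon>] that by simp
      qed
      moreover have "(\<lambda>n. rlog (\<epsilon> n) (X r \<omega>)) \<longlonglongrightarrow> ln (X r \<omega>)" if "a \<le> r" for r
        unfolding \<epsilon>_def by (rule rlog_tendsto_ln) (use elim(2) that in simp)
      ultimately show ?case
        unfolding rnoise_def using t by (intro tendsto_diff) auto
    qed
  qed
  show ?thesis
    unfolding has_differential_def D_def[symmetric]
    using p1 p2 \<phi> cont D_int \<phi>_int ito by (auto simp: D_def[abs_def])
qed

end

section \<open>Restriction in time and moving averages\<close>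

text \<open>The price is modelled from time 0, but the portfolio equation starts at
  \<open>L\<^sub>2\<close>. The integral over \<open>{a'..t}\<close> is the difference of those up
  to \<open>t\<close> and \<open>a'\<close>; clipped approximants from \<open>{a..t}\<close>
  converge to it.\<close>

lemma (in wiener_space) has_differential_restrict:
  assumes X: "has_differential M F W a X b s" and a: "0 \<le> a" "a \<le> a'"
  shows "has_differential M F W a' X b s"
proof -
  have sub: "{a'..} \<subseteq> {a..}" using a by auto
  have p: "progressive F {a..} X" "progressive F {a..} b" "progressive F {a..} s"
    and c: "AE \<omega> in M. continuous_on {a..} (\<lambda>t. X t \<omega>)"
    and bi: "AE \<omega> in M. \<forall>t\<ge>a. set_integrable lborel {a..t} (\<lambda>u. b u \<omega>)"
    and si: "AE \<omega> in M. \<forall>t\<ge>a. set_integrable lborel {a..t} (\<lambda>u. (s u \<omega>)\<^sup>2)"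
    using X by (auto simp: has_differential_def)
  have ito: "has_ito_integral M F W s a' t (\<lambda>\<omega>. X t \<omega> - X a' \<omega> - (LINT u:{a'..t}|lborel. b u \<omega>))"
    if t: "a' \<le> t" for t
  proof -
    have at: "a \<le> t" using a t by simp
    define J where "J r \<omega> = X r \<omega> - X a \<omega> - (LINT u:{a..r}|lborel. b u \<omega>)" for r \<omega>
    have J: "has_ito_integral M F W s a r (J r)" if "a \<le> r" for r
      unfolding J_def[abs_def] by (rule has_differential_ito_integral[OF X that])
    obtain hs where hs: "\<And>n. simple_on F a t (hs n)"
      and L: "AE \<omega> in M. (\<lambda>n. LINT u:{a..t}|lborel. (simple_process (hs n) u \<omega> - s u \<omega>)\<^sup>2) \<longlonglongrightarrow> 0"
      and I: "AE \<omega> in M. (\<lambda>n. simple_integral W (hs n) \<omega>) \<longlonglongrightarrow> J t \<omega>"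
      using has_ito_integralE_AE[OF J[OF at] a(1) at] by blast
    have sq: "AE \<omega> in M. square_integrable_on (\<lambda>u. s u \<omega>) {a..t}"
      by (rule has_ito_integral_square_integrable[OF J[OF at] at])
    have ps: "progressive F {a..t} s" by (rule progressive_subset[OF p(3)]) auto
    have cl: "simple_on F a a' (clip a a' (\<lambda>_. 1) (hs n))" for n
      by (rule simple_on_clip[OF hs a(2), where B=1]) auto
    have [measurable]: "J a' \<in> borel_measurable M"
      using J[OF a(2)] by (auto simp: has_ito_integral_def tendsto_in_prob_def)
    have [measurable]: "simple_integral W (clip a a' (\<lambda>_. 1) (hs n)) \<in> borel_measurable M" for n
      by (rule simple_integral_measurable[OF cl a(1)])
    have "(\<lambda>n. prob_norm M (\<lambda>\<omega>. simple_integral W (clip a a' (\<lambda>_. 1) (hs n)) \<omega> - J a' \<omega>)) \<longlonglongrightarrow> 0"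
      by (rule restriction_tendsto[OF ps a t hs L sq J[OF a(2)]])
    then obtain \<rho> :: "nat \<Rightarrow> nat" where \<rho>: "strict_mono \<rho>"
      "AE \<omega> in M. (\<lambda>n. simple_integral W (clip a a' (\<lambda>_. 1) (hs (\<rho> n))) \<omega> - J a' \<omega>) \<longlonglongrightarrow> 0"
      using prob_norm_subseq[of "\<lambda>n \<omega>. simple_integral W (clip a a' (\<lambda>_. 1) (hs n)) \<omega> - J a' \<omega>"] by auto
    \<comment> \<open>The subsequence \<rho> makes the integrals up to \<open>a'\<close> converge
      almost surely along the approximants already chosen up to \<open>t\<close>, so the difference
      converges too.\<close>
    define k where "k n = clip a' t (\<lambda>_. 1) (hs (\<rho> n))" for n
    have k: "simple_on F a' t (k n)" for n
      unfolding k_def by (rule simple_on_clip[OF hs t, where B=1]) auto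
    show ?thesis
    proof (rule has_ito_integralI_AE[OF _ _ t _ k])
      show "progressive F {a'..t} s" by (rule progressive_subset[OF p(3)]) (use a in auto)
      show "AE \<omega> in M. set_integrable lborel {a'..t} (\<lambda>u. (s u \<omega>)\<^sup>2)"
        using si by eventually_elim (rule set_integrable_subset[of _ "{a..t}"], use a at in auto)
      show "AE \<omega> in M. (\<lambda>n. LINT u:{a'..t}|lborel. (simple_process (k n) u \<omega> - s u \<omega>)\<^sup>2) \<longlonglongrightarrow> 0"
        using L sq AE_space
      proof eventually_elim
        case (elim \<omega>)
        show ?case
        proof (rule tendsto_sandwich[OF _ _ tendsto_const LIMSEQ_subseq_LIMSEQ[OF elim(1) \<rho>(1)]];
            intro always_eventually allI)
          fix n
          have sqn: "square_integrable_on (\<lambda>u. simple_process (hs (\<rho> n)) u \<omega> - s u \<omega>) {a..t}"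
            by (intro square_integrable_on_diff(1) simple_process_square_integrable[OF hs] elim)
          have sqk: "square_integrable_on (\<lambda>u. simple_process (k n) u \<omega> - s u \<omega>) {a'..t}"
            by (intro square_integrable_on_diff(1) simple_process_square_integrable[OF k] elim
                square_integrable_on_subset[OF elim(2)]) (use a in auto)
          have sqn': "square_integrable_on (\<lambda>u. simple_process (hs (\<rho> n)) u \<omega> - s u \<omega>) {a'..t}"
            by (rule square_integrable_on_subset[OF sqn]) (use a in auto)
          have "(LINT u:{a'..t}|lborel. (simple_process (k n) u \<omega> - s u \<omega>)\<^sup>2) =
              (LINT u:{a'..t}|lborel. (simple_process (hs (\<rho> n)) u \<omega> - s u \<omega>)\<^sup>2)"
          proof -
            \<comment> \<open>Clipping produces left-open intervals, so the two processes differ on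
              \<open>{a'..t}\<close> at most in the point \<open>a'\<close>.\<close>
            have "AE u in lborel. indicator {a'..t} u *\<^sub>R (simple_process (k n) u \<omega> - s u \<omega>)\<^sup>2 =
                indicator {a'..t} u *\<^sub>R (simple_process (hs (\<rho> n)) u \<omega> - s u \<omega>)\<^sup>2"
              using AE_lborel_singleton[of a']
              by eventually_elim (auto simp: k_def simple_process_clip[OF hs t] indicator_def)
            then show ?thesis
              unfolding set_lebesgue_integral_def
              by (intro integral_cong_AE)
                 (use sqn' sqk in \<open>auto simp: square_integrable_on_def set_integrable_def intro: borel_measurable_integrable\<close>)
          qed
          also have "\<dots> \<le> (LINT u:{a..t}|lborel. (simple_process (hs (\<rho> n)) u \<omega> - s u \<omega>)\<^sup>2)"
            by (rule set_integral_nonneg_mono_set) (use sqn a in \<open>auto simp: square_integrable_on_def\<close>)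
          finally show "(LINT u:{a'..t}|lborel. (simple_process (k n) u \<omega> - s u \<omega>)\<^sup>2) \<le>
              ((\<lambda>n. LINT u:{a..t}|lborel. (simple_process (hs n) u \<omega> - s u \<omega>)\<^sup>2) \<circ> \<rho>) n" by simp
        qed (rule set_integral_square_nonneg)
      qed
      have XM: "X r \<in> borel_measurable M" if "a \<le> r" for r
        by (rule measurable_F_M[OF progressive_adapted[OF p(1)]]) (use that in simp)
      have "(\<lambda>\<omega>. LINT u:{a'..t}|lborel. b u \<omega>) \<in> borel_measurable M"
        by (rule measurable_F_M[OF progressive_path_integral[OF p(2) _ t]]) (use a in auto)
      then show "(\<lambda>\<omega>. X t \<omega> - X a' \<omega> - (LINT u:{a'..t}|lborel. b u \<omega>)) \<in> borel_measurable M"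
        using XM[OF at] XM[OF a(2)] by measurable
      show "AE \<omega> in M. (\<lambda>n. simple_integral W (k n) \<omega>) \<longlonglongrightarrow> X t \<omega> - X a' \<omega> - (LINT u:{a'..t}|lborel. b u \<omega>)"
        using I \<rho>(2) bi
      proof eventually_elim
        case (elim \<omega>)
        have eq: "simple_integral W (k n) \<omega> = simple_integral W (hs (\<rho> n)) \<omega> - simple_integral W (clip a a' (\<lambda>_. 1) (hs (\<rho> n))) \<omega>" for n
          unfolding k_def simple_integral_clip[OF hs a(2) t] simple_integral_clip_whole[OF hs] by simp
        have "(\<lambda>n. simple_integral W (k n) \<omega>) \<longlonglongrightarrow> J t \<omega> - J a' \<omega>"
          unfolding eq using LIMSEQ_subseq_LIMSEQ[OF elim(1) \<rho>(1)] LIM_zero_cancel[OF elim(2)]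
          by (intro tendsto_diff) (simp_all add: comp_def)
        moreover have "J t \<omega> - J a' \<omega> = X t \<omega> - X a' \<omega> - (LINT u:{a'..t}|lborel. b u \<omega>)"
          using set_integral_split_Icc[of a t "\<lambda>u. b u \<omega>" a' t] elim(3) a t at by (simp add: J_def)
        ultimately show ?case by simp
      qed
    qed (use a in simp)
  qed
  have restr: "\<forall>t\<ge>a'. set_integrable lborel {a'..t} g" if "\<forall>t\<ge>a. set_integrable lborel {a..t} g" for g :: "real \<Rightarrow> real"
  proof (intro allI impI)
    fix t assume "a' \<le> t"
    then have "set_integrable lborel {a..t} g" using that a by simp
    then show "set_integrable lborel {a'..t} g" by (rule set_integrable_subset) (use a in auto)
  qed
  have "AE \<omega> in M. continuous_on {a'..} (\<lambda>t. X t \<omega>)"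
    using c by eventually_elim (rule continuous_on_subset[OF _ sub])
  moreover have "AE \<omega> in M. \<forall>t\<ge>a'. set_integrable lborel {a'..t} (\<lambda>u. b u \<omega>)"
    using bi by eventually_elim (rule restr)
  moreover have "AE \<omega> in M. \<forall>t\<ge>a'. set_integrable lborel {a'..t} (\<lambda>u. (s u \<omega>)\<^sup>2)"
    using si by eventually_elim (rule restr)
  ultimately show ?thesis
    unfolding has_differential_def using progressive_subset[OF _ sub] p ito by blast
qed

text \<open>Window and integrand both vary with (t, \<omega>). The moving window is turned into a
  measurable condition on the pair of \<open>t\<close> and \<open>u\<close>, and the parameter
  version of Fubini's theorem applies. \<open>L \<le> a\<close> keeps the window inside the
  nonnegative times.\<close>

lemma (in filtered_prob_space) progressive_geometric_average:
  assumes S: "progressive F {0..} S" and L: "0 \<le> L" "L \<le> a"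
  shows "progressive F {a..} (\<lambda>t. geometric_average S t L)"
  unfolding progressive_def
proof
  fix T assume "T \<in> {a..}"
  then have T: "0 \<le> T" using L by simp
  let ?N = "restrict_space borel ({a..} \<inter> {..T}) \<Otimes>\<^sub>M F T"
  \<comment> \<open>Cutting at the fixed time \<open>T\<close> makes the integrand measurable for
    \<open>F T\<close>; every window that occurs lies in \<open>{0..T}\<close>.\<close>
  define g where "g u \<omega> = indicator {0..T} u * ln (S u \<omega>)" for u \<omega>
  have g: "(\<lambda>(u, \<omega>). g u \<omega>) \<in> borel_measurable (borel \<Otimes>\<^sub>M F T)"
    unfolding g_def by (rule progressive_joint[OF progressive_compose[OF S]]) (use T in auto)
  have m1: "(\<lambda>q. fst (fst q)) \<in> ?N \<Otimes>\<^sub>M lborel \<rightarrow>\<^sub>M borel"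
  proof -
    have "(\<lambda>t. t) \<in> restrict_space borel ({a..} \<inter> {..T}) \<rightarrow>\<^sub>M (borel :: real measure)"
      by (intro measurable_restrict_space1) simp
    from measurable_compose[OF measurable_compose[OF measurable_fst measurable_fst] this]
    show ?thesis .
  qed
  have m2: "(\<lambda>q. (snd q, snd (fst q))) \<in> ?N \<Otimes>\<^sub>M lborel \<rightarrow>\<^sub>M borel \<Otimes>\<^sub>M F T"
    by measurable
  have m3: "(\<lambda>q. g (snd q) (snd (fst q))) \<in> borel_measurable (?N \<Otimes>\<^sub>M lborel)"
    using measurable_compose[OF m2 g] by simp
  have m4: "(\<lambda>q. snd q) \<in> ?N \<Otimes>\<^sub>M lborel \<rightarrow>\<^sub>M borel" by measurable
  have "(\<lambda>q. if fst (fst q) - L \<le> snd q \<and> snd q \<le> fst (fst q) then g (snd q) (snd (fst q)) else 0)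
      \<in> borel_measurable (?N \<Otimes>\<^sub>M lborel)"
    using m1 m3 m4 by measurable
  then have "(\<lambda>(z, u). if fst z - L \<le> u \<and> u \<le> fst z then g u (snd z) else 0) \<in> borel_measurable (?N \<Otimes>\<^sub>M lborel)"
    by (simp add: case_prod_unfold)
  from lborel.borel_measurable_lebesgue_integral[OF this]
  have "(\<lambda>z. \<integral>u. (if fst z - L \<le> u \<and> u \<le> fst z then g u (snd z) else 0) \<partial>lborel) \<in> borel_measurable ?N" .
  then have "(\<lambda>z. exp (1 / L * (\<integral>u. (if fst z - L \<le> u \<and> u \<le> fst z then g u (snd z) else 0) \<partial>lborel))) \<in> borel_measurable ?N"
    by measurable
  moreover have "(\<integral>u. (if fst z - L \<le> u \<and> u \<le> fst z then g u (snd z) else 0) \<partial>lborel)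
      = (LINT u:{fst z - L..fst z}|lborel. ln (S u (snd z)))" if "z \<in> space ?N" for z
    unfolding set_lebesgue_integral_def
    by (intro Bochner_Integration.integral_cong refl)
       (use that L in \<open>auto simp: g_def indicator_def space_pair_measure space_restrict_space\<close>)
  ultimately show "(\<lambda>(t, \<omega>). geometric_average S t L \<omega>) \<in> borel_measurable ?N"
    unfolding geometric_average_def case_prod_unfold by (subst measurable_cong) auto
qed

lemma (in filtered_prob_space) progressive_cross_signal:
  assumes S: "progressive F {0..} S" and L: "0 \<le> L1" "0 \<le> L2" "L1 \<le> a" "L2 \<le> a"
  shows "progressive F {a..} (cross_signal S L1 L2)"
  unfolding progressive_def
proof
  fix t assume "t \<in> {a..}"
  then have [measurable]:
    "(\<lambda>(u, \<omega>). geometric_average S u L1 \<omega>) \<in> borel_measurable (restrict_space borel ({a..} \<inter> {..t}) \<Otimes>\<^sub>M F t)"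
    "(\<lambda>(u, \<omega>). geometric_average S u L2 \<omega>) \<in> borel_measurable (restrict_space borel ({a..} \<inter> {..t}) \<Otimes>\<^sub>M F t)"
    using progressive_geometric_average[OF S L(1,3)] progressive_geometric_average[OF S L(2,4)]
    unfolding progressive_def by blast+
  show "(\<lambda>(u, \<omega>). cross_signal S L1 L2 u \<omega>) \<in> borel_measurable (restrict_space borel ({a..} \<inter> {..t}) \<Otimes>\<^sub>M F t)"
    unfolding cross_signal_def by measurable
qed

section \<open>The portfolio\<close>

text \<open>Positivity is asserted along with the differential because \<open>ln\<close> is total:
  an equation for \<open>ln (Q t \<omega>)\<close> alone would not say that the wealth stays in the
  range where this is the logarithm.\<close>

theorem proposition6:
  fixes M :: "'a measure" and F :: "real \<Rightarrow> 'a measure"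
    and W\<^sub>S W\<^sub>\<mu> S \<mu> Q \<theta> :: "real \<Rightarrow> 'a \<Rightarrow> real"
    and lam \<sigma>\<^sub>\<mu> \<sigma>\<^sub>S \<gamma> \<alpha> L\<^sub>1 L\<^sub>2 S\<^sub>0 x :: real
  assumes "filtered_prob_space M F"
    and "wiener_process_2d M F W\<^sub>S W\<^sub>\<mu>"
    and "lam > 0" "\<sigma>\<^sub>\<mu> > 0" "\<sigma>\<^sub>S > 0" "S\<^sub>0 > 0" "0 < L\<^sub>1" "L\<^sub>1 < L\<^sub>2" "x > 0"
    and "AE \<omega> in M. S 0 \<omega> = S\<^sub>0"
    and "has_differential M F W\<^sub>S 0 S (\<lambda>t \<omega>. S t \<omega> * \<mu> t \<omega>) (\<lambda>t \<omega>. S t \<omega> * \<sigma>\<^sub>S)"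
    and "AE \<omega> in M. \<mu> 0 \<omega> = 0"
    and "has_differential M F W\<^sub>\<mu> 0 \<mu> (\<lambda>t \<omega>. - lam * \<mu> t \<omega>) (\<lambda>t \<omega>. \<sigma>\<^sub>\<mu>)"
    and "\<And>t \<omega>. \<theta> t \<omega> = \<gamma> + \<alpha> * cross_signal S L\<^sub>1 L\<^sub>2 t \<omega>"
    and "AE \<omega> in M. \<forall>t\<in>{0..L\<^sub>2}. Q t \<omega> = x"
    and "has_differential_wrt M F W\<^sub>S L\<^sub>2 Q (\<lambda>t \<omega>. Q t \<omega> * \<theta> t \<omega> / S t \<omega>) S"
  shows "(AE \<omega> in M. \<forall>t\<ge>L\<^sub>2. Q t \<omega> > 0) \<and>
    has_differential M F W\<^sub>S L\<^sub>2 (\<lambda>t \<omega>. ln (Q t \<omega>))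
      (\<lambda>t \<omega>. (\<gamma> + \<alpha> * cross_signal S L\<^sub>1 L\<^sub>2 t \<omega>) * \<mu> t \<omega> - \<gamma>\<^sup>2 * \<sigma>\<^sub>S\<^sup>2 / 2
         - (\<alpha>\<^sup>2 + 2 * \<alpha> * \<gamma>) * \<sigma>\<^sub>S\<^sup>2 / 2 * cross_signal S L\<^sub>1 L\<^sub>2 t \<omega>)
      (\<lambda>t \<omega>. (\<gamma> + \<alpha> * cross_signal S L\<^sub>1 L\<^sub>2 t \<omega>) * \<sigma>\<^sub>S)"
proof -
  interpret filtered_prob_space M F by fact
  have L: "0 \<le> L\<^sub>1" "0 \<le> L\<^sub>2" "L\<^sub>1 \<le> L\<^sub>2" using assms(7,8) by auto
  interpret wiener_space M F W\<^sub>S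
    by unfold_locales (use assms(2) in \<open>simp add: wiener_process_2d_def\<close>)
  have p\<mu>: "progressive F {0..} \<mu>" and c\<mu>: "AE \<omega> in M. continuous_on {0..} (\<lambda>t. \<mu> t \<omega>)"
    and pS: "progressive F {0..} S"
    using assms(11,13) by (auto simp: has_differential_def)
  have const: "set_integrable lborel {l..r} (\<lambda>_. c)" for l r c :: real
    using borel_integrable_atLeastAtMost'[of l r "\<lambda>_. c"] by simp
  have \<mu>_int: "AE \<omega> in M. \<forall>r\<ge>l. set_integrable lborel {l..r} (\<lambda>u. \<mu> u \<omega>)" if "0 \<le> l" for l
    using c\<mu>
    by eventually_elim
       (use that in \<open>auto intro!: borel_integrable_atLeastAtMost' elim!: continuous_on_subset\<close>)
  \<comment> \<open>The price equation is itself of exponential type, with \<beta> = \<mu> and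
    constant \<phi>. Only its positivity is used below.\<close>
  interpret S: exponential_sde M F W\<^sub>S 0 S\<^sub>0 S "\<lambda>t \<omega>. S t \<omega> * \<mu> t \<omega>" "\<lambda>t \<omega>. S t \<omega> * \<sigma>\<^sub>S" \<mu> "\<lambda>_ _. \<sigma>\<^sub>S"
    by unfold_locales (use assms(6,10,11) p\<mu> \<mu>_int[of 0] const progressive_const in auto)
  define c where "c = cross_signal S L\<^sub>1 L\<^sub>2"
  have c01: "c t \<omega> = 0 \<or> c t \<omega> = 1" for t \<omega> by (simp add: c_def cross_signal_def)
  have \<theta>_eq: "\<theta> t \<omega> = \<gamma> + \<alpha> * c t \<omega>" for t \<omega> using assms(14) by (simp add: c_def)
  have \<theta>_bound: "\<bar>\<theta> t \<omega>\<bar> \<le> \<bar>\<gamma>\<bar> + \<bar>\<alpha>\<bar>" for t \<omega>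
    using c01[of t \<omega>] abs_triangle_ineq[of \<gamma> \<alpha>] by (auto simp: \<theta>_eq)
  have p\<theta>: "progressive F {L\<^sub>2..} \<theta>"
  proof -
    have "progressive F {L\<^sub>2..} (\<lambda>t \<omega>. \<gamma> + \<alpha> * c t \<omega>)"
      unfolding c_def by (intro progressive_add progressive_times progressive_const progressive_cross_signal[OF pS]) (use L in auto)
    then show ?thesis by (simp add: \<theta>_eq[symmetric])
  qed
  have \<theta>_path: "set_borel_measurable lborel {L\<^sub>2..r} (\<lambda>u. \<theta> u \<omega>)" if "L\<^sub>2 \<le> r" "\<omega> \<in> space M" for r \<omega>
    by (rule progressive_path_measurable[OF p\<theta> _ that]) auto
  have dS: "has_differential M F W\<^sub>S L\<^sub>2 S (\<lambda>t \<omega>. S t \<omega> * \<mu> t \<omega>) (\<lambda>t \<omega>. S t \<omega> * \<sigma>\<^sub>S)"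
    by (rule has_differential_restrict[OF assms(11) order_refl L(2)])
  \<comment> \<open>\<open>has_differential_wrt\<close> covers every pair of coefficients of
    \<open>S\<close>; the pair of the model, restricted to times from \<open>L\<^sub>2\<close> on,
    is inserted.\<close>
  have dQ: "has_differential M F W\<^sub>S L\<^sub>2 Q (\<lambda>t \<omega>. Q t \<omega> * \<theta> t \<omega> / S t \<omega> * (S t \<omega> * \<mu> t \<omega>))
      (\<lambda>t \<omega>. Q t \<omega> * \<theta> t \<omega> / S t \<omega> * (S t \<omega> * \<sigma>\<^sub>S))"
    using assms(16) dS unfolding has_differential_wrt_def by blast
  interpret Q: exponential_sde M F W\<^sub>S L\<^sub>2 x Q
    "\<lambda>t \<omega>. Q t \<omega> * \<theta> t \<omega> / S t \<omega> * (S t \<omega> * \<mu> t \<omega>)" "\<lambda>t \<omega>. Q t \<omega> * \<theta> t \<omega> / S t \<omega> * (S t \<omega> * \<sigma>\<^sub>S)"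
    "\<lambda>t \<omega>. \<theta> t \<omega> * \<mu> t \<omega>" "\<lambda>t \<omega>. \<theta> t \<omega> * \<sigma>\<^sub>S"
  proof
    show "progressive F {L\<^sub>2..} (\<lambda>t \<omega>. \<theta> t \<omega> * \<mu> t \<omega>)"
      by (rule progressive_times[OF p\<theta> progressive_subset[OF p\<mu>]]) (use L in auto)
    show "progressive F {L\<^sub>2..} (\<lambda>t \<omega>. \<theta> t \<omega> * \<sigma>\<^sub>S)"
      by (rule progressive_times[OF p\<theta> progressive_const])
    \<comment> \<open>The factors \<open>S\<close> cancel because \<open>S\<close> is almost surely
      positive; this turns the portfolio into an equation of exponential type.\<close>
    show "AE \<omega> in M. \<forall>t\<ge>L\<^sub>2. Q t \<omega> * \<theta> t \<omega> / S t \<omega> * (S t \<omega> * \<mu> t \<omega>) = Q t \<omega> * (\<theta> t \<omega> * \<mu> t \<omega>) \<and>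
        Q t \<omega> * \<theta> t \<omega> / S t \<omega> * (S t \<omega> * \<sigma>\<^sub>S) = Q t \<omega> * (\<theta> t \<omega> * \<sigma>\<^sub>S)"
      using S.AE_positive
    proof eventually_elim
      case (elim \<omega>)
      have "S t \<omega> \<noteq> 0" if "L\<^sub>2 \<le> t" for t
        using elim[rule_format, of t] that L(2) by simp
      then show ?case by simp
    qed
    show "AE \<omega> in M. \<forall>t\<ge>L\<^sub>2. set_integrable lborel {L\<^sub>2..t} (\<lambda>u. \<theta> u \<omega> * \<mu> u \<omega>)"
      using \<mu>_int[OF L(2)] AE_space
      by eventually_elim (auto intro!: set_integrable_bounded_mult[OF _ \<theta>_path \<theta>_bound])
    show "AE \<omega> in M. \<forall>t\<ge>L\<^sub>2. set_integrable lborel {L\<^sub>2..t} (\<lambda>u. (\<theta> u \<omega> * \<sigma>\<^sub>S)\<^sup>2)"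
      using AE_space
    proof eventually_elim
      case (elim \<omega>)
      show ?case
      proof (intro allI impI)
        fix t assume t: "L\<^sub>2 \<le> t"
        have "set_integrable lborel {L\<^sub>2..t} (\<lambda>u. \<theta> u \<omega> * (\<theta> u \<omega> * \<sigma>\<^sub>S\<^sup>2))"
          by (intro set_integrable_bounded_mult[OF _ \<theta>_path[OF t elim] \<theta>_bound] const)
        then show "set_integrable lborel {L\<^sub>2..t} (\<lambda>u. (\<theta> u \<omega> * \<sigma>\<^sub>S)\<^sup>2)"
          by (simp add: power2_eq_square mult_ac)
      qed
    qed
    show "AE \<omega> in M. Q L\<^sub>2 \<omega> = x"
      using assms(15) by eventually_elim (use L in simp)
  qed (use L(2) assms(9) dQ in auto)
  \<comment> \<open>The signal takes only the values 0 and 1, hence equals its square. The square of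
    \<theta> is therefore affine in the signal, with slope
    \<open>\<alpha>\<^sup>2 + 2 * \<alpha> * \<gamma>\<close>.\<close>
  have drift: "\<theta> t \<omega> * \<mu> t \<omega> - (\<theta> t \<omega> * \<sigma>\<^sub>S)\<^sup>2 / 2 = (\<gamma> + \<alpha> * c t \<omega>) * \<mu> t \<omega> - \<gamma>\<^sup>2 * \<sigma>\<^sub>S\<^sup>2 / 2
      - (\<alpha>\<^sup>2 + 2 * \<alpha> * \<gamma>) * \<sigma>\<^sub>S\<^sup>2 / 2 * c t \<omega>" for t \<omega>
    using c01[of t \<omega>] by (auto simp: \<theta>_eq power2_eq_square field_simps)
  show ?thesis
    using Q.AE_positive Q.log_differential[unfolded drift, unfolded \<theta>_eq] unfolding c_def by blast
qed

end
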